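(* Let $D$ be a negative integer with $D\equiv1\pmod4$. (1) Let $E$ be an elliptic curve over $\mathbb{C}$ with $j(E)\in\mathbb{R}$. Then the following are equivalent: (i) $E$ has complex multiplication and $\mathrm{End}(E)$ is an order of discriminant $D$; (ii) there exists a positive saturated divisor $\beta$ of $D$ with $\beta<\sqrt{|D|}$ such that $j(E)=j(\tau)$, where $\tau=\frac12+\frac{\sqrt{|D|}}{2\beta}\mathbf{i}$. (2) Let $\mathcal{J}_D(\mathbb{R})$ be the set of $j$-invariants of all elliptic curves $E$ over $\mathbb{C}$ satisfying the equivalent conditions of (1), and let $s_D$ be the number of positive prime divisors of $D$. Then $\mathcal{J}_D(\mathbb{R})$ consists of exactly $2^{s_D-1}$ distinct real numbers and is contained in the interval $\left[j\left(\frac{1+\sqrt{|D|}\,\mathbf{i}}{2}\right),1728\right)$.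
   Context: A divisor $\beta$ of a nonzero integer $n$ is saturated if $\beta$ and $n/\beta$ are relatively prime. $j:\mathfrak{H}\to\mathbb{C}$ is the classical modular $j$-function on the upper half-plane, so that $j(\tau)$ is the $j$-invariant of the complex elliptic curve $\mathbb{C}/(\mathbb{Z}\tau+\mathbb{Z})$ (with $j(\mathbf{i})=1728$). The discriminant of an order $O$ in a quadratic field is the discriminant of the trace form $(a,b)\mapsto\mathrm{tr}(ab)$ on $O$. *)

theory Defs
  imports "HOL-Analysis.Analysis" "HOL-Algebra.Algebra" "HOL-Algebra.Algebraic_Closure_Type"
    "HOL-Number_Theory.Cong"
begin

abbreviation complex_ring :: "complex ring" where
  "complex_ring \<equiv> ring_of_type_algebra"

section \<open>Complex elliptic curves\<close>

definition lattice_spanned :: "complex \<Rightarrow> complex \<Rightarrow> complex set" where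
  "lattice_spanned \<omega>1 \<omega>2 = {of_int m * \<omega>1 + of_int n * \<omega>2 | m n. True}"

definition is_lattice :: "complex set \<Rightarrow> bool" where
  "is_lattice \<Lambda> \<longleftrightarrow>
     (\<exists>\<omega>1 \<omega>2. \<omega>1 \<noteq> \<omega>2 \<and> independent {\<omega>1, \<omega>2} \<and> \<Lambda> = lattice_spanned \<omega>1 \<omega>2)"

text \<open>
  An elliptic curve over the complex numbers is a complex torus: the quotient group of the
  additive group of complex numbers by a lattice, with the complex structure for which the
  projection is a local biholomorphism.  The points are the cosets; in particular the neutral
  element of \<open>E\<close> is the lattice itself, so that \<open>\<one>\<^bsub>E\<^esub>\<close> recovers the period lattice of \<open>E\<close>.
\<close>

definition elliptic_curve :: "complex set monoid \<Rightarrow> bool" where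
  "elliptic_curve E \<longleftrightarrow> (\<exists>\<Lambda>. is_lattice \<Lambda> \<and> E = complex_ring A_Mod \<Lambda>)"

definition torus_point :: "complex set monoid \<Rightarrow> complex \<Rightarrow> complex set" where
  "torus_point E z = \<one>\<^bsub>E\<^esub> +>\<^bsub>complex_ring\<^esub> z"

definition holomorphic_torus_map ::
  "complex set monoid \<Rightarrow> (complex set \<Rightarrow> complex set) \<Rightarrow> bool" where
  "holomorphic_torus_map E \<phi> \<longleftrightarrow>
     (\<forall>z. \<exists>U f. open U \<and> z \<in> U \<and> f holomorphic_on U \<and>
        (\<forall>w\<in>U. \<phi> (torus_point E w) = torus_point E (f w)))"

text \<open>
  The endomorphism ring, with pointwise addition and with composition as multiplication.
  Restricting to extensional functions makes equality of elements the equality of maps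
  on the points of \<open>E\<close>.
\<close>

definition End :: "complex set monoid \<Rightarrow> (complex set \<Rightarrow> complex set) ring" where
  "End E = \<lparr>
     carrier = {\<phi> \<in> hom E E. \<phi> \<in> extensional (carrier E) \<and> holomorphic_torus_map E \<phi>},
     monoid.mult = compose (carrier E),
     one = (\<lambda>P\<in>carrier E. P),
     ring.zero = (\<lambda>P\<in>carrier E. \<one>\<^bsub>E\<^esub>),
     add = (\<lambda>\<phi> \<psi>. \<lambda>P\<in>carrier E. \<phi> P \<otimes>\<^bsub>E\<^esub> \<psi> P) \<rparr>"

text \<open>Complex multiplication: some endomorphism is not multiplication by an integer.\<close>

definition has_CM :: "complex set monoid \<Rightarrow> bool" where
  "has_CM E \<longleftrightarrow> (\<exists>\<phi>\<in>carrier (End E). \<forall>n::int. \<phi> \<noteq> (\<lambda>P\<in>carrier E. P [^]\<^bsub>E\<^esub> n))"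

section \<open>The \<open>j\<close>-invariant\<close>

definition eisenstein_g2 :: "complex set \<Rightarrow> complex" where
  "eisenstein_g2 \<Lambda> = 60 * (\<Sum>\<^sub>\<infinity>\<omega>\<in>\<Lambda> - {0}. 1 / \<omega> ^ 4)"

definition eisenstein_g3 :: "complex set \<Rightarrow> complex" where
  "eisenstein_g3 \<Lambda> = 140 * (\<Sum>\<^sub>\<infinity>\<omega>\<in>\<Lambda> - {0}. 1 / \<omega> ^ 6)"

text \<open>
  The torus is isomorphic to the Weierstrass curve \<open>y\<^sup>2 = 4 x\<^sup>3 - g2 x - g3\<close>, whose
  \<open>j\<close>-invariant is the following quantity.
\<close>

definition j_invariant :: "complex set monoid \<Rightarrow> complex" where
  "j_invariant E =
     (let g2 = eisenstein_g2 \<one>\<^bsub>E\<^esub>; g3 = eisenstein_g3 \<one>\<^bsub>E\<^esub>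
      in 1728 * g2 ^ 3 / (g2 ^ 3 - 27 * g3 ^ 2))"

definition modular_j :: "complex \<Rightarrow> complex" where
  "modular_j \<tau> = j_invariant (complex_ring A_Mod lattice_spanned \<tau> 1)"

section \<open>Orders in quadratic fields\<close>

text \<open>
  Every quadratic field embeds into the complex numbers, so quadratic fields are taken to be
  subfields of the complex numbers.
\<close>

definition rat_basis :: "complex set \<Rightarrow> complex ^ 2 \<Rightarrow> bool" where
  "rat_basis K e \<longleftrightarrow> bij_betw (\<lambda>c :: rat ^ 2. \<Sum>i\<in>UNIV. of_rat (c $ i) * e $ i) UNIV K"

definition int_basis :: "complex set \<Rightarrow> complex ^ 2 \<Rightarrow> bool" where
  "int_basis A e \<longleftrightarrow> bij_betw (\<lambda>c :: int ^ 2. \<Sum>i\<in>UNIV. of_int (c $ i) * e $ i) UNIV A"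

definition quadratic_field :: "complex set \<Rightarrow> bool" where
  "quadratic_field K \<longleftrightarrow> subfield K complex_ring \<and> (\<exists>e. rat_basis K e)"

definition order_in :: "complex set \<Rightarrow> complex set \<Rightarrow> bool" where
  "order_in K A \<longleftrightarrow> subring A complex_ring \<and> (\<exists>e. int_basis A e \<and> rat_basis K e)"

text \<open>The trace of the rational-linear endomorphism of \<open>K\<close> given by multiplication by \<open>x\<close>.\<close>

definition field_trace :: "complex set \<Rightarrow> complex \<Rightarrow> rat" where
  "field_trace K x =
     (THE t. \<exists>e (M :: rat ^ 2 ^ 2). rat_basis K e \<and>
        (\<forall>j. x * e $ j = (\<Sum>i\<in>UNIV. of_rat (M $ i $ j) * e $ i)) \<and> t = trace M)"

definition order_discriminant :: "complex set \<Rightarrow> complex set \<Rightarrow> rat" where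
  "order_discriminant K A =
     (THE d. \<exists>e. int_basis A e \<and>
        d = det ((\<chi> i j. field_trace K (e $ i * e $ j)) :: rat ^ 2 ^ 2))"

text \<open>The ring \<open>R\<close> is (isomorphic to) an order of discriminant \<open>D\<close> in a quadratic field.\<close>

definition is_order_of_discriminant :: "'a ring \<Rightarrow> int \<Rightarrow> bool" where
  "is_order_of_discriminant R D \<longleftrightarrow>
     (\<exists>K A. quadratic_field K \<and> order_in K A \<and> order_discriminant K A = of_int D \<and>
        R \<simeq> complex_ring\<lparr>carrier := A\<rparr>)"

section \<open>Saturated divisors and real \<open>j\<close>-invariants\<close>

definition saturated_divisor :: "int \<Rightarrow> int \<Rightarrow> bool" where
  "saturated_divisor \<beta> n \<longleftrightarrow> \<beta> dvd n \<and> coprime \<beta> (n div \<beta>)"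

definition real_CM_j_invariants :: "int \<Rightarrow> real set" where
  "real_CM_j_invariants D =
     {x. \<exists>E. elliptic_curve E \<and> j_invariant E = complex_of_real x \<and>
             has_CM E \<and> is_order_of_discriminant (End E) D}"

end

theory Submission
  imports Defs "HOL-Complex_Analysis.Complex_Analysis"
begin

text \<open>
  The Weierstrass function of a lattice satisfies \<open>\<wp>'' = 6 \<wp>\<^sup>2 - g2 / 2\<close> (by Liouville's theorem), and this
  equation determines all its Laurent coefficients from \<open>g2\<close> and \<open>g3\<close>; hence these determine the pole
  set, which is the lattice, and \<open>j\<close> determines a lattice up to homothety.  In particular \<open>j\<close> is real
  exactly for the lattices homothetic to their complex conjugate, that is, up to homothety, for the
  rectangular and the rhombic ones.

  The endomorphism ring of \<open>\<complex> / L\<close> is the ring of multipliers of \<open>L\<close>.  A rectangular lattice does not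
  admit \<open>(1 + \<surd>D) / 2\<close> as a multiplier; for the rhombic lattice spanned by \<open>\<tau> = 1/2 + t \<i>\<close> and \<open>1\<close> the
  multiplier ring has discriminant \<open>D\<close> if and only if \<open>\<beta> \<tau>\<^sup>2 - \<beta> \<tau> + w = 0\<close> with \<open>\<beta>\<close>, \<open>w\<close> coprime and
  \<open>\<beta> (\<beta> - 4 w) = D\<close>, which makes \<open>\<beta>\<close> a saturated divisor of \<open>D\<close>.  Replacing \<open>t\<close> by \<open>1 / (4 t)\<close>, a homothety,
  exchanges \<open>\<beta>\<close> and \<open>|D| / \<beta>\<close>.

  Finally \<open>t \<mapsto> j(1/2 + t \<i>)\<close> is continuous and injective for \<open>t \<ge> 1/2\<close>, hence strictly monotone; it is
  decreasing from the value 1728 at \<open>t = 1/2\<close>, since it vanishes at \<open>t = \<surd>3 / 2\<close>.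
\<close>

text \<open>Division by zero yields zero, so equal values of \<open>lattice_j\<close> compare
  lattices only once its denominator is known not to vanish; hence the section on the discriminant.
  Counting zeros of elliptic functions is avoided there: a double root a of the Weierstrass cubic
  would turn the reciprocal of \<open>wp L\<close> - a into a solution of a linear equation with
  constant coefficients, and such solutions are explicit. Injectivity of j along Re \<tau> = 1/2
  needs no q-expansion: the classification up to homothety turns it into arithmetic of integer
  matrices. The congruence D = 1 (mod 4) acts in several places. It gives the generator of the order
  real part 1/2, which is what excludes rectangular lattices; it makes \<beta> odd and 4 a divisor
  of \<beta> + |D| / \<beta>, so that w is an integer; and since |D| = 3 (mod 4) is never a square,
  \<beta> and |D| / \<beta> differ, which pairs off the divisors and keeps the point t = 1/2, hence
  the value 1728, out of the set.\<close>

section \<open>Lattices in the complex plane\<close>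

text \<open>The function theory is developed without a basis. Summability of the inverse cubes
  carries discreteness; cocompactness makes a continuous periodic function bounded and later
  prevents the lattice from lying on a line.\<close>

locale complex_lattice =
  fixes L :: "complex set"
  assumes zero_mem [simp]: "0 \<in> L"
    and diff_mem: "x \<in> L \<Longrightarrow> y \<in> L \<Longrightarrow> x - y \<in> L"
    and summable_cubes: "(\<lambda>w. 1 / norm w ^ 3) summable_on (L - {0})"
    and cocompact: "\<exists>R>0. \<forall>z. \<exists>w\<in>L. norm (z - w) \<le> R"
begin

lemma uminus_mem: "x \<in> L \<Longrightarrow> - x \<in> L"
  using diff_mem[of 0 x] by simp

lemma add_mem: "x \<in> L \<Longrightarrow> y \<in> L \<Longrightarrow> x + y \<in> L"
  using diff_mem[of x "-y"] uminus_mem by simp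

text \<open>The summands are bounded below by a positive constant on a ball, so a convergent sum has
  room for only finitely many of them.\<close>

lemma finite_cball: "finite (L \<inter> cball 0 r)"
proof (cases "r > 0")
  case True
  have s: "(\<lambda>w. 1 / norm w ^ 3) summable_on (L \<inter> cball 0 r - {0})"
    by (rule summable_on_subset_banach[OF summable_cubes]) auto
  have "(\<lambda>w::complex. 1 / r ^ 3) summable_on (L \<inter> cball 0 r - {0})"
  proof (rule summable_on_comparison_test[OF s])
    fix x assume "x \<in> L \<inter> cball 0 r - {0}"
    then show "1 / r ^ 3 \<le> 1 / norm x ^ 3"
      using True by (intro divide_left_mono mult_pos_pos zero_less_power power_mono) auto
  qed (use True in auto)
  then have "finite (L \<inter> cball 0 r - {0})"
    using True infsum_diverge_constant[of "L \<inter> cball 0 r - {0}" "1 / r ^ 3"] by auto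
  then show ?thesis by simp
next
  case False
  then have "L \<inter> cball 0 r \<subseteq> {0}"
    by auto (metis norm_ge_zero norm_le_zero_iff order.trans linorder_not_less)
  then show ?thesis using finite_subset by blast
qed

lemma countable: "countable L"
proof -
  have "L = (\<Union>n::nat. L \<inter> cball 0 (real n))"
    using real_arch_simple by fastforce
  moreover have "countable (\<Union>n::nat. L \<inter> cball 0 (real n))"
    using finite_cball by (intro countable_UN) (auto intro: countable_finite)
  ultimately show ?thesis by simp
qed

lemma closed_subset_lattice: "A \<subseteq> L \<Longrightarrow> closed A"
proof -
  assume A: "A \<subseteq> L"
  have "\<not> x islimpt A" for x
  proof
    assume "x islimpt A"
    then have "infinite (A \<inter> ball x 1)"
      by (simp add: islimpt_eq_infinite_ball)
    moreover have "A \<inter> ball x 1 \<subseteq> L \<inter> cball 0 (norm x + 1)"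
      using A by (auto simp: dist_norm) (smt (verit) norm_minus_commute norm_triangle_sub)
    ultimately show False using finite_cball finite_subset by blast
  qed
  then show ?thesis by (simp add: closed_limpt)
qed

lemma open_Compl_subset: "A \<subseteq> L \<Longrightarrow> open (- A)"
  using closed_subset_lattice by auto

lemma summable_powers: 
  assumes "k \<ge> 3" shows "(\<lambda>w. 1 / norm w ^ k) summable_on (L - {0})"
proof -
  have fin: "finite (L \<inter> cball 0 1 - {0})" using finite_cball by auto
  have "(\<lambda>w. 1 / norm w ^ k) summable_on (L - cball 0 1)"
  proof (rule summable_on_comparison_test)
    show "(\<lambda>w. 1 / norm w ^ 3) summable_on (L - cball 0 1)"
      by (rule summable_on_subset_banach[OF summable_cubes]) auto
    fix x assume "x \<in> L - cball 0 1"
    then show "1 / norm x ^ k \<le> 1 / norm x ^ 3"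
      using assms by (intro divide_left_mono mult_pos_pos zero_less_power power_increasing) auto
  qed auto
  moreover have "L - {0} = (L \<inter> cball 0 1 - {0}) \<union> (L - cball 0 1)" by auto
  ultimately show ?thesis using fin
    by (metis (no_types, lifting) summable_on_union summable_on_finite)
qed

end

text \<open>\<open>Im (w1 * cnj w2)\<close> is, up to sign, the area of the period parallelogram, a
  determinant that is easier to carry through computations than real independence.\<close>

lemma independent_iff_Im:
  "(w1 \<noteq> w2 \<and> independent {w1, w2}) \<longleftrightarrow> Im (w1 * cnj w2) \<noteq> 0"
proof
  assume *: "w1 \<noteq> w2 \<and> independent {w1, w2}"
  show "Im (w1 * cnj w2) \<noteq> 0"
  proof
    assume i: "Im (w1 * cnj w2) = 0"
    have w2: "w2 \<noteq> 0" using * dependent_zero[of "{w1,w2}"] by auto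
    have "w1 = (w1 * cnj w2) / (w2 * cnj w2) * w2" using w2 by simp
    also have "w1 * cnj w2 = of_real (Re (w1 * cnj w2))"
      using i by (simp add: complex_eq_iff)
    finally have "w1 = of_real (Re (w1 * cnj w2) / (norm w2)^2) * w2"
      by (simp only: complex_norm_square[symmetric] of_real_divide of_real_power)
    then have "w1 \<in> span {w2}"
      by (metis scaleR_conv_of_real insertI1 span_base span_scale)
    then have "dependent {w1, w2}"
      using * unfolding dependent_def by (intro bexI[of _ w1]) (auto simp: insert_Diff_if)
    with * show False by simp
  qed
next
  assume i: "Im (w1 * cnj w2) \<noteq> 0"
  then have ne: "w1 \<noteq> w2" "w2 \<noteq> 0" by (auto simp: algebra_simps)
  moreover have "w1 \<notin> span {w2}"
  proof
    assume "w1 \<in> span {w2}"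
    then obtain k where "w1 = k *\<^sub>R w2" by (auto simp: span_singleton)
    then show False using i by (simp add: algebra_simps)
  qed
  ultimately show "w1 \<noteq> w2 \<and> independent {w1, w2}"
    by (simp add: independent_insert)
qed

lemma is_lattice_iff: 
  "is_lattice L \<longleftrightarrow> (\<exists>w1 w2. Im (w1 * cnj w2) \<noteq> 0 \<and> L = lattice_spanned w1 w2)"
  unfolding is_lattice_def independent_iff_Im[symmetric] by simp

text \<open>Cramer's rule: pairing a lattice vector with \<open>cnj w2\<close> or
  \<open>cnj w1\<close> and taking imaginary parts isolates |m| or |n| times the area
  \<open>A\<close>, and each pairing is at most the norm times |w1| + |w2|.\<close>

lemma lattice_spanned_norm_bound:
  assumes "Im (w1 * cnj w2) \<noteq> 0"
  obtains d where "d > 0" "\<And>m n :: int. norm (of_int m * w1 + of_int n * w2) \<ge> d * real_of_int (max \<bar>m\<bar> \<bar>n\<bar>)"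
proof
  define A where "A = \<bar>Im (w1 * cnj w2)\<bar>"
  define d where "d = A / (norm w1 + norm w2)"
  have "A > 0" using assms by (simp add: A_def)
  have "w1 \<noteq> 0" using assms by auto
  then have pos: "norm w1 + norm w2 > 0" by (simp add: add_pos_nonneg)
  show "d > 0" using \<open>A > 0\<close> pos by (simp add: d_def)
  fix m n :: int
  define z where "z = of_int m * w1 + of_int n * w2"
  have "\<bar>real_of_int m\<bar> * A = \<bar>Im (z * cnj w2)\<bar>"
    by (simp add: z_def A_def abs_mult[symmetric]) (simp add: algebra_simps)
  also have "\<dots> \<le> norm z * norm w2"
    by (metis abs_Im_le_cmod complex_mod_cnj norm_mult)
  finally have 1: "\<bar>real_of_int m\<bar> * A \<le> norm z * (norm w1 + norm w2)"
    by (smt (verit) mult_left_mono norm_ge_zero)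
  have "\<bar>real_of_int n\<bar> * A = \<bar>Im (z * cnj w1)\<bar>"
    by (simp add: z_def A_def abs_mult[symmetric]) (simp add: algebra_simps abs_if)
  also have "\<dots> \<le> norm z * norm w1"
    by (metis abs_Im_le_cmod complex_mod_cnj norm_mult)
  finally have 2: "\<bar>real_of_int n\<bar> * A \<le> norm z * (norm w1 + norm w2)"
    by (smt (verit) mult_left_mono norm_ge_zero)
  have "real_of_int (max \<bar>m\<bar> \<bar>n\<bar>) * A \<le> norm z * (norm w1 + norm w2)"
    using 1 2 by (auto simp: max_def)
  then show "norm z \<ge> d * real_of_int (max \<bar>m\<bar> \<bar>n\<bar>)"
    using pos by (simp add: d_def field_simps)
qed

lemma bij_betw_lattice_spanned:
  assumes im: "Im (w1 * cnj w2) \<noteq> 0"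
  shows "bij_betw (\<lambda>(m::int, n::int). of_int m * w1 + of_int n * w2) (UNIV - {(0, 0)}) (lattice_spanned w1 w2 - {0})"
proof -
  obtain d where d: "d > 0" "\<And>m n :: int. norm (of_int m * w1 + of_int n * w2) \<ge> d * real_of_int (max \<bar>m\<bar> \<bar>n\<bar>)"
    using lattice_spanned_norm_bound[OF im] by blast
  define g where "g = (\<lambda>(m::int,n::int). of_int m * w1 + of_int n * w2)"
  have g0: "g p = 0 \<Longrightarrow> p = (0,0)" for p
    using d(2)[of "fst p" "snd p"] d(1) by (auto simp: g_def case_prod_beta' mult_le_0_iff prod_eq_iff)
  have inj: "inj g"
  proof (rule injI)
    fix p q assume "g p = g q"
    then have "g (fst p - fst q, snd p - snd q) = 0" by (simp add: g_def case_prod_beta' algebra_simps)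
    from g0[OF this] show "p = q" by (simp add: prod_eq_iff)
  qed
  have "lattice_spanned w1 w2 = g ` UNIV" by (auto simp: lattice_spanned_def g_def)
  moreover have "{0} = g ` {(0,0)}" by (simp add: g_def)
  ultimately have "lattice_spanned w1 w2 - {0} = g ` (UNIV - {(0,0)})"
    using image_set_diff[OF inj] by metis
  then show ?thesis using inj_on_subset[OF inj] unfolding bij_betw_def g_def[symmetric] by simp
qed

text \<open>The cube is split into two powers of exponent 3/2 > 1, one for each coordinate: with M
  the maximum norm, both 1 + |m| and 1 + |n| are at most 2 M away from the origin, so
  \<open>8 * (f m * f n)\<close> dominates. The summand at the origin is 0 by the convention for
  division.\<close>

lemma summable_int_pairs_max:
  "(\<lambda>(m::int, n::int). 1 / real_of_int (max \<bar>m\<bar> \<bar>n\<bar>) ^ 3) summable_on UNIV"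
proof -
  define f where "f = (\<lambda>m::int. (1 + real_of_int \<bar>m\<bar>) powr (-3/2))"
  have nat: "(\<lambda>n::nat. (1 + real n) powr (-3/2)) summable_on UNIV"
  proof (rule norm_summable_imp_summable_on)
    have "summable (\<lambda>n. real (Suc n) powr (-3/2))"
      using summable_real_powr_iff[of "-3/2"] by (subst summable_Suc_iff) simp
    then show "summable (\<lambda>n. norm ((1 + real n) powr (- 3 / 2)))" by (simp add: add.commute)
  qed
  have "f summable_on (range int)"
    using nat by (subst summable_on_reindex) (auto simp: f_def o_def)
  moreover have "f summable_on (range (\<lambda>n. - int n))"
    using nat by (subst summable_on_reindex) (auto simp: f_def o_def inj_on_def)
  moreover have "UNIV = range int \<union> range (\<lambda>n. - int n)"
  proof -
    have "x \<in> range int \<union> range (\<lambda>n. - int n)" for x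
      by (cases x rule: int_cases2) auto
    then show ?thesis by auto
  qed
  ultimately have sf: "f summable_on UNIV"
    by (metis summable_on_union)
  have fn: "f x \<ge> 0" for x by (simp add: f_def)
  have "(\<lambda>(m,n). f m * f n) summable_on (UNIV \<times> UNIV)"
  proof (rule summable_on_SigmaI)
    show "((\<lambda>n. case (m, n) of (m, n) \<Rightarrow> f m * f n) has_sum f m * infsum f UNIV) UNIV" for m
      using has_sum_cmult_right[OF has_sum_infsum[OF sf]] by simp
    show "(\<lambda>m. f m * infsum f UNIV) summable_on UNIV"
      by (rule summable_on_cmult_left[OF sf])
  qed (use fn in auto)
  then have s: "(\<lambda>(m,n). 8 * (f m * f n)) summable_on UNIV"
    using summable_on_cmult_right[of "\<lambda>(m,n). f m * f n" UNIV 8] by (simp add: case_prod_beta')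
  show ?thesis
  proof (rule summable_on_comparison_test[OF s], clarify)
    fix m n :: int
    define M where "M = real_of_int (max \<bar>m\<bar> \<bar>n\<bar>)"
    show "1 / real_of_int (max \<bar>m\<bar> \<bar>n\<bar>) ^ 3 \<le> 8 * (f m * f n)"
    proof (cases "m = 0 \<and> n = 0")
      case False
      then have M1: "M \<ge> 1" by (auto simp: M_def)
      have "1 / (2*M) ^ 3 = (2*M) powr (-3/2) * (2*M) powr (-3/2)"
        using M1 powr_minus_divide[of "2*M" 3] by (simp only: powr_add[symmetric]) simp
      also have "\<dots> \<le> f m * f n"
        unfolding f_def using M1
        by (intro mult_mono powr_mono2') (auto simp: M_def)
      finally have "1 / (8 * M ^ 3) \<le> f m * f n" by (simp add: power_mult_distrib)
      then have "1 / M ^ 3 \<le> 8 * (f m * f n)" by simp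
      then show ?thesis by (simp add: M_def)
    next
      case True
      show ?thesis using mult_nonneg_nonneg[OF fn fn, of m n] True by simp
    qed
  qed (simp add: case_prod_beta')
qed

lemma complex_lattice_spanned:
  assumes im: "Im (w1 * cnj w2) \<noteq> 0"
  shows "complex_lattice (lattice_spanned w1 w2)"
proof
  show "0 \<in> lattice_spanned w1 w2"
    unfolding lattice_spanned_def by (auto intro!: exI[of _ 0])
  fix x y assume "x \<in> lattice_spanned w1 w2" "y \<in> lattice_spanned w1 w2"
  then obtain m n m' n' :: int where "x = of_int m * w1 + of_int n * w2" "y = of_int m' * w1 + of_int n' * w2"
    unfolding lattice_spanned_def by blast
  then have "x - y = of_int (m - m') * w1 + of_int (n - n') * w2" by (simp add: algebra_simps)
  then show "x - y \<in> lattice_spanned w1 w2" unfolding lattice_spanned_def by blast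
next
  obtain d where d: "d > 0" "\<And>m n :: int. norm (of_int m * w1 + of_int n * w2) \<ge> d * real_of_int (max \<bar>m\<bar> \<bar>n\<bar>)"
    using lattice_spanned_norm_bound[OF im] by blast
  define g where "g = (\<lambda>(m::int,n::int). of_int m * w1 + of_int n * w2)"
  have bij: "bij_betw g (UNIV - {(0, 0)}) (lattice_spanned w1 w2 - {0})"
    using bij_betw_lattice_spanned[OF im] by (simp add: g_def)
  have "(\<lambda>p. 1 / norm (g p) ^ 3) summable_on (UNIV - {(0,0)})"
  proof (rule summable_on_comparison_test)
    have "(\<lambda>p. 1 / d^3 * (\<lambda>(m::int, n::int). 1 / real_of_int (max \<bar>m\<bar> \<bar>n\<bar>) ^ 3) p) summable_on UNIV"
      by (rule summable_on_cmult_right[OF summable_int_pairs_max])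
    then show "(\<lambda>p. 1 / d^3 * (\<lambda>(m::int, n::int). 1 / real_of_int (max \<bar>m\<bar> \<bar>n\<bar>) ^ 3) p) summable_on (UNIV - {(0,0)})"
      by (rule summable_on_subset_banach) auto
    fix p :: "int \<times> int" assume p: "p \<in> UNIV - {(0,0)}"
    define M where "M = real_of_int (max \<bar>fst p\<bar> \<bar>snd p\<bar>)"
    have M: "M > 0" using p by (cases p) (auto simp: M_def)
    have "d * M \<le> norm (g p)"
      using d(2)[of "fst p" "snd p"] by (simp add: g_def case_prod_beta' M_def)
    moreover have "d * M > 0" using d(1) M by simp
    ultimately have "1 / norm (g p) ^ 3 \<le> 1 / (d * M) ^ 3"
      by (intro divide_left_mono power_mono mult_pos_pos[OF zero_less_power zero_less_power]) auto
    also have "\<dots> = 1 / d^3 * (1 / M ^ 3)" by (simp add: power_mult_distrib)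
    finally show "1 / norm (g p) ^ 3 \<le> 1 / d^3 * (\<lambda>(m::int, n::int). 1 / real_of_int (max \<bar>m\<bar> \<bar>n\<bar>) ^ 3) p"
      unfolding M_def case_prod_beta' .
  qed simp
  then show "(\<lambda>w. 1 / norm w ^ 3) summable_on lattice_spanned w1 w2 - {0}"
    using summable_on_reindex_bij_betw[OF bij, of "\<lambda>w. 1 / norm w ^ 3"] by simp
next
  define I where "I = Im (w1 * cnj w2)"
  have "w1 \<noteq> 0" using im by auto
  then have "norm w1 + norm w2 > 0" by (simp add: add_pos_nonneg)
  moreover have "\<exists>w\<in>lattice_spanned w1 w2. norm (z - w) \<le> norm w1 + norm w2" for z
  proof -
    \<comment> \<open>Cramer's rule again: \<open>x\<close> and \<open>y\<close> are the real
      coordinates of \<open>z\<close> in the basis; rounding them down leaves a remainder in the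
      period parallelogram.\<close>
    define x where "x = Im (z * cnj w2) / I"
    define y where "y = - Im (z * cnj w1) / I"
    have "I \<noteq> 0" using im by (simp add: I_def)
    have "of_real I * z = of_real (Im (z * cnj w2)) * w1 - of_real (Im (z * cnj w1)) * w2"
      unfolding I_def by (simp add: complex_eq_iff algebra_simps)
    then have z: "z = of_real x * w1 + of_real y * w2"
      using \<open>I \<noteq> 0\<close> by (simp add: x_def y_def field_simps)
    define w where "w = of_int \<lfloor>x\<rfloor> * w1 + of_int \<lfloor>y\<rfloor> * w2"
    have "z - w = of_real (x - \<lfloor>x\<rfloor>) * w1 + of_real (y - \<lfloor>y\<rfloor>) * w2"
      unfolding z w_def by (simp add: algebra_simps)
    also have "norm \<dots> \<le> \<bar>x - \<lfloor>x\<rfloor>\<bar> * norm w1 + \<bar>y - \<lfloor>y\<rfloor>\<bar> * norm w2"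
      by (rule norm_triangle_ineq[THEN order_trans]) (simp only: norm_mult norm_of_real order_refl)
    also have "\<dots> \<le> 1 * norm w1 + 1 * norm w2"
      by (intro add_mono mult_right_mono norm_ge_zero) linarith+
    finally have "norm (z - w) \<le> norm w1 + norm w2" by simp
    moreover have "w \<in> lattice_spanned w1 w2" by (auto simp: w_def lattice_spanned_def)
    ultimately show ?thesis by blast
  qed
  ultimately show "\<exists>R>0. \<forall>z. \<exists>w\<in>lattice_spanned w1 w2. norm (z - w) \<le> R" by blast
qed

lemma is_lattice_imp_complex_lattice: "is_lattice L \<Longrightarrow> complex_lattice L"
  unfolding is_lattice_iff by (elim exE conjE, hypsubst, rule complex_lattice_spanned)

lemma scale_lattice_spanned: "(*) c ` lattice_spanned w1 w2 = lattice_spanned (c * w1) (c * w2)"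
proof -
  have "lattice_spanned a b = (\<lambda>(m::int,n::int). of_int m * a + of_int n * b) ` UNIV" for a b
    by (auto simp: lattice_spanned_def)
  then show ?thesis by (simp add: image_image case_prod_beta' algebra_simps)
qed

lemma cnj_lattice_spanned: "cnj ` lattice_spanned w1 w2 = lattice_spanned (cnj w1) (cnj w2)"
proof -
  have "lattice_spanned a b = (\<lambda>(m::int,n::int). of_int m * a + of_int n * b) ` UNIV" for a b
    by (auto simp: lattice_spanned_def)
  then show ?thesis by (simp add: image_image case_prod_beta')
qed

lemma Im_mult_real: "Im (of_real x * z) = x * Im z"
  by simp

lemma is_lattice_scale:
  assumes "is_lattice L" "c \<noteq> 0"
  shows "is_lattice ((*) c ` L)"
proof -
  obtain w1 w2 where w: "Im (w1 * cnj w2) \<noteq> 0" "L = lattice_spanned w1 w2"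
    using assms is_lattice_iff by blast
  have "(c * w1) * cnj (c * w2) = of_real ((norm c)^2) * (w1 * cnj w2)"
    by (simp only: complex_norm_square complex_cnj_mult mult_ac)
  then have "Im ((c * w1) * cnj (c * w2)) \<noteq> 0"
    using w assms by (simp only: Im_mult_real) simp
  then show ?thesis unfolding w(2) scale_lattice_spanned is_lattice_iff by blast
qed

lemma is_lattice_cnj:
  assumes "is_lattice L"
  shows "is_lattice (cnj ` L)"
proof -
  obtain w1 w2 where w: "Im (w1 * cnj w2) \<noteq> 0" "L = lattice_spanned w1 w2"
    using assms is_lattice_iff by blast
  have "Im (cnj w1 * cnj (cnj w2)) \<noteq> 0"
    using w(1) by (simp add: algebra_simps)
  then show ?thesis unfolding w(2) cnj_lattice_spanned is_lattice_iff by blast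
qed

lemma is_lattice_tau: "Im \<tau> \<noteq> 0 \<Longrightarrow> is_lattice (lattice_spanned \<tau> 1)"
  unfolding is_lattice_iff by (intro exI[of _ \<tau>] exI[of _ 1]) simp

section \<open>The Weierstrass function\<close>

lemma higher_deriv_sum:
  fixes f :: "'i \<Rightarrow> complex \<Rightarrow> complex"
  assumes S: "open S" and "z \<in> S" and "finite I" and "\<And>i. i \<in> I \<Longrightarrow> f i holomorphic_on S"
  shows "(deriv ^^ n) (\<lambda>z. \<Sum>i\<in>I. f i z) z = (\<Sum>i\<in>I. (deriv ^^ n) (f i) z)"
  using assms(3,4)
proof (induction I rule: finite_induct)
  case empty
  then show ?case by (simp add: higher_deriv_const)
next
  case (insert x F)
  then have "(\<lambda>z. \<Sum>i\<in>F. f i z) holomorphic_on S" "f x holomorphic_on S"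
    by (auto intro!: holomorphic_intros)
  then have "(deriv ^^ n) (\<lambda>z. f x z + (\<Sum>i\<in>F. f i z)) z = (deriv ^^ n) (f x) z + (deriv ^^ n) (\<lambda>z. \<Sum>i\<in>F. f i z) z"
    using higher_deriv_add[of "f x" S _ z n] S \<open>z \<in> S\<close> by blast
  then show ?case using insert by simp
qed

text \<open>The summable bound may fail for finitely many indices, later the lattice points near
  \<open>x\<close>. Those terms are bounded on a compact disc inside \<open>S\<close> instead, after
  which the M-test covers the whole sum.\<close>

lemma uniform_limit_infsum_near:
  fixes f :: "'i \<Rightarrow> complex \<Rightarrow> complex"
  assumes S: "open S" and f: "\<And>i. i \<in> I \<Longrightarrow> f i holomorphic_on S"
    and loc: "\<And>x. x \<in> S \<Longrightarrow> \<exists>r>0. \<exists>A M. finite A \<and> M summable_on I \<and>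
                (\<forall>i\<in>I-A. \<forall>y\<in>ball x r \<inter> S. norm (f i y) \<le> M i)"
    and x: "x \<in> S"
  obtains d where "d > 0" "cball x d \<subseteq> S"
    "uniform_limit (cball x d) (\<lambda>Y y. \<Sum>i\<in>Y. f i y) (\<lambda>y. \<Sum>\<^sub>\<infinity>i\<in>I. f i y) (finite_subsets_at_top I)"
proof -
  obtain r A M where r: "r > 0" and A: "finite A" and M: "M summable_on I"
    and bound: "\<And>i y. i \<in> I - A \<Longrightarrow> y \<in> ball x r \<inter> S \<Longrightarrow> norm (f i y) \<le> M i"
    using loc[OF x] by metis
  obtain e where e: "e > 0" "cball x e \<subseteq> S" using S x open_contains_cball by blast
  define d where "d = min e (r/2)"
  have d: "d > 0" "cball x d \<subseteq> S" "cball x d \<subseteq> ball x r"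
    using e r by (auto simp: d_def)
  have "\<exists>B. \<forall>y\<in>cball x d. norm (f i y) \<le> B" if "i \<in> I" for i
  proof -
    have "continuous_on (cball x d) (f i)"
      using f[OF that] d(2) holomorphic_on_imp_continuous_on continuous_on_subset by blast
    then have "bounded (f i ` cball x d)"
      by (intro compact_imp_bounded compact_continuous_image) auto
    then show ?thesis by (auto simp: bounded_iff)
  qed
  then obtain B where B: "\<And>i y. i \<in> I \<Longrightarrow> y \<in> cball x d \<Longrightarrow> norm (f i y) \<le> B i" by metis
  define M' where "M' = (\<lambda>i. if i \<in> A then B i else M i)"
  have "M' summable_on (I - A)"
    using summable_on_subset_banach[OF M, of "I - A"] summable_on_cong[of "I - A" M' M] by (simp add: M'_def)
  moreover have "M' summable_on (I \<inter> A)" using A by (intro summable_on_finite) auto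
  ultimately have "M' summable_on ((I - A) \<union> (I \<inter> A))" by (rule summable_on_union)
  moreover have "(I - A) \<union> (I \<inter> A) = I" by auto
  ultimately have M': "M' summable_on I" by simp
  have "uniform_limit (cball x d) (\<lambda>Y y. \<Sum>i\<in>Y. f i y) (\<lambda>y. \<Sum>\<^sub>\<infinity>i\<in>I. f i y) (finite_subsets_at_top I)"
  proof (rule Weierstrass_m_test_general[OF _ M'])
    fix i y assume iy: "i \<in> I" "y \<in> cball x d"
    then have "y \<in> ball x r \<inter> S" using d(2,3) by blast
    then show "norm (f i y) \<le> M' i" using B[OF iy] bound[of i y] iy(1) by (simp add: M'_def)
  qed
  then show ?thesis using that d by blast
qed

lemma
  fixes f :: "'i \<Rightarrow> complex \<Rightarrow> complex"
  assumes S: "open S" and f: "\<And>i. i \<in> I \<Longrightarrow> f i holomorphic_on S"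
    and loc: "\<And>x. x \<in> S \<Longrightarrow> \<exists>r>0. \<exists>A M. finite A \<and> M summable_on I \<and>
                (\<forall>i\<in>I-A. \<forall>y\<in>ball x r \<inter> S. norm (f i y) \<le> M i)"
  shows holomorphic_on_infsum: "(\<lambda>z. \<Sum>\<^sub>\<infinity>i\<in>I. f i z) holomorphic_on S"
    and has_sum_higher_deriv:
      "z \<in> S \<Longrightarrow> ((\<lambda>i. (deriv ^^ n) (f i) z) has_sum (deriv ^^ n) (\<lambda>z. \<Sum>\<^sub>\<infinity>i\<in>I. f i z) z) I"
proof -
  have ev: "eventually (\<lambda>Y. finite Y \<and> Y \<subseteq> I) (finite_subsets_at_top I)"
    by (rule eventually_finite_subsets_at_top_weakI) auto
  have "\<exists>d>0. (\<lambda>z. \<Sum>\<^sub>\<infinity>i\<in>I. f i z) holomorphic_on ball x d" if x: "x \<in> S" for x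
  proof -
    obtain d where d: "d > 0" "cball x d \<subseteq> S"
      and ul: "uniform_limit (cball x d) (\<lambda>Y y. \<Sum>i\<in>Y. f i y) (\<lambda>y. \<Sum>\<^sub>\<infinity>i\<in>I. f i y) (finite_subsets_at_top I)"
      using uniform_limit_infsum_near[OF assms x] by blast
    have hol: "(\<lambda>y. \<Sum>i\<in>Y. f i y) holomorphic_on cball x d" if "Y \<subseteq> I" for Y
      using that d by (intro holomorphic_on_sum) (meson f holomorphic_on_subset subsetD)
    have "eventually (\<lambda>Y. continuous_on (cball x d) (\<lambda>y. \<Sum>i\<in>Y. f i y) \<and> (\<lambda>y. \<Sum>i\<in>Y. f i y) holomorphic_on ball x d) (finite_subsets_at_top I)"
      using ev
    proof eventually_elim
      case (elim Y)
      then have "(\<lambda>y. \<Sum>i\<in>Y. f i y) holomorphic_on cball x d" using hol by blast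
      then show ?case
        using holomorphic_on_imp_continuous_on holomorphic_on_subset ball_subset_cball by blast
    qed
    from holomorphic_uniform_limit[OF this ul] d(1) show ?thesis by (metis finite_subsets_at_top_neq_bot)
  qed
  then show "(\<lambda>z. \<Sum>\<^sub>\<infinity>i\<in>I. f i z) holomorphic_on S"
    using S by (simp add: holomorphic_on_open)
      (metis centre_in_ball holomorphic_on_open open_ball)
  assume z: "z \<in> S"
  obtain d where d: "d > 0" "cball z d \<subseteq> S"
      and ul: "uniform_limit (cball z d) (\<lambda>Y y. \<Sum>i\<in>Y. f i y) (\<lambda>y. \<Sum>\<^sub>\<infinity>i\<in>I. f i y) (finite_subsets_at_top I)"
    using uniform_limit_infsum_near[OF assms z] by blast
  have f': "f i holomorphic_on ball z d" if "i \<in> I" for i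
    using f[OF that] d(2) by (meson ball_subset_cball holomorphic_on_subset order.trans)
  have "((\<lambda>Y. (deriv ^^ n) (\<lambda>y. \<Sum>i\<in>Y. f i y) z) \<longlongrightarrow> (deriv ^^ n) (\<lambda>z. \<Sum>\<^sub>\<infinity>i\<in>I. f i z) z) (finite_subsets_at_top I)"
  proof (rule higher_deriv_complex_uniform_limit)
    show "uniform_limit (ball z d) (\<lambda>Y y. \<Sum>i\<in>Y. f i y) (\<lambda>z. \<Sum>\<^sub>\<infinity>i\<in>I. f i z) (finite_subsets_at_top I)"
      using ul by (rule uniform_limit_on_subset) auto
    show "\<forall>\<^sub>F Y in finite_subsets_at_top I. (\<lambda>y. \<Sum>i\<in>Y. f i y) holomorphic_on ball z d"
      using ev by eventually_elim (auto intro!: holomorphic_on_sum f')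
  qed (use d in auto)
  moreover have "\<forall>\<^sub>F Y in finite_subsets_at_top I. (deriv ^^ n) (\<lambda>y. \<Sum>i\<in>Y. f i y) z = (\<Sum>i\<in>Y. (deriv ^^ n) (f i) z)"
    using ev by eventually_elim (rule higher_deriv_sum[of "ball z d"], use f' d(1) in auto)
  ultimately show "((\<lambda>i. (deriv ^^ n) (f i) z) has_sum (deriv ^^ n) (\<lambda>z. \<Sum>\<^sub>\<infinity>i\<in>I. f i z) z) I"
    unfolding has_sum_def using tendsto_cong[of "\<lambda>Y. (deriv ^^ n) (\<lambda>y. \<Sum>i\<in>Y. f i y) z"] by fastforce
qed

lemma DERIV_inverse_power:
  fixes z w K :: complex
  assumes "z \<noteq> w"
  shows "((\<lambda>z. K / (z - w) ^ n) has_field_derivative - of_nat n * K / (z - w) ^ Suc n) (at z)"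
proof (cases n)
  case (Suc m)
  have *: "((\<lambda>z. K / z ^ n) has_field_derivative - of_nat n * K / u ^ Suc n) (at u)" if "u \<noteq> 0" for u
  proof -
    have "((\<lambda>z. K / z ^ Suc m) has_field_derivative
        (0 * u ^ Suc m - K * (of_nat (Suc m) * u ^ m)) / (u ^ Suc m * u ^ Suc m)) (at u)"
    proof (intro DERIV_divide DERIV_const)
      show "((\<lambda>z. z ^ Suc m) has_field_derivative of_nat (Suc m) * u ^ m) (at u)"
        by (rule DERIV_cong[OF DERIV_power_Suc[OF DERIV_ident]]) simp
    qed (use that in auto)
    moreover have "(0 * u ^ Suc m - K * (of_nat (Suc m) * u ^ m)) / (u ^ Suc m * u ^ Suc m)
        = - of_nat n * K / u ^ Suc n"
      using that Suc by (simp add: field_simps)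
    ultimately show ?thesis unfolding Suc by (rule DERIV_cong)
  qed
  have "((\<lambda>z. z - w) has_field_derivative 1) (at z)" by (auto intro!: derivative_eq_intros)
  from DERIV_chain2[OF * this] show ?thesis using assms by simp
qed simp

lemmas deriv_inverse_power = DERIV_imp_deriv[OF DERIV_inverse_power]

text \<open>A positive order of differentiation removes the constant \<open>c\<close>, which later
  is the term 1 / w^2 that makes the series converge.\<close>

lemma higher_deriv_inverse_square:
  fixes z w c :: complex
  assumes "z \<noteq> w" "n > 0"
  shows "(deriv ^^ n) (\<lambda>z. 1 / (z - w)^2 - c) z = (-1) ^ n * fact (Suc n) / (z - w) ^ (n + 2)"
  using assms(2,1)
proof (induction n arbitrary: z rule: nat_induct_non_zero)
  case 1
  have "((\<lambda>z. 1 / (z - w)^2 - c) has_field_derivative -2 / (z - w) ^ 3) (at z)"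
    using DERIV_diff[OF DERIV_inverse_power[OF 1, of 1 2] DERIV_const[of c]] by (simp add: eval_nat_numeral)
  then show ?case by (simp add: DERIV_imp_deriv eval_nat_numeral)
next
  case (Suc n)
  have "open (-{w})" by auto
  then have "\<forall>\<^sub>F u in nhds z. u \<in> -{w}"
    using Suc.prems by (intro eventually_nhds_in_open) auto
  then have "\<forall>\<^sub>F u in nhds z. (deriv ^^ n) (\<lambda>z. 1 / (z - w)^2 - c) u = (-1) ^ n * fact (Suc n) / (u - w) ^ (n + 2)"
    by eventually_elim (use Suc.IH in auto)
  then have "deriv ((deriv ^^ n) (\<lambda>z. 1 / (z - w)^2 - c)) z = deriv (\<lambda>u. (-1) ^ n * fact (Suc n) / (u - w) ^ (n + 2)) z"
    by (rule deriv_cong_ev) simp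
  also have "\<dots> = - of_nat (n + 2) * ((-1) ^ n * fact (Suc n)) / (z - w) ^ Suc (n + 2)"
    by (rule deriv_inverse_power[OF Suc.prems])
  also have "\<dots> = (-1) ^ Suc n * fact (Suc (Suc n)) / (z - w) ^ (Suc n + 2)"
    by (simp add: algebra_simps)
  finally show ?case by simp
qed

text \<open>Leaving out the pole at 0 gives a function with a power series there, on which the
  formal arguments operate.\<close>

definition wp_reg :: "complex set \<Rightarrow> complex \<Rightarrow> complex" where
  "wp_reg L z = (\<Sum>\<^sub>\<infinity>w\<in>L-{0}. 1 / (z - w)^2 - 1 / w^2)"

definition wp :: "complex set \<Rightarrow> complex \<Rightarrow> complex" where
  "wp L z = 1 / z^2 + wp_reg L z"

context complex_lattice
begin

lemma open_reg: "open (- (L - {0}))"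
  by (rule open_Compl_subset) auto

lemma open_Compl_lattice: "open (- L)"
  by (rule open_Compl_subset) auto

lemma connected_Compl_lattice: "connected (- L)"
  using path_connected_complement_countable[of L] countable path_connected_imp_connected by auto

text \<open>Combining the fractions gives z (2 w - z) / (w^2 (z - w)^2). Here |2 w - z| is at most
  5/2 |w| and |z - w| is at least |w| / 2, whence the constant 10 as 4 times 5/2.\<close>

lemma wp_term_bound:
  fixes z w :: complex
  assumes "norm z \<le> r" "norm w \<ge> 2 * r" "r > 0"
  shows "norm (1 / (z - w)^2 - 1 / w^2) \<le> 10 * r / norm w ^ 3"
proof -
  have w: "norm w > 0" using assms by linarith
  have zw: "norm (z - w) \<ge> norm w / 2"
    using assms norm_triangle_ineq2[of w z] by (simp add: norm_minus_commute)
  then have ne: "z - w \<noteq> 0" "w \<noteq> 0" using w by auto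
  have "1 / (z - w)^2 - 1 / w^2 = z * (2 * w - z) / (w^2 * (z - w)^2)"
    using ne by (simp add: divide_simps) (simp add: power2_eq_square algebra_simps)
  then have "norm (1 / (z - w)^2 - 1 / w^2) = norm z * norm (2 * w - z) / (norm w ^ 2 * norm (z - w)^2)"
    by (simp add: norm_mult norm_divide norm_power)
  also have "\<dots> \<le> r * (5/2 * norm w) / (norm w ^ 2 * (norm w / 2)^2)"
  proof (intro frac_le mult_mono mult_pos_pos zero_less_power power_mono)
    have "norm (2 * w - z) \<le> norm (2 * w) + norm z" by (rule norm_triangle_ineq4)
    then show "norm (2 * w - z) \<le> 5/2 * norm w" using assms by (simp add: norm_mult)
  qed (use assms w zw in auto)
  also have "\<dots> = 10 * r / norm w ^ 3"
    using w by (simp add: field_simps eval_nat_numeral)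
  finally show ?thesis .
qed

lemma wp_reg_loc:
  "\<exists>r>0. \<exists>A M. finite A \<and> M summable_on (L - {0}) \<and>
     (\<forall>w\<in>L-{0}-A. \<forall>y\<in>ball x r \<inter> -(L-{0}). norm (1 / (y - w)^2 - 1 / w^2) \<le> M w)"
proof (intro exI conjI)
  define R where "R = norm x + 1"
  have R: "R > 0" by (simp add: R_def add_nonneg_pos)
  show "finite (L \<inter> cball 0 (2 * R))" by (rule finite_cball)
  show "(\<lambda>w. 10 * R * (1 / norm w ^ 3)) summable_on (L - {0})"
    by (rule summable_on_cmult_right[OF summable_cubes])
  show "\<forall>w\<in>L-{0}-(L \<inter> cball 0 (2 * R)). \<forall>y\<in>ball x 1 \<inter> -(L-{0}). norm (1 / (y - w)^2 - 1 / w^2) \<le> 10 * R * (1 / norm w ^ 3)"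
  proof (intro ballI)
    fix w y assume w: "w \<in> L-{0}-(L \<inter> cball 0 (2 * R))" and y: "y \<in> ball x 1 \<inter> -(L-{0})"
    have "norm y \<le> R" using y norm_triangle_ineq2[of y x] by (auto simp: R_def dist_norm norm_minus_commute)
    moreover have "norm w \<ge> 2 * R" using w by auto
    ultimately show "norm (1 / (y - w)^2 - 1 / w^2) \<le> 10 * R * (1 / norm w ^ 3)"
      using wp_term_bound[of y R w] R by simp
  qed
qed auto

lemma wp_term_holomorphic: "w \<in> L - {0} \<Longrightarrow> (\<lambda>z. 1 / (z - w)^2 - 1 / w^2) holomorphic_on -(L - {0})"
  by (intro holomorphic_intros) auto

lemma holomorphic_wp_reg: "wp_reg L holomorphic_on -(L - {0})"
  unfolding wp_reg_def[abs_def]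
  by (rule holomorphic_on_infsum[OF open_reg wp_term_holomorphic wp_reg_loc])

lemma has_sum_higher_deriv_wp_reg:
  assumes "z \<notin> L - {0}" "n > 0"
  shows "((\<lambda>w. (-1) ^ n * fact (Suc n) / (z - w) ^ (n + 2)) has_sum (deriv ^^ n) (wp_reg L) z) (L - {0})"
proof -
  have "((\<lambda>w. (deriv ^^ n) (\<lambda>z. 1 / (z - w)^2 - 1 / w^2) z) has_sum (deriv ^^ n) (wp_reg L) z) (L - {0})"
    unfolding wp_reg_def[abs_def]
    by (rule has_sum_higher_deriv[OF open_reg wp_term_holomorphic wp_reg_loc]) (use assms in auto)
  moreover have "(deriv ^^ n) (\<lambda>z. 1 / (z - w)^2 - 1 / w^2) z = (-1) ^ n * fact (Suc n) / (z - w) ^ (n + 2)"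
    if "w \<in> L - {0}" for w
    by (rule higher_deriv_inverse_square) (use that assms in auto)
  ultimately show ?thesis by (subst has_sum_cong[symmetric]) auto
qed

lemma holomorphic_wp: "wp L holomorphic_on - L"
proof -
  have "wp_reg L holomorphic_on - L"
    by (rule holomorphic_on_subset[OF holomorphic_wp_reg]) auto
  then show ?thesis unfolding wp_def[abs_def]
    by (intro holomorphic_intros) (use zero_mem in auto)
qed

lemma wp_reg_field_derivative:
  "z \<in> - (L - {0}) \<Longrightarrow> (wp_reg L has_field_derivative deriv (wp_reg L) z) (at z)"
  using holomorphic_wp_reg open_reg by (rule holomorphic_derivI)

lemma deriv_wp:
  assumes "z \<in> - L"
  shows "deriv (wp L) z = -2 / z^3 + deriv (wp_reg L) z"
proof -
  have "z \<noteq> 0" using assms zero_mem by auto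
  then have "(wp L has_field_derivative -2 / z^3 + deriv (wp_reg L) z) (at z)"
    unfolding wp_def[abs_def] using assms
    by (auto intro!: derivative_eq_intros wp_reg_field_derivative simp: field_simps eval_nat_numeral)
  then show ?thesis by (rule DERIV_imp_deriv)
qed

lemma has_sum_deriv_wp:
  assumes "z \<in> - L"
  shows "((\<lambda>w. -2 / (z - w)^3) has_sum deriv (wp L) z) L"
proof -
  have "((\<lambda>w. -2 / (z - w)^3) has_sum deriv (wp_reg L) z) (L - {0})"
    using has_sum_higher_deriv_wp_reg[of z 1] assms by (simp add: eval_nat_numeral)
  then have "((\<lambda>w. -2 / (z - w)^3) has_sum (-2 / (z - 0)^3 + deriv (wp_reg L) z)) (insert 0 (L - {0}))"
    by (intro has_sum_insert) auto
  moreover have "insert 0 (L - {0}) = L" by auto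
  ultimately show ?thesis using deriv_wp[OF assms] by simp
qed

lemma shift_mem_iff: "w \<in> L \<Longrightarrow> z + w \<in> L \<longleftrightarrow> z \<in> L"
  using add_mem diff_mem by (metis add_diff_cancel_right')

text \<open>The series of the derivative contains no correction terms, so translation by a lattice
  point merely permutes its summands. Periodicity of \<open>wp\<close> itself has to be integrated
  from this.\<close>

lemma deriv_wp_periodic:
  assumes "w \<in> L" "z \<in> - L"
  shows "deriv (wp L) (z + w) = deriv (wp L) z"
proof -
  have "z + w \<in> - L" using assms shift_mem_iff by auto
  from has_sum_deriv_wp[OF this]
  have "((\<lambda>u. -2 / (z + w - u)^3) has_sum deriv (wp L) (z + w)) L" .
  then have "((\<lambda>u. -2 / (z - u)^3) has_sum deriv (wp L) (z + w)) L"
    by (subst has_sum_reindex_bij_witness[where i = "\<lambda>u. u + w" and j = "\<lambda>u. u - w" and S = L and T = L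
          and h = "\<lambda>u. -2 / (z - u)^3" and g = "\<lambda>u. -2 / (z + w - u)^3", symmetric])
      (auto simp: add_mem diff_mem assms algebra_simps)
  then show ?thesis using has_sum_deriv_wp[OF assms(2)] has_sum_unique by blast
qed

lemma wp_reg_even: "wp_reg L (- z) = wp_reg L z"
  unfolding wp_reg_def
proof (rule infsum_reindex_bij_witness[where i = uminus and j = uminus])
  fix w :: complex
  have "(- z - w)^2 = (z - - w)^2" by (simp add: power2_eq_square algebra_simps)
  then show "1 / (z - - w)^2 - 1 / (- w)^2 = 1 / (- z - w)^2 - 1 / w^2" by simp
qed (auto simp: uminus_mem)

lemma wp_even: "wp L (- z) = wp L z"
  by (simp add: wp_def wp_reg_even)

text \<open>The difference \<open>\<wp>(z + w) - \<wp>(z)\<close> is a constant, which evenness shows to be its own negative.\<close>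
lemma wp_periodic:
  assumes w: "w \<in> L" and z: "z \<in> - L"
  shows "wp L (z + w) = wp L z"
proof -
  have hd: "(wp L has_field_derivative deriv (wp L) u) (at u)" if "u \<in> - L" for u
    using holomorphic_wp open_Compl_lattice that by (rule holomorphic_derivI)
  have d: "((\<lambda>u. wp L (u + w) - wp L u) has_field_derivative 0) (at u)" if u: "u \<in> - L" for u
  proof -
    have "u + w \<in> - L" using w u shift_mem_iff by auto
    then have "((\<lambda>u. wp L (u + w)) has_field_derivative deriv (wp L) (u + w)) (at u)"
      using hd[of "u + w"] by (simp add: DERIV_shift)
    from DERIV_diff[OF this hd[OF u]] show ?thesis using deriv_wp_periodic[OF w u] by simp
  qed
  then have "continuous_on (- L) (\<lambda>u. wp L (u + w) - wp L u)"
    by (meson DERIV_isCont continuous_at_imp_continuous_on)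
  then obtain c where c: "\<And>u. u \<in> - L \<Longrightarrow> wp L (u + w) - wp L u = c"
    using DERIV_zero_connected_constant[OF connected_Compl_lattice open_Compl_lattice finite.emptyI] d
    by blast
  \<comment> \<open>The translate of this point by \<open>w\<close> is \<open>- z\<close>, so
    evenness turns the difference there into the negative of the one at \<open>z\<close>.\<close>
  have "- z - w \<in> - L"
  proof -
    have "- z \<notin> L" using z uminus_mem[of "- z"] by auto
    then show ?thesis using shift_mem_iff[OF uminus_mem[OF w]] by simp
  qed
  from c[OF this] have "wp L (- z) - wp L (- (z + w)) = c" by simp
  then have "wp L z - wp L (z + w) = c" by (simp only: wp_even)
  with c[OF z] have "c = - c" by (metis minus_diff_eq)
  then have "c = 0" by simp
  then show ?thesis using c[OF z] by simp
qed

end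

section \<open>Laurent coefficients from the second order differential equation\<close>

definition eis :: "nat \<Rightarrow> complex set \<Rightarrow> complex" where
  "eis k L = (\<Sum>\<^sub>\<infinity>w\<in>L-{0}. 1 / w ^ k)"

text \<open>Substituting 1 / z^2 + H into the equation y'' = 6 y^2 + C and clearing the pole gives
  \<open>ode\<close>; moving 12 H to the left turns the factor n (n - 1) at index n into (n - 4) (n
  + 3).\<close>

lemma fps_weierstrass_ode_nth:
  fixes H :: "complex fps"
  assumes ode: "fps_X^2 * fps_deriv (fps_deriv H) = fps_const 12 * H + fps_const 6 * (fps_X^2 * H^2) + fps_const C * fps_X^2"
  shows "H $ 0 = 0" "C = - 10 * (H $ 2)"
    and "n \<ge> 3 \<Longrightarrow> (of_nat n - 4) * (of_nat n + 3) * (H $ n) = 6 * (H^2) $ (n - 2)"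
proof -
  have nth: "(fps_X^2 * fps_deriv (fps_deriv H)) $ n = of_nat n * (of_nat n - 1) * H $ n" for n
  proof (cases "n < 2")
    case True
    then have "n = 0 \<or> n = 1" by auto
    then show ?thesis by (auto simp: fps_X_power_mult_nth)
  next
    case False
    then obtain m where "n = Suc (Suc m)" by (metis add_2_eq_Suc le_Suc_ex not_le)
    then show ?thesis unfolding fps_X_power_mult_nth by (simp add: algebra_simps)
  qed
  have nth': "of_nat n * (of_nat n - 1) * H $ n = 12 * H $ n + 6 * (if n < 2 then 0 else (H^2) $ (n - 2)) + (if n = 2 then C else 0)" for n
    using arg_cong[OF ode, of "\<lambda>f. f $ n"] unfolding nth
    by (simp add: fps_X_power_mult_nth fps_X_power_nth)
  show H0: "H $ 0 = 0" using nth'[of 0] by simp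
  have "2 * (H $ 2) = 12 * (H $ 2) + 6 * ((H^2) $ 0) + C" using nth'[of 2] by simp
  moreover have "(H^2) $ 0 = 0" using H0 by simp
  ultimately have "2 * (H $ 2) = 12 * (H $ 2) + C" by (simp only: mult_zero_right add_0_right)
  then have "C = 2 * (H $ 2) - 12 * (H $ 2)" by (simp only: add_diff_cancel_left')
  then show "C = - 10 * (H $ 2)" by simp
  show "(of_nat n - 4) * (of_nat n + 3) * (H $ n) = 6 * (H^2) $ (n - 2)" if "n \<ge> 3"
    using nth'[of n] that by (simp add: algebra_simps)
qed

text \<open>The recursion for the coefficients degenerates at \<open>n = 4\<close>, so that this coefficient has to be given
  in addition; the coefficient of index 2 determines the constant \<open>C\<close>.\<close>
lemma fps_weierstrass_ode_unique:
  fixes H H' :: "complex fps"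
  assumes ode: "fps_X^2 * fps_deriv (fps_deriv H) = fps_const 12 * H + fps_const 6 * (fps_X^2 * H^2) + fps_const C * fps_X^2"
    and ode': "fps_X^2 * fps_deriv (fps_deriv H') = fps_const 12 * H' + fps_const 6 * (fps_X^2 * H'^2) + fps_const C' * fps_X^2"
    and eq: "H $ 1 = H' $ 1" "H $ 2 = H' $ 2" "H $ 4 = H' $ 4"
  shows "H = H'"
proof -
  have "H $ n = H' $ n" for n
  proof (induction n rule: less_induct)
    case (less n)
    show ?case
    proof (cases "n \<in> {0,1,2,4}")
      case True
      then show ?thesis using eq fps_weierstrass_ode_nth(1)[OF ode] fps_weierstrass_ode_nth(1)[OF ode'] by auto
    next
      case False
      then have n: "n \<ge> 3" "n \<noteq> 4" by auto
      have "(H^2) $ (n - 2) = (H'^2) $ (n - 2)"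
        unfolding power2_eq_square fps_mult_nth using less n by (intro sum.cong refl) auto
      then have "(of_nat n - 4) * (of_nat n + 3) * (H $ n) = (of_nat n - 4) * (of_nat n + 3) * (H' $ n)"
        using fps_weierstrass_ode_nth(3)[OF ode n(1)] fps_weierstrass_ode_nth(3)[OF ode' n(1)] by simp
      moreover have "(of_nat n - 4 :: complex) \<noteq> 0"
        using n(2) by (metis eq_iff_diff_eq_0 of_nat_eq_iff of_nat_numeral)
      moreover have "(of_nat n + 3 :: complex) \<noteq> 0"
        by (metis add_is_0 of_nat_add of_nat_eq_0_iff of_nat_numeral zero_neq_numeral)
      ultimately show ?thesis by simp
    qed
  qed
  then show ?thesis by (rule fps_ext)
qed

context complex_lattice
begin

definition wp_fps :: "complex fps" where "wp_fps = fps_expansion (wp_reg L) 0"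

lemma wp_reg_has_fps_expansion: "wp_reg L has_fps_expansion wp_fps"
  unfolding wp_fps_def
  by (rule has_fps_expansion_fps_expansion[OF open_reg _ holomorphic_wp_reg]) simp

lemma wp_reg_0 [simp]: "wp_reg L 0 = 0"
  by (simp add: wp_reg_def)

lemma wp_fps_nth:
  assumes "n > 0"
  shows "wp_fps $ n = of_nat (n + 1) * eis (n + 2) L"
proof -
  have "((\<lambda>w. (-1) ^ n * fact (Suc n) / (0 - w) ^ (n + 2)) has_sum (deriv ^^ n) (wp_reg L) 0) (L - {0})"
    by (rule has_sum_higher_deriv_wp_reg) (use assms in auto)
  moreover have "(-1) ^ n * fact (Suc n) / (0 - w) ^ (n + 2) = fact (Suc n) * (1 / w ^ (n + 2))" for w :: complex
  proof -
    have "(0 - w) ^ (n + 2) = (-1) ^ n * w ^ (n + 2)"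
      using power_minus[of w "n + 2"] by simp
    moreover have "(-1 :: complex) ^ n \<noteq> 0" by simp
    ultimately show ?thesis
      by (simp only: mult_divide_mult_cancel_left times_divide_eq_right mult_1_right if_False not_False_eq_True simp_thms)
  qed
  ultimately have "((\<lambda>w. fact (Suc n) * (1 / w ^ (n + 2))) has_sum (deriv ^^ n) (wp_reg L) 0) (L - {0})"
    by simp
  then have "(deriv ^^ n) (wp_reg L) 0 = (\<Sum>\<^sub>\<infinity>w\<in>L-{0}. fact (Suc n) * (1 / w ^ (n + 2)))"
    by (simp add: infsumI)
  also have "\<dots> = fact (Suc n) * eis (n + 2) L"
    unfolding eis_def by (rule infsum_cmult_right')
  finally show ?thesis
    unfolding fps_nth_fps_expansion[OF wp_reg_has_fps_expansion] by simp
qed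

lemma deriv_wp_reg_0: "deriv (wp_reg L) 0 = 0"
proof -
  have d: "(wp_reg L has_field_derivative deriv (wp_reg L) 0) (at 0)"
    by (rule wp_reg_field_derivative) simp
  then have "((\<lambda>z. wp_reg L (- z)) has_field_derivative - deriv (wp_reg L) 0) (at 0)"
    using DERIV_chain2[of "wp_reg L" "deriv (wp_reg L) 0" uminus 0 "-1" UNIV] DERIV_minus[OF DERIV_ident, of 0 UNIV]
    by simp
  then have "(wp_reg L has_field_derivative - deriv (wp_reg L) 0) (at 0)"
    by (simp add: wp_reg_even)
  then have "deriv (wp_reg L) 0 = - deriv (wp_reg L) 0"
    using d DERIV_unique by blast
  then show ?thesis by simp
qed

lemma wp_fps_low: "wp_fps $ 0 = 0" "wp_fps $ Suc 0 = 0"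
  unfolding fps_nth_fps_expansion[OF wp_reg_has_fps_expansion] by (simp_all add: deriv_wp_reg_0)

lemma zero_in_reg: "0 \<in> - (L - {0})" by simp

lemma deriv_deriv_wp:
  assumes z: "z \<in> - L"
  shows "deriv (deriv (wp L)) z = 6 / z^4 + deriv (deriv (wp_reg L)) z"
proof -
  have z0: "z \<noteq> 0" and zU: "z \<in> - (L - {0})" using z zero_mem by auto
  have ev: "\<forall>\<^sub>F u in nhds z. u \<in> - L" using z open_Compl_lattice by (intro eventually_nhds_in_open)
  have "deriv (deriv (wp L)) z = deriv (\<lambda>u. (-2) / (u - 0)^3 + deriv (wp_reg L) u) z"
    by (rule deriv_cong_ev) (use ev in eventually_elim, auto simp: deriv_wp)
  also have "\<dots> = 6 / z^4 + deriv (deriv (wp_reg L)) z"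
  proof -
    have "((\<lambda>u. (-2) / (u - 0)^3) has_field_derivative 6 / z^4) (at z)"
      using DERIV_inverse_power[OF z0, of "-2" 3] by (simp add: eval_nat_numeral)
    moreover have "(deriv (wp_reg L) has_field_derivative deriv (deriv (wp_reg L)) z) (at z)"
      by (rule holomorphic_derivI[OF holomorphic_deriv[OF holomorphic_wp_reg open_reg] open_reg zU])
    ultimately show ?thesis by (intro DERIV_imp_deriv DERIV_add)
  qed
  finally show ?thesis .
qed

text \<open>The second derivative of \<open>wp L\<close> minus 6 times its square loses its pole at
  0, hence by periodicity at every lattice point; the resulting entire function is bounded by
  cocompactness and so constant.\<close>

lemma wp_ode_ex:
  "\<exists>C. \<forall>z \<in> - (L - {0}). z^2 * deriv (deriv (wp_reg L)) z = 12 * wp_reg L z + 6 * (z^2 * (wp_reg L z)^2) + C * z^2"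
proof -
  define U where "U = - (L - {0})"
  have U: "open U" "0 \<in> U" using open_reg by (auto simp: U_def)
  have hol: "wp_reg L holomorphic_on U" using holomorphic_wp_reg by (simp add: U_def)
  \<comment> \<open>As \<open>wp_reg\<close> vanishes to second order at 0, dividing by z twice with
    removable singularities gives a holomorphic \<open>k\<close>, which accounts for the cross term
    12 \<open>wp_reg L z\<close> / z^2 in the square of \<open>wp\<close>.\<close>
  define h1 where "h1 = (\<lambda>z. if z = 0 then deriv (wp_reg L) 0 else (wp_reg L z - wp_reg L 0) / (z - 0))"
  have h1: "h1 holomorphic_on U" unfolding h1_def by (rule pole_lemma_open[OF hol U(1)])
  define k where "k = (\<lambda>z. if z = 0 then deriv h1 0 else (h1 z - h1 0) / (z - 0))"
  have k: "k holomorphic_on U" unfolding k_def by (rule pole_lemma_open[OF h1 U(1)])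
  have k_eq: "z^2 * k z = wp_reg L z" for z
    by (cases "z = 0") (simp_all add: k_def h1_def deriv_wp_reg_0 power2_eq_square)
  define \<Phi> where "\<Phi> = (\<lambda>z. deriv (deriv (wp_reg L)) z - 12 * k z - 6 * (wp_reg L z)^2)"
  have \<Phi>: "\<Phi> holomorphic_on U" unfolding \<Phi>_def
    using U by (intro holomorphic_intros hol k holomorphic_deriv)
  have d1: "deriv (wp L) holomorphic_on - L"
    by (rule holomorphic_deriv[OF holomorphic_wp open_Compl_lattice])
  have \<Phi>_wp: "\<Phi> z = deriv (deriv (wp L)) z - 6 * (wp L z)^2" if z: "z \<in> - L" for z
  proof -
    have z0: "z \<noteq> 0" and zU: "z \<in> U" using z zero_mem by (auto simp: U_def)
    have "k z = wp_reg L z / z^2" using k_eq[of z] z0 by (simp add: field_simps)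
    then show ?thesis unfolding deriv_deriv_wp[OF z] \<Phi>_def wp_def using z0
      by (simp add: power2_sum power_divide)
  qed
  have \<Phi>_per: "\<Phi> (z + w) = \<Phi> z" if z: "z \<in> - L" and w: "w \<in> L" for z w
  proof -
    have zw: "z + w \<in> - L" using z w shift_mem_iff by auto
    have ev: "\<forall>\<^sub>F u in nhds z. u \<in> - L" using z open_Compl_lattice by (intro eventually_nhds_in_open)
    have "(deriv (wp L) has_field_derivative deriv (deriv (wp L)) (z + w)) (at (z + w))"
      by (rule holomorphic_derivI[OF d1 open_Compl_lattice zw])
    then have "((\<lambda>u. deriv (wp L) (u + w)) has_field_derivative deriv (deriv (wp L)) (z + w)) (at z)"
      by (simp add: DERIV_shift)
    then have "deriv (\<lambda>u. deriv (wp L) (u + w)) z = deriv (deriv (wp L)) (z + w)"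
      by (rule DERIV_imp_deriv)
    moreover have "deriv (\<lambda>u. deriv (wp L) (u + w)) z = deriv (deriv (wp L)) z"
      by (rule deriv_cong_ev) (use ev in eventually_elim, auto simp: deriv_wp_periodic w)
    ultimately show ?thesis using \<Phi>_wp[OF z] \<Phi>_wp[OF zw] wp_periodic[OF w z] by simp
  qed
  \<comment> \<open>Off the lattice \<Phi> is already periodic; only its value at 0 has to be copied
    to the other lattice points.\<close>
  define F where "F = (\<lambda>z. if z \<in> L then \<Phi> 0 else \<Phi> z)"
  have F_U: "F z = \<Phi> z" if "z \<in> U" for z using that by (auto simp: F_def U_def)
  have F_per: "F (z + w) = F z" if "w \<in> L" for z w
    using that \<Phi>_per[of z w] shift_mem_iff[of w z] by (auto simp: F_def)
  have FU: "F holomorphic_on U" using \<Phi> F_U holomorphic_cong by blast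
  have "F holomorphic_on (\<Union>w\<in>L. (\<lambda>z. z - w) -` U)"
  proof (rule holomorphic_on_UN_open)
    fix w assume w: "w \<in> L"
    show "open ((\<lambda>z. z - w) -` U)" by (intro open_vimage U(1) continuous_intros)
    have "(F \<circ> (\<lambda>z. z - w)) holomorphic_on ((\<lambda>z. z - w) -` U)"
      by (rule holomorphic_on_compose_gen[OF _ FU]) (auto intro!: holomorphic_intros)
    moreover have "F \<circ> (\<lambda>z. z - w) = F" using F_per[OF w, of "z - w" for z] by (simp add: fun_eq_iff)
    ultimately show "F holomorphic_on ((\<lambda>z. z - w) -` U)" by simp
  qed
  moreover have "(\<Union>w\<in>L. (\<lambda>z. z - w) -` U) = UNIV"
  proof -
    have "z \<in> (\<Union>w\<in>L. (\<lambda>z. z - w) -` U)" for z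
    proof (cases "z \<in> L")
      case True
      then show ?thesis using U by (intro UN_I[of z]) auto
    next
      case False
      then show ?thesis by (intro UN_I[of 0]) (auto simp: U_def)
    qed
    then show ?thesis by auto
  qed
  ultimately have entire: "F holomorphic_on UNIV" by simp
  obtain R where R: "R > 0" "\<And>z. \<exists>w\<in>L. norm (z - w) \<le> R" using cocompact by blast
  have "compact (F ` cball 0 R)"
    by (intro compact_continuous_image continuous_on_subset[OF holomorphic_on_imp_continuous_on[OF entire]]) auto
  then have "bounded (F ` cball 0 R)" by (rule compact_imp_bounded)
  moreover have "range F \<subseteq> F ` cball 0 R"
  proof clarify
    fix z
    obtain w where w: "w \<in> L" "norm (z - w) \<le> R" using R(2) by blast
    have "F z = F (z - w)" using F_per[OF w(1), of "z - w"] by simp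
    then show "F z \<in> F ` cball 0 R" using w(2) by auto
  qed
  ultimately have "bounded (range F)" by (rule bounded_subset)
  then have "F constant_on UNIV" using entire Liouville_theorem by blast
  then obtain C where C: "\<And>z. F z = C" by (auto simp: constant_on_def)
  have "z^2 * deriv (deriv (wp_reg L)) z = 12 * wp_reg L z + 6 * (z^2 * (wp_reg L z)^2) + C * z^2" if z: "z \<in> U" for z
  proof -
    have "deriv (deriv (wp_reg L)) z = C + 12 * k z + 6 * (wp_reg L z)^2"
      using C[of z] F_U[OF z] by (simp add: \<Phi>_def algebra_simps)
    then have "z^2 * deriv (deriv (wp_reg L)) z = 12 * (z^2 * k z) + 6 * (z^2 * (wp_reg L z)^2) + C * z^2"
      by (simp add: algebra_simps)
    then show ?thesis by (simp add: k_eq)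
  qed
  then show ?thesis unfolding U_def by blast
qed

lemma eventually_reg: "\<forall>\<^sub>F z in nhds 0. z \<in> - (L - {0})"
  by (rule eventually_nhds_in_open[OF open_reg]) simp

lemma wp_fps_ode_of:
  assumes "\<forall>z \<in> - (L - {0}). z^2 * deriv (deriv (wp_reg L)) z = 12 * wp_reg L z + 6 * (z^2 * (wp_reg L z)^2) + C * z^2"
  shows "fps_X^2 * fps_deriv (fps_deriv wp_fps) = fps_const 12 * wp_fps + fps_const 6 * (fps_X^2 * wp_fps^2) + fps_const C * fps_X^2"
proof (rule fps_expansion_unique_complex)
  let ?f = "\<lambda>z. z^2 * deriv (deriv (wp_reg L)) z"
  show "?f has_fps_expansion fps_X^2 * fps_deriv (fps_deriv wp_fps)"
    by (intro fps_expansion_intros has_fps_expansion_deriv wp_reg_has_fps_expansion)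
  have "(\<lambda>z. 12 * wp_reg L z + 6 * (z^2 * (wp_reg L z)^2) + C * z^2) has_fps_expansion
     fps_const 12 * wp_fps + fps_const 6 * (fps_X^2 * wp_fps^2) + fps_const C * fps_X^2"
    by (intro fps_expansion_intros wp_reg_has_fps_expansion)
  moreover have "\<forall>\<^sub>F z in nhds 0. 12 * wp_reg L z + 6 * (z^2 * (wp_reg L z)^2) + C * z^2 = ?f z"
    using eventually_reg by eventually_elim (use assms in auto)
  ultimately show "?f has_fps_expansion fps_const 12 * wp_fps + fps_const 6 * (fps_X^2 * wp_fps^2) + fps_const C * fps_X^2"
    by (rule iffD1[OF has_fps_expansion_cong[OF _ refl], rotated])
qed

lemma wp_ode:
  assumes "z \<in> - (L - {0})"
  shows "z^2 * deriv (deriv (wp_reg L)) z = 12 * wp_reg L z + 6 * (z^2 * (wp_reg L z)^2) - 30 * eis 4 L * z^2"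
proof -
  obtain C where C: "\<forall>z \<in> - (L - {0}). z^2 * deriv (deriv (wp_reg L)) z = 12 * wp_reg L z + 6 * (z^2 * (wp_reg L z)^2) + C * z^2"
    using wp_ode_ex by blast
  have "C = - 10 * (wp_fps $ 2)" by (rule fps_weierstrass_ode_nth(2)[OF wp_fps_ode_of[OF C]])
  \<comment> \<open>Coefficient 2 of the expansion is 3 \<open>eis 4 L\<close>, which turns the
    factor 10 into 30.\<close>
  then have "C = - (30 * eis 4 L)" using wp_fps_nth[of 2] by simp
  then show ?thesis using bspec[OF C assms] by simp
qed

lemma wp_fps_ode: "fps_X^2 * fps_deriv (fps_deriv wp_fps) =
    fps_const 12 * wp_fps + fps_const 6 * (fps_X^2 * wp_fps^2) + fps_const (- 30 * eis 4 L) * fps_X^2"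
  by (rule wp_fps_ode_of) (use wp_ode in simp)

end

text \<open>Equal expansions make the two functions agree near 0 and hence off the union of the
  lattices, whose complement is connected because the union is countable. A point of
  \<open>L\<close> outside \<open>L'\<close> would then be a pole of one function and a regular
  point of the other.\<close>

lemma lattice_subset_of_eis_eq:
  assumes "complex_lattice L" "complex_lattice L'"
    and eq: "eis 4 L = eis 4 L'" "eis 6 L = eis 6 L'"
  shows "L \<subseteq> L'"
proof
  interpret A: complex_lattice L by fact
  interpret B: complex_lattice L' by fact
  have "A.wp_fps = B.wp_fps"
    by (rule fps_weierstrass_ode_unique[OF A.wp_fps_ode B.wp_fps_ode])
      (use eq A.wp_fps_nth[of 2] A.wp_fps_nth[of 4] B.wp_fps_nth[of 2] B.wp_fps_nth[of 4] in
        \<open>simp_all add: A.wp_fps_low B.wp_fps_low\<close>)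
  then have "wp_reg L' has_fps_expansion A.wp_fps" using B.wp_reg_has_fps_expansion by simp
  from has_fps_expansion_diff[OF A.wp_reg_has_fps_expansion this]
  have "\<forall>\<^sub>F z in nhds 0. wp_reg L z - wp_reg L' z = 0"
    unfolding diff_self has_fps_expansion_0_iff .
  with A.eventually_reg B.eventually_reg
  have "\<forall>\<^sub>F z in nhds 0. wp_reg L z = wp_reg L' z \<and> z \<in> - (L - {0}) \<and> z \<in> - (L' - {0})"
    by eventually_elim auto
  then obtain d where d: "d > 0"
    and near: "\<And>z. norm z < d \<Longrightarrow> wp_reg L z = wp_reg L' z \<and> z \<in> - (L - {0}) \<and> z \<in> - (L' - {0})"
    by (auto simp: eventually_nhds_metric)
  fix w assume w: "w \<in> L"
  show "w \<in> L'"
  proof (rule ccontr)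
    assume w': "w \<notin> L'"
    have conn: "connected (- (L \<union> L'))"
      using path_connected_complement_countable[of "L \<union> L'"] A.countable B.countable path_connected_imp_connected
      by auto
    have op: "open (- (L \<union> L'))"
      using A.open_Compl_lattice B.open_Compl_lattice by (simp add: open_Int)
    have sub: "ball 0 d - {0} \<subseteq> - (L \<union> L')"
    proof
      fix z :: complex assume "z \<in> ball 0 d - {0}"
      then show "z \<in> - (L \<union> L')" using near[of z] by auto
    qed
    have ne: "ball 0 d - {0::complex} \<noteq> {}"
    proof -
      have "of_real (d/2) \<in> ball (0::complex) d - {0}" using d by (simp add: norm_divide)
      then show ?thesis by blast
    qed
    have eq_wp: "wp L z = wp L' z" if "z \<in> - (L \<union> L')" for z
    proof (rule analytic_continuation_open[OF _ op ne conn sub _ _ _ that])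
      show "open (ball 0 d - {0::complex})" by (intro open_Diff) auto
      show "wp L holomorphic_on - (L \<union> L')" "wp L' holomorphic_on - (L \<union> L')"
        by (rule holomorphic_on_subset[OF A.holomorphic_wp] holomorphic_on_subset[OF B.holomorphic_wp], blast)+
      fix z :: complex assume "z \<in> ball 0 d - {0}"
      then show "wp L z = wp L' z" using near[of z] by (simp add: wp_def)
    qed
    \<comment> \<open>\<open>G\<close> tests for the double pole: it tends to 0 because
      \<open>wp L'\<close> is regular at \<open>w\<close>, yet equals 1 at nonzero points near 0
      because \<open>wp L' (z + w)\<close> is \<open>wp L z\<close> there.\<close>
    define G where "G = (\<lambda>z. z^2 * (wp L' (z + w) - wp_reg L z))"
    have contB: "isCont (wp L') w"
      using B.holomorphic_wp B.open_Compl_lattice w' holomorphic_on_imp_continuous_on continuous_on_eq_continuous_at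
      by (metis ComplI)
    have contB': "isCont (\<lambda>z. wp L' (z + w)) 0"
      by (rule isCont_o2[where g = "wp L'"]) (use contB in auto)
    have contA: "isCont (wp_reg L) 0"
      using A.holomorphic_wp_reg A.open_reg A.zero_in_reg holomorphic_on_imp_continuous_on continuous_on_eq_continuous_at
      by metis
    have "isCont G 0" unfolding G_def by (intro continuous_intros contA contB')
    then have lim: "(G \<longlongrightarrow> 0) (at 0)" by (simp add: isCont_def G_def)
    have "\<forall>\<^sub>F z in at 0. z + w \<in> - L'"
    proof -
      have "((\<lambda>z. z + w) \<longlongrightarrow> w) (at 0)" by (auto intro!: tendsto_eq_intros)
      then show ?thesis using w' by (intro topological_tendstoD[OF _ B.open_Compl_lattice]) auto
    qed
    moreover have "\<forall>\<^sub>F z in at 0. z \<in> - (L - {0})"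
      using A.eventually_reg unfolding eventually_nhds_conv_at by blast
    moreover have "\<forall>\<^sub>F z in at 0. z \<noteq> (0::complex)" by (rule eventually_neq_at_within)
    ultimately have "\<forall>\<^sub>F z in at 0. G z = 1"
    proof eventually_elim
      case (elim z)
      then have z: "z \<in> - L" by auto
      then have "z + w \<in> - (L \<union> L')" using elim A.shift_mem_iff[OF w] by auto
      then have "wp L' (z + w) = wp L z" using eq_wp A.wp_periodic[OF w z] by simp
      then show ?case using elim by (simp add: G_def wp_def)
    qed
    then have "(G \<longlongrightarrow> 1) (at 0)" by (simp add: tendsto_eventually)
    with lim show False using tendsto_unique[of "at 0" G 0 1] by simp
  qed
qed

theorem lattice_eqI:
  assumes "complex_lattice L" "complex_lattice L'" "eis 4 L = eis 4 L'" "eis 6 L = eis 6 L'"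
  shows "L = L'"
  using lattice_subset_of_eis_eq[of L L'] lattice_subset_of_eis_eq[of L' L] assms by auto

section \<open>The discriminant\<close>

lemma fps_linear_ode_unique:
  fixes F G :: "complex fps"
  assumes F: "fps_deriv (fps_deriv F) = fps_const 2 + fps_const k * F"
    and G: "fps_deriv (fps_deriv G) = fps_const 2 + fps_const k * G"
    and eq: "F $ 0 = G $ 0" "F $ 1 = G $ 1"
  shows "F = G"
proof (rule fps_ext)
  fix n
  show "F $ n = G $ n"
  proof (induction n rule: less_induct)
    case (less n)
    show ?case
    proof (cases "n < 2")
      case True
      then have "n = 0 \<or> n = 1" by auto
      then show ?thesis using eq by auto
    next
      case False
      then obtain m where m: "n = Suc (Suc m)" by (metis add_2_eq_Suc le_Suc_ex not_le)
      have "of_nat (m + 1) * (of_nat (m + 2) * F $ n) = (fps_deriv (fps_deriv F)) $ m" 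
        "of_nat (m + 1) * (of_nat (m + 2) * G $ n) = (fps_deriv (fps_deriv G)) $ m"
        unfolding m by simp_all
      moreover have "F $ m = G $ m" using less[of m] m by simp
      ultimately have "of_nat (m + 1) * (of_nat (m + 2) * F $ n) = of_nat (m + 1) * (of_nat (m + 2) * G $ n)"
        unfolding F G by simp
      then show ?thesis unfolding mult_cancel_left of_nat_eq_0_iff by simp
    qed
  qed
qed

text \<open>The function \<open>W\<close> is the reciprocal of \<open>\<wp> - a\<close> when the Weierstrass cubic has the double root \<open>a\<close>.\<close>
lemma degenerate_solution:
  fixes a :: complex
  obtains W c where "W holomorphic_on UNIV" "W 0 = 0" "deriv W 0 = 0"
    "\<And>z. deriv (deriv W) z = 2 + 12 * a * W z" "c \<noteq> 0" "\<And>w. W w = 0 \<Longrightarrow> Re (c * w) = 0"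
proof (cases "a = 0")
  case True
  define W where "W = (\<lambda>z::complex. z^2)"
  have d: "deriv W = (\<lambda>z. 2 * z)"
    unfolding W_def by (rule ext, rule DERIV_imp_deriv) (auto intro!: derivative_eq_intros)
  have dd: "deriv (deriv W) = (\<lambda>z. 2)"
    unfolding d by (rule ext, rule DERIV_imp_deriv) (auto intro!: derivative_eq_intros)
  have "W holomorphic_on UNIV" unfolding W_def by (intro holomorphic_intros)
  then show ?thesis using that[of W 1] True by (simp add: d dd) (simp add: W_def)
next
  case False
  define c where "c = csqrt (12 * a)"
  have c: "c^2 = 12 * a" by (simp add: c_def)
  then have c0: "c \<noteq> 0" using False by auto
  define W where "W = (\<lambda>z. (exp (c * z) + exp (- c * z) - 2) / c^2)"
  have d: "deriv W = (\<lambda>z. (exp (c * z) - exp (- c * z)) / c)"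
    unfolding W_def by (rule ext, rule DERIV_imp_deriv)
      (use c0 in \<open>auto intro!: derivative_eq_intros simp: field_simps power2_eq_square\<close>)
  have dd: "deriv (deriv W) z = exp (c * z) + exp (- c * z)" for z
    unfolding d by (rule DERIV_imp_deriv) (use c0 in \<open>auto intro!: derivative_eq_intros simp: field_simps\<close>)
  have "W holomorphic_on UNIV" unfolding W_def by (intro holomorphic_intros) (use c0 in auto)
  moreover have "deriv (deriv W) z = 2 + 12 * a * W z" for z
    unfolding dd c[symmetric] using c0 by (simp add: W_def)
  moreover have "Re (c * w) = 0" if "W w = 0" for w
  proof -
    \<comment> \<open>With x = exp (c w) the equation is x + 1 / x = 2, which has only the double
      root x = 1; hence c w is purely imaginary.\<close>
    have "exp (c * w) + exp (- c * w) = 2" using that c0 by (simp add: W_def)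
    moreover have "exp (- c * w) * exp (c * w) = 1" by (simp flip: exp_add)
    ultimately have "(2 - exp (c * w)) * exp (c * w) = 1" by (metis add_diff_cancel_left')
    then have "(exp (c * w) - 1)^2 = 0" by (simp add: power2_eq_square algebra_simps)
    then have "exp (c * w) = 1" by simp
    then show ?thesis by (simp add: exp_eq_1)
  qed
  moreover have "W 0 = 0" "deriv W 0 = 0" by (simp_all add: d) (simp add: W_def)
  ultimately show ?thesis using that[of W c] c0 by blast
qed

text \<open>Here \<open>h\<close> will be the derivative of \<open>wp_reg\<close>, since z^3 times
  the derivative of \<open>wp\<close> is - 2 + z^3 h. The factor z^6 clears all poles of the first
  order equation; both sides then begin with 4, and a common z^2 can be cancelled.\<close>

lemma weierstrass_expand_lhs:
  fixes z h :: complex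
  shows "(- 2 + z^3 * h)^2 = 4 + z^2 * (- 4 * (z * h) + z^4 * h^2)"
  by (simp add: power2_eq_square power3_eq_cube power4_eq_xxxx algebra_simps)

lemma weierstrass_expand_rhs:
  fixes z h g c w :: complex
  assumes "z^2 * w = 1 + z^2 * h"
  shows "z^6 * (4 * w^3 - g * w + c) =
    4 + z^2 * (12 * h + 12 * (z^2 * h^2) + 4 * (z^4 * h^3) - g * z^2 - g * (z^4 * h) + c * z^4)"
proof -
  have "z^6 * (4 * w^3 - g * w + c) = 4 * (z^2 * w)^3 - g * z^4 * (z^2 * w) + c * z^6"
    by (simp add: eval_nat_numeral algebra_simps)
  then show ?thesis unfolding assms by (simp add: eval_nat_numeral algebra_simps)
qed

lemma wp_scaled: "z \<noteq> 0 \<Longrightarrow> z^2 * wp L z = 1 + z^2 * wp_reg L z"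
  by (simp add: wp_def distrib_left)

context complex_lattice
begin

lemma wp_second_order:
  assumes z: "z \<in> - L"
  shows "deriv (deriv (wp L)) z = 6 * (wp L z)^2 - 30 * eis 4 L"
proof -
  have z0: "z \<noteq> 0" "z \<in> - (L - {0})" using z zero_mem by auto
  have "z^2 * deriv (deriv (wp_reg L)) z = 12 * wp_reg L z + 6 * (z^2 * (wp_reg L z)^2) - 30 * eis 4 L * z^2"
    by (rule wp_ode[OF z0(2)])
  then have e: "deriv (deriv (wp_reg L)) z = (12 * wp_reg L z + 6 * (z^2 * (wp_reg L z)^2) - 30 * eis 4 L * z^2) / z^2"
    using z0 by (metis nonzero_mult_div_cancel_left power_not_zero)
  show ?thesis
    unfolding deriv_deriv_wp[OF z] wp_def e using z0(1)
    by (simp add: field_simps eval_nat_numeral)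
qed

lemma wp_field_derivative:
  "z \<in> - L \<Longrightarrow> (wp L has_field_derivative deriv (wp L) z) (at z)"
  using holomorphic_wp open_Compl_lattice by (rule holomorphic_derivI)

lemma deriv_wp_field_derivative:
  "z \<in> - L \<Longrightarrow> (deriv (wp L) has_field_derivative deriv (deriv (wp L)) z) (at z)"
  by (rule holomorphic_derivI[OF holomorphic_deriv[OF holomorphic_wp open_Compl_lattice] open_Compl_lattice])

text \<open>The derivative of \<Psi> is twice the derivative of \<open>wp\<close> times the defect
  in the second order equation, hence 0, and the complement of the lattice is connected.\<close>

lemma wp_first_order_ex:
  obtains c where "\<And>z. z \<in> - L \<Longrightarrow> (deriv (wp L) z)^2 = 4 * (wp L z)^3 - 60 * eis 4 L * wp L z + c"
proof -
  define \<Psi> where "\<Psi> = (\<lambda>z. (deriv (wp L) z)^2 - 4 * (wp L z)^3 + 60 * eis 4 L * wp L z)"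
  have d: "(\<Psi> has_field_derivative 0) (at z)" if z: "z \<in> - L" for z
    unfolding \<Psi>_def
    by (rule derivative_eq_intros refl wp_field_derivative[OF z] deriv_wp_field_derivative[OF z])+
      (simp add: wp_second_order[OF z] algebra_simps eval_nat_numeral)
  then have "continuous_on (- L) \<Psi>"
    by (meson DERIV_isCont continuous_at_imp_continuous_on)
  then obtain c where "\<And>u. u \<in> - L \<Longrightarrow> \<Psi> u = c"
    using DERIV_zero_connected_constant[OF connected_Compl_lattice open_Compl_lattice finite.emptyI] d
    by blast
  then show ?thesis using that[of c] by (auto simp: \<Psi>_def algebra_simps)
qed

text \<open>Integrating the second order equation leaves a constant, which is read off from the fourth power of \<open>z\<close>.\<close>
lemma wp_first_order:
  assumes z: "z \<in> - L"
  shows "(deriv (wp L) z)^2 = 4 * (wp L z)^3 - 60 * eis 4 L * wp L z - 140 * eis 6 L"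
proof -
  obtain c where c: "\<And>z. z \<in> - L \<Longrightarrow> (deriv (wp L) z)^2 = 4 * (wp L z)^3 - 60 * eis 4 L * wp L z + c"
    using wp_first_order_ex by blast
  let ?h = "wp_reg L" and ?g = "60 * eis 4 L"
  let ?lhs = "\<lambda>z. - 4 * (z * deriv ?h z) + z^4 * (deriv ?h z)^2"
  let ?rhs = "\<lambda>z. 12 * ?h z + 12 * (z^2 * (?h z)^2) + 4 * (z^4 * (?h z)^3) - ?g * z^2 - ?g * (z^4 * ?h z) + c * z^4"
  let ?L = "fps_const (-4) * (fps_X * fps_deriv wp_fps) + fps_X^4 * (fps_deriv wp_fps)^2"
  let ?R = "fps_const 12 * wp_fps + fps_const 12 * (fps_X^2 * wp_fps^2) + fps_const 4 * (fps_X^4 * wp_fps^3)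
     - fps_const ?g * fps_X^2 - fps_const ?g * (fps_X^4 * wp_fps) + fps_const c * fps_X^4"
  have eq: "?lhs z = ?rhs z" if "z \<in> - (L - {0})" for z
  proof (cases "z = 0")
    case False
    then have zL: "z \<in> - L" using that by auto
    have "z^6 * (deriv (wp L) z)^2 = z^6 * (4 * (wp L z)^3 - 60 * eis 4 L * wp L z + c)"
      using c[OF zL] by simp
    moreover have "z^6 * (deriv (wp L) z)^2 = 4 + z^2 * ?lhs z"
    proof -
      have "z^3 * deriv (wp L) z = - 2 + z^3 * deriv ?h z"
        unfolding deriv_wp[OF zL] using False by (simp add: field_simps)
      moreover have "z^6 * (deriv (wp L) z)^2 = (z^3 * deriv (wp L) z)^2"
        by (simp add: power_mult_distrib flip: power_mult)
      ultimately have "z^6 * (deriv (wp L) z)^2 = (- 2 + z^3 * deriv ?h z)^2" by (simp only:)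
      then show ?thesis by (rule trans[OF _ weierstrass_expand_lhs])
    qed
    moreover have "z^6 * (4 * (wp L z)^3 - 60 * eis 4 L * wp L z + c) = 4 + z^2 * ?rhs z"
    proof -
      show ?thesis by (rule weierstrass_expand_rhs[OF wp_scaled[OF False]])
    qed
    ultimately have "z^2 * ?lhs z = z^2 * ?rhs z" by (metis add_left_cancel)
    then show ?thesis using False by (metis mult_left_cancel power_not_zero)
  qed simp
  have "?L = ?R"
  proof (rule fps_expansion_unique_complex)
    show "?lhs has_fps_expansion ?L"
      by (intro fps_expansion_intros has_fps_expansion_deriv wp_reg_has_fps_expansion)
    have "?rhs has_fps_expansion ?R"
      by (intro fps_expansion_intros wp_reg_has_fps_expansion)
    moreover have "\<forall>\<^sub>F z in nhds 0. ?rhs z = ?lhs z"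
      using eventually_reg by eventually_elim (rule eq[symmetric])
    ultimately show "?lhs has_fps_expansion ?R"
      by (rule iffD1[OF has_fps_expansion_cong[OF _ refl], rotated])
  qed
  then have "?L $ 4 = ?R $ 4" by simp
  moreover have "?L $ 4 = - 16 * wp_fps $ 4"
  proof -
    have "(fps_X * fps_deriv wp_fps) $ 4 = 4 * wp_fps $ 4" by (simp add: eval_nat_numeral)
    moreover have "((fps_deriv wp_fps)^2) $ 0 = 0" using wp_fps_low by simp
    moreover have "(fps_X^4 * (fps_deriv wp_fps)^2) $ 4 = ((fps_deriv wp_fps)^2) $ 0"
      unfolding fps_X_power_mult_nth by simp
    ultimately show ?thesis by (simp only: fps_add_nth fps_mult_left_const_nth) simp
  qed
  moreover have "?R $ 4 = 12 * wp_fps $ 4 + c"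
  proof -
    have "(fps_X^2 * wp_fps^2) $ 4 = 0"
      unfolding fps_X_power_mult_nth using wp_fps_low
      by (simp add: power2_eq_square fps_mult_nth eval_nat_numeral)
    moreover have "(fps_X^4 * wp_fps^3) $ 4 = 0" "(fps_X^4 * wp_fps) $ 4 = 0"
      unfolding fps_X_power_mult_nth using wp_fps_low by simp_all
    moreover have "(fps_X^2 :: complex fps) $ 4 = 0" "(fps_X^4 :: complex fps) $ 4 = 1"
      unfolding fps_X_power_nth by simp_all
    ultimately show ?thesis by (simp only: fps_add_nth fps_sub_nth fps_mult_left_const_nth) simp
  qed
  ultimately have "- 16 * wp_fps $ 4 = 12 * wp_fps $ 4 + c" by (simp only:)
  then have "c = - 16 * wp_fps $ 4 - 12 * wp_fps $ 4" by (metis add_diff_cancel_left')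
  then have "c = - 140 * eis 6 L" using wp_fps_nth[of 4] by simp
  then show ?thesis using c[OF z] by simp
qed

text \<open>With \<open>a\<close> a double root, \<open>1 / (\<wp> - a)\<close> satisfies a linear differential equation near 0, hence
  continues to an entire function \<open>W\<close> whose zeros include \<open>L\<close> but lie on a line.\<close>
lemma no_double_root:
  assumes g2: "60 * eis 4 L = 12 * a^2" and g3: "140 * eis 6 L = - 8 * a^3"
  shows False
proof -
  obtain W c where W: "W holomorphic_on UNIV" "W 0 = 0" "deriv W 0 = 0"
    "\<And>z. deriv (deriv W) z = 2 + 12 * a * W z" "c \<noteq> 0" "\<And>w. W w = 0 \<Longrightarrow> Re (c * w) = 0"
    using degenerate_solution[of a] by blast
  define u where "u = (\<lambda>z. wp L z - a)"
  have u1: "(u has_field_derivative deriv (wp L) z) (at z)" if "z \<in> - L" for z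
    unfolding u_def using that by (auto intro!: derivative_eq_intros wp_field_derivative)
  \<comment> \<open>The cubic factors as 4 (X - a)^2 (X + 2 a), rewritten here in u = X - a.\<close>
  have sq: "(deriv (wp L) z)^2 = 4 * (u z)^2 * (u z + 3 * a)" if "z \<in> - L" for z
    using wp_first_order[OF that] unfolding g2 g3 u_def
    by (simp add: eval_nat_numeral algebra_simps)
  have u2: "deriv (deriv (wp L)) z = 6 * u z * (u z + 2 * a)" if "z \<in> - L" for z
  proof -
    have "30 * eis 4 L = 6 * a^2" using g2 by simp
    then have "deriv (deriv (wp L)) z = 6 * (wp L z)^2 - 6 * a^2"
      using wp_second_order[OF that] by (simp only:)
    also have "\<dots> = 6 * (wp L z - a) * (wp L z - a + 2 * a)"
      by (simp add: power2_eq_square algebra_simps)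
    finally show ?thesis unfolding u_def .
  qed
  define P where "P = (\<lambda>z. 1 + z^2 * (wp_reg L z - a))"
  have "isCont (wp_reg L) 0" using wp_reg_field_derivative[OF zero_in_reg] by (rule DERIV_isCont)
  then have "isCont P 0" unfolding P_def by (intro continuous_intros)
  then have "(P \<longlongrightarrow> P 0) (nhds 0)" by (simp add: continuous_at tendsto_nhds_iff)
  moreover have "P 0 \<noteq> 0" by (simp add: P_def)
  ultimately have "\<forall>\<^sub>F z in nhds 0. P z \<noteq> 0" by (rule tendsto_imp_eventually_ne)
  with eventually_reg have "\<forall>\<^sub>F z in nhds 0. z \<in> - (L - {0}) \<and> P z \<noteq> 0" by eventually_elim auto
  then obtain d where d: "d > 0" and near: "\<And>z. norm z < d \<Longrightarrow> z \<in> - (L - {0}) \<and> P z \<noteq> 0"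
    by (auto simp: eventually_nhds_metric)
  define B where "B = ball 0 d - {0::complex}"
  have B: "open B" "B \<subseteq> - L"
  proof -
    show "open B" unfolding B_def by (intro open_Diff) auto
    show "B \<subseteq> - L"
    proof
      fix z assume "z \<in> B"
      then show "z \<in> - L" using near[of z] by (auto simp: B_def)
    qed
  qed
  \<comment> \<open>This is 1 / u with its singularity at 0 removed. It has a double zero there, so
    its initial values match those of \<open>W\<close>.\<close>
  define v where "v = (\<lambda>z. z^2 * inverse (P z))"
  have uP: "u z = P z / z^2" and u0: "u z \<noteq> 0" and vu: "v z = 1 / u z" if "z \<in> B" for z
  proof -
    have z: "z \<noteq> 0" "norm z < d" using that by (auto simp: B_def)
    have "z^2 * u z = P z" using wp_scaled[OF z(1), of L] by (simp add: u_def P_def right_diff_distrib)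
    then show *: "u z = P z / z^2" using z(1) by (metis nonzero_mult_div_cancel_left power_not_zero)
    show "u z \<noteq> 0" using near[OF z(2)] z(1) * by simp
    show "v z = 1 / u z" unfolding v_def * by (simp add: field_simps)
  qed
  have v1: "deriv v z = - deriv (wp L) z / (u z)^2" if z: "z \<in> B" for z
  proof -
    have "\<forall>\<^sub>F x in nhds z. x \<in> B" using B(1) z by (rule eventually_nhds_in_open)
    then have "\<forall>\<^sub>F x in nhds z. v x = 1 / u x" by eventually_elim (rule vu)
    then have "deriv v z = deriv (\<lambda>x. 1 / u x) z" by (rule deriv_cong_ev) simp
    moreover have "((\<lambda>x. 1 / u x) has_field_derivative - deriv (wp L) z / (u z)^2) (at z)"
      using z B(2) u0[OF z] by (auto intro!: derivative_eq_intros u1 simp: power2_eq_square)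
    ultimately show ?thesis by (simp add: DERIV_imp_deriv)
  qed
  \<comment> \<open>By the quotient rule v'' = - u'' / u^2 + 2 u'^2 / u^3; inserting
    \<open>u2\<close> and \<open>sq\<close> leaves 8 (u + 3 a) / u - 6 (u + 2 a) / u = 2 + 12 a /
    u.\<close>
  have v2: "deriv (deriv v) z = 2 + 12 * a * v z" if z: "z \<in> B" for z
  proof -
    have zL: "z \<in> - L" using z B(2) by blast
    have "\<forall>\<^sub>F x in nhds z. x \<in> B" using B(1) z by (rule eventually_nhds_in_open)
    then have "\<forall>\<^sub>F x in nhds z. deriv v x = - deriv (wp L) x / (u x)^2" by eventually_elim (rule v1)
    then have "deriv (deriv v) z = deriv (\<lambda>x. - deriv (wp L) x / (u x)^2) z" by (rule deriv_cong_ev) simp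
    also have "\<dots> = (- deriv (deriv (wp L)) z * (u z)^2 + deriv (wp L) z * (2 * u z * deriv (wp L) z)) / ((u z)^2 * (u z)^2)"
    proof (rule DERIV_imp_deriv)
      have du2: "((\<lambda>x. (u x)^2) has_field_derivative 2 * u z * deriv (wp L) z) (at z)"
        using DERIV_power[OF u1[OF zL], of 2] by (simp add: mult_ac)
      have "(u z)^2 \<noteq> 0" using u0[OF z] by simp
      from DERIV_cong[OF DERIV_divide[OF DERIV_minus[OF deriv_wp_field_derivative[OF zL]] du2 this]]
      show "((\<lambda>x. - deriv (wp L) x / (u x)^2) has_field_derivative
        (- deriv (deriv (wp L)) z * (u z)^2 + deriv (wp L) z * (2 * u z * deriv (wp L) z)) / ((u z)^2 * (u z)^2)) (at z)" by simp
    qed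
    also have "\<dots> = (- deriv (deriv (wp L)) z * (u z)^2 + 2 * u z * (deriv (wp L) z)^2) / ((u z)^2 * (u z)^2)"
      by (simp add: power2_eq_square)
    also have "\<dots> = 2 + 12 * a * (1 / u z)"
    proof -
      have "(- (6 * t * (t + 2 * a)) * t^2 + 2 * t * (4 * t^2 * (t + 3 * a))) / (t^2 * t^2) = 2 + 12 * a * (1 / t)"
        if "t \<noteq> 0" for t :: complex
      proof -
        have e: "- (6 * t * (t + 2 * a)) * t^2 + 2 * t * (4 * t^2 * (t + 3 * a)) = (t^2 * t^2) * 2 + (t * t^2) * (12 * a)"
          by (simp add: power2_eq_square algebra_simps)
        have A: "(2 + 12 * a * (1 / t)) * (t^2 * t^2) = (t^2 * t^2) * 2 + (t * t^2) * (12 * a)"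
          using that by (simp add: distrib_right power2_eq_square)
        have "t^2 * t^2 \<noteq> 0" using that by simp
        from nonzero_divide_eq_eq[THEN iffD2, OF this A[symmetric]] show ?thesis unfolding e .
      qed
      then show ?thesis unfolding sq[OF zL] u2[OF zL] using u0[OF z] by blast
    qed
    finally show ?thesis by (simp add: vu[OF z])
  qed
  have P_fps: "P has_fps_expansion 1 + fps_X^2 * (wp_fps - fps_const a)"
    unfolding P_def by (intro fps_expansion_intros wp_reg_has_fps_expansion)
  define Q where "Q = inverse (1 + fps_X^2 * (wp_fps - fps_const a))"
  have Q0: "Q $ 0 = 1" by (simp add: Q_def)
  have "(\<lambda>z. inverse (P z)) has_fps_expansion Q"
    unfolding Q_def by (rule has_fps_expansion_inverse[OF P_fps]) simp
  then have v_fps: "v has_fps_expansion fps_X^2 * Q"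
    unfolding v_def by (intro fps_expansion_intros)
  define V where "V = fps_X^2 * Q"
  have V: "V $ 0 = 0" "V $ 1 = 0" "V $ 2 = 1" unfolding V_def fps_X_power_mult_nth using Q0 by simp_all
  note v_fps = v_fps[folded V_def]
  have V_ode: "fps_deriv (fps_deriv V) = fps_const 2 + fps_const (12 * a) * V"
  proof (rule fps_expansion_unique_complex)
    show dd: "deriv (deriv v) has_fps_expansion fps_deriv (fps_deriv V)"
      by (intro has_fps_expansion_deriv v_fps)
    have "(\<lambda>z. 2 + 12 * a * v z) has_fps_expansion fps_const 2 + fps_const (12 * a) * V"
      by (intro fps_expansion_intros v_fps)
    moreover have "\<forall>\<^sub>F z in nhds 0. 2 + 12 * a * v z = deriv (deriv v) z"
    proof -
      \<comment> \<open>The origin is excluded from \<open>B\<close>. There the equation reads v'' =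
        2, which comes from the coefficient \<open>V $ 2 = 1\<close>.\<close>
      have "deriv (deriv v) 0 = 2"
        using has_fps_expansion_imp_0_eq_fps_nth_0[OF dd] V by (simp add: eval_nat_numeral)
      then have "2 + 12 * a * v z = deriv (deriv v) z" if "z \<in> ball 0 d" for z
        using v2[of z] that by (cases "z = 0") (auto simp: v_def B_def)
      moreover have "\<forall>\<^sub>F z in nhds 0. z \<in> ball (0::complex) d"
        by (rule eventually_nhds_in_open) (use d in auto)
      ultimately show ?thesis by (auto elim!: eventually_mono)
    qed
    ultimately show "deriv (deriv v) has_fps_expansion fps_const 2 + fps_const (12 * a) * V"
      by (rule iffD1[OF has_fps_expansion_cong[OF _ refl], rotated])
  qed
  define WF where "WF = fps_expansion W 0"
  have W_fps: "W has_fps_expansion WF"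
    unfolding WF_def by (rule has_fps_expansion_fps_expansion[OF open_UNIV _ W(1)]) simp
  have W_ode: "fps_deriv (fps_deriv WF) = fps_const 2 + fps_const (12 * a) * WF"
  proof (rule fps_expansion_unique_complex)
    show "deriv (deriv W) has_fps_expansion fps_deriv (fps_deriv WF)"
      by (intro has_fps_expansion_deriv W_fps)
    have "(\<lambda>z. 2 + 12 * a * W z) has_fps_expansion fps_const 2 + fps_const (12 * a) * WF"
      by (intro fps_expansion_intros W_fps)
    moreover have "deriv (deriv W) = (\<lambda>z. 2 + 12 * a * W z)" using W(4) by (rule ext)
    ultimately show "deriv (deriv W) has_fps_expansion fps_const 2 + fps_const (12 * a) * WF" by (simp only:)
  qed
  have "V = WF"
    by (rule fps_linear_ode_unique[OF V_ode W_ode])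
      (use W(2,3) V in \<open>simp_all add: fps_nth_fps_expansion[OF W_fps]\<close>)
  then have "(\<lambda>z. v z - W z) has_fps_expansion 0"
    using has_fps_expansion_diff[OF v_fps W_fps] by simp
  then have "\<forall>\<^sub>F z in nhds 0. v z - W z = 0" by (simp only: has_fps_expansion_0_iff)
  then obtain e where e: "e > 0" "\<And>z. norm z < e \<Longrightarrow> v z = W z"
    by (auto simp: eventually_nhds_metric)
  define B' where "B' = ball 0 (min d e) - {0::complex}"
  have B': "open B'" "B' \<subseteq> B" "B' \<noteq> {}"
  proof -
    show "open B'" unfolding B'_def by (intro open_Diff) auto
    show "B' \<subseteq> B" by (auto simp: B'_def B_def)
    have "of_real (min d e / 2) \<in> B'" using d e by (auto simp: B'_def norm_divide)
    then show "B' \<noteq> {}" by blast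
  qed
  have uW: "u z * W z = 1" if "z \<in> - L" for z
  proof (rule analytic_continuation_open[OF B'(1) open_Compl_lattice B'(3) connected_Compl_lattice _ _ _ _ that])
    show "B' \<subseteq> - L" using B'(2) B(2) by blast
    show "(\<lambda>z. u z * W z) holomorphic_on - L"
      unfolding u_def by (intro holomorphic_intros holomorphic_wp holomorphic_on_subset[OF W(1)]) auto
    fix z assume z: "z \<in> B'"
    then have "v z = W z" "z \<in> B" using e(2)[of z] B'(2) by (auto simp: B'_def)
    then show "u z * W z = 1" using vu[of z] u0[of z] by (metis nonzero_mult_div_cancel_left times_divide_eq_right mult.right_neutral)
  qed auto
  have Wcont: "isCont W z" for z
    using W(1) holomorphic_on_imp_continuous_on continuous_on_eq_continuous_at[of UNIV W] by blast
  \<comment> \<open>Off the lattice \<open>W\<close> is the reciprocal of the periodic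
    \<open>u\<close>, so it has the same limit at \<open>w\<close> as at 0, where it
    vanishes.\<close>
  have WL: "W w = 0" if w: "w \<in> L" for w
  proof -
    have "\<forall>\<^sub>F z in at 0. z \<in> - (L - {0})" using eventually_reg unfolding eventually_nhds_conv_at by blast
    moreover have "\<forall>\<^sub>F z in at 0. z \<noteq> (0::complex)" by (rule eventually_neq_at_within)
    ultimately have "\<forall>\<^sub>F z in at 0. W (z + w) = W z"
    proof eventually_elim
      case (elim z)
      then have z: "z \<in> - L" by auto
      then have zw: "z + w \<in> - L" using shift_mem_iff[OF w] by auto
      have "u (z + w) = u z" using wp_periodic[OF w z] by (simp add: u_def)
      then have "u z * W (z + w) = u z * W z" using uW[OF z] uW[OF zw] by simp
      moreover have "u z \<noteq> 0" using uW[OF z] by auto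
      ultimately show ?case by simp
    qed
    moreover have "((\<lambda>z. W (z + w)) \<longlongrightarrow> W (0 + w)) (at 0)"
    proof -
      have "isCont (\<lambda>z. W (z + w)) 0"
        by (rule isCont_o2[where g = W]) (auto intro: continuous_intros Wcont)
      then show ?thesis by (simp add: isCont_def)
    qed
    moreover have "(W \<longlongrightarrow> W 0) (at 0)" using Wcont by (simp add: isCont_def)
    ultimately have "W (0 + w) = W 0"
      using tendsto_unique[of "at 0" W "W (0 + w)" "W 0"] tendsto_cong[of "\<lambda>z. W (z + w)" W "at 0"] by auto
    then show ?thesis using W(2) by simp
  qed
  obtain R where R: "R > 0" "\<And>z. \<exists>w\<in>L. norm (z - w) \<le> R" using cocompact by blast
  \<comment> \<open>Re (c z) = |c| R + 1 puts \<open>z\<close> at distance more than R from the line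
    Re (c w) = 0 on which all of \<open>L\<close> would lie.\<close>
  define z where "z = of_real (norm c * R + 1) / c"
  obtain w where w: "w \<in> L" "norm (z - w) \<le> R" using R(2) by blast
  have "norm c * R + 1 = Re (c * z)" using W(5) by (simp add: z_def)
  also have "\<dots> = Re (c * (z - w))" using W(6)[OF WL[OF w(1)]] by (simp add: algebra_simps)
  also have "\<dots> \<le> norm (c * (z - w))" by (rule complex_Re_le_cmod)
  also have "\<dots> \<le> norm c * R" using w(2) by (simp add: norm_mult mult_left_mono)
  finally show False by simp
qed

theorem discriminant_nonzero: "(60 * eis 4 L)^3 - 27 * (140 * eis 6 L)^2 \<noteq> 0"
proof
  define g2 where "g2 = 60 * eis 4 L"
  define g3 where "g3 = 140 * eis 6 L"
  assume "(60 * eis 4 L)^3 - 27 * (140 * eis 6 L)^2 = 0"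
  then have eq: "g2^3 = 27 * g3^2" by (simp add: g2_def g3_def)
  \<comment> \<open>For g2 = 12 a^2 and g3 = - 8 a^3 this quotient recovers the double root a. If g2
    = 0 then g3 = 0 as well, and the quotient is 0 by the convention for division, as it should
    be.\<close>
  define a where "a = - 3 * g3 / (2 * g2)"
  have "g2 = 12 * a^2 \<and> g3 = - 8 * a^3"
  proof (cases "g2 = 0")
    case True
    then show ?thesis using eq by (simp add: a_def)
  next
    case False
    have "12 * a^2 = 27 * g3^2 / g2^2" by (simp add: a_def power_divide power_mult_distrib)
    also have "\<dots> = g2" unfolding eq[symmetric] using False by (simp add: eval_nat_numeral)
    finally have "g2 = 12 * a^2" by simp
    moreover have "- 8 * a^3 = g3 * (27 * g3^2 / g2^3)"
      by (simp add: a_def power_divide power_mult_distrib eval_nat_numeral)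
    moreover have "27 * g3^2 / g2^3 = 1" unfolding eq[symmetric] using False by simp
    ultimately show ?thesis by simp
  qed
  then show False using no_double_root[of a] by (simp add: g2_def g3_def)
qed

end

section \<open>The \<open>j\<close>-invariant of a lattice\<close>

definition lattice_j :: "complex set \<Rightarrow> complex" where
  "lattice_j L = 1728 * (60 * eis 4 L)^3 / ((60 * eis 4 L)^3 - 27 * (140 * eis 6 L)^2)"

lemma one_A_Mod: "\<one>\<^bsub>R A_Mod L\<^esub> = L"
  by (simp add: A_FactGroup_def FactGroup_def)

lemma j_invariant_A_Mod: "j_invariant (R A_Mod L) = lattice_j L"
  by (simp add: j_invariant_def lattice_j_def eisenstein_g2_def eisenstein_g3_def eis_def one_A_Mod Let_def)

lemma modular_j_eq: "modular_j \<tau> = lattice_j (lattice_spanned \<tau> 1)"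
  by (simp add: modular_j_def j_invariant_A_Mod)

lemma eis_scale:
  assumes "c \<noteq> 0"
  shows "eis k ((*) c ` L) = eis k L / c ^ k"
proof -
  have "(*) c ` L - {0} = (*) c ` (L - {0})" using assms by auto
  moreover have "inj_on ((*) c) (L - {0})" using assms by (simp add: inj_on_def)
  ultimately have "eis k ((*) c ` L) = infsum ((\<lambda>w. 1 / w ^ k) \<circ> (*) c) (L - {0})"
    unfolding eis_def by (simp add: infsum_reindex)
  also have "\<dots> = (\<Sum>\<^sub>\<infinity>w\<in>L - {0}. 1 / c ^ k * (1 / w ^ k))"
    by (simp add: o_def power_mult_distrib)
  also have "\<dots> = 1 / c ^ k * eis k L"
    unfolding eis_def by (rule infsum_cmult_right')
  finally show ?thesis by simp
qed

lemma eis_cnj: "eis k (cnj ` L) = cnj (eis k L)"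
proof -
  have "cnj ` L - {0} = cnj ` (L - {0})" by auto
  moreover have "inj_on cnj (L - {0})" by (simp add: inj_on_def)
  ultimately have "eis k (cnj ` L) = infsum ((\<lambda>w. 1 / w ^ k) \<circ> cnj) (L - {0})"
    unfolding eis_def by (simp add: infsum_reindex)
  also have "\<dots> = (\<Sum>\<^sub>\<infinity>w\<in>L - {0}. cnj (1 / w ^ k))"
    by (simp add: o_def)
  finally show ?thesis unfolding eis_def infsum_cnj .
qed

lemma lattice_j_cnj: "lattice_j (cnj ` L) = cnj (lattice_j L)"
  by (simp add: lattice_j_def eis_cnj)

lemma lattice_j_scale:
  assumes "c \<noteq> 0"
  shows "lattice_j ((*) c ` L) = lattice_j L"
proof -
  define x where "x = (60 * eis 4 L)^3"
  define y where "y = 27 * (140 * eis 6 L)^2"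
  have x: "(60 * eis 4 ((*) c ` L))^3 = x / c ^ 12"
    unfolding eis_scale[OF assms] x_def by (simp add: power_divide flip: power_mult)
  have y: "27 * (140 * eis 6 ((*) c ` L))^2 = y / c ^ 12"
    unfolding eis_scale[OF assms] y_def by (simp add: power_divide flip: power_mult)
  show ?thesis
    unfolding lattice_j_def x y unfolding x_def[symmetric] y_def[symmetric]
    using assms by (simp flip: diff_divide_distrib)
qed

lemma lattice_disc_nonzero:
  assumes "is_lattice L"
  shows "(60 * eis 4 L)^3 - 27 * (140 * eis 6 L)^2 \<noteq> 0"
  using complex_lattice.discriminant_nonzero[OF is_lattice_imp_complex_lattice[OF assms]] .

text \<open>Cross-multiplication gives x^3 y'^2 = x'^3 y^2. If neither x nor y vanishes, X = x' / x
  and Y = y' / y satisfy X^3 = Y^2, and any square root t of Y / X has t^4 = X and t^6 = Y. If one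
  of them vanishes, so does its primed partner, and a sixth or fourth root of the other ratio
  serves; the nonzero discriminants exclude that both vanish.\<close>

lemma weighted_ratio:
  fixes x y x' y' :: complex
  assumes d: "x^3 - 27 * y^2 \<noteq> 0" and d': "x'^3 - 27 * y'^2 \<noteq> 0"
    and eq: "1728 * x^3 / (x^3 - 27 * y^2) = 1728 * x'^3 / (x'^3 - 27 * y'^2)"
  obtains t where "t \<noteq> 0" "x' = t^4 * x" "y' = t^6 * y"
proof -
  have "1728 * x^3 * (x'^3 - 27 * y'^2) = 1728 * x'^3 * (x^3 - 27 * y^2)"
    using eq frac_eq_eq[OF d d'] by blast
  then have cross: "x^3 * y'^2 = x'^3 * y^2" by (simp add: algebra_simps)
  have root: "\<exists>t. t \<noteq> 0 \<and> t ^ n = (z::complex)" if "n > 0" "z \<noteq> 0" for n z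
  proof -
    have "(exp (Ln z / of_nat n)) ^ n = z"
      using that by (simp flip: exp_of_nat_mult)
    then show ?thesis by (intro exI[of _ "exp (Ln z / of_nat n)"]) auto
  qed
  consider "x = 0" | "y = 0" "x \<noteq> 0" | "x \<noteq> 0" "y \<noteq> 0" by blast
  then show ?thesis
  proof cases
    case 1
    then have "y \<noteq> 0" using d by auto
    then have "x' = 0" using cross 1 by simp
    then have "y' \<noteq> 0" using d' by auto
    obtain t where "t \<noteq> 0" "t ^ 6 = y' / y" using root[of 6 "y' / y"] \<open>y \<noteq> 0\<close> \<open>y' \<noteq> 0\<close> by auto
    then show ?thesis using that[of t] 1 \<open>x' = 0\<close> \<open>y \<noteq> 0\<close> by simp
  next
    case 2
    then have "y' = 0" using cross by simp
    then have "x' \<noteq> 0" using d' by auto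
    obtain t where "t \<noteq> 0" "t ^ 4 = x' / x" using root[of 4 "x' / x"] 2 \<open>x' \<noteq> 0\<close> by auto
    then show ?thesis using that[of t] 2 \<open>y' = 0\<close> by simp
  next
    case 3
    have nz: "x' \<noteq> 0" "y' \<noteq> 0"
    proof -
      show "x' \<noteq> 0"
      proof
        assume "x' = 0"
        then have "y' = 0" using cross 3 by simp
        then show False using d' \<open>x' = 0\<close> by simp
      qed
      then show "y' \<noteq> 0" using cross 3 by auto
    qed
    define X' Y' where "X' = x' / x" and "Y' = y' / y"
    have XY: "X'^3 = Y'^2" "X' \<noteq> 0" "Y' \<noteq> 0"
      using cross 3 nz by (auto simp: X'_def Y'_def power_divide frac_eq_eq mult.commute)
    obtain t where t: "t \<noteq> 0" "t ^ 2 = Y' / X'" using root[of 2 "Y' / X'"] XY by auto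
    have "t ^ 4 = (t ^ 2) ^ 2" by (simp flip: power_mult)
    also have "\<dots> = X' ^ 3 / X' ^ 2" unfolding t(2) XY(1) power_divide ..
    also have "\<dots> = X'" using XY(2) by (simp add: eval_nat_numeral)
    finally have 4: "t ^ 4 = X'" .
    have "t ^ 6 = t ^ 4 * t ^ 2" by (simp flip: power_add)
    also have "\<dots> = Y'" unfolding 4 t(2) using XY(2) by simp
    finally have 6: "t ^ 6 = Y'" .
    show ?thesis using that[of t] t(1) 4 6 3 by (simp add: X'_def Y'_def)
  qed
qed

theorem lattice_j_eq_iff:
  assumes L: "is_lattice L" and L': "is_lattice L'"
  shows "lattice_j L = lattice_j L' \<longleftrightarrow> (\<exists>s. s \<noteq> 0 \<and> L' = (*) s ` L)"
proof
  assume "lattice_j L = lattice_j L'"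
  then obtain t where t: "t \<noteq> 0" "60 * eis 4 L' = t^4 * (60 * eis 4 L)" "140 * eis 6 L' = t^6 * (140 * eis 6 L)"
    using weighted_ratio[OF lattice_disc_nonzero[OF L] lattice_disc_nonzero[OF L']] unfolding lattice_j_def by blast
  \<comment> \<open>\<open>eis k\<close> is homogeneous of degree - k in the lattice, so the scaling
    factor is the inverse of \<open>t\<close>.\<close>
  define s where "s = inverse t"
  have s: "s \<noteq> 0" using t by (simp add: s_def)
  have "L' = (*) s ` L"
  proof (rule lattice_eqI)
    show "complex_lattice L'" "complex_lattice ((*) s ` L)"
      using L L' s by (auto intro: is_lattice_imp_complex_lattice is_lattice_scale)
    show "eis 4 L' = eis 4 ((*) s ` L)" "eis 6 L' = eis 6 ((*) s ` L)"
      unfolding eis_scale[OF s] using t by (simp_all add: s_def power_inverse field_simps)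
  qed
  then show "\<exists>s. s \<noteq> 0 \<and> L' = (*) s ` L" using s by blast
next
  assume "\<exists>s. s \<noteq> 0 \<and> L' = (*) s ` L"
  then show "lattice_j L = lattice_j L'" using lattice_j_scale by auto
qed

lemma lattice_j_real_iff:
  assumes "is_lattice L"
  shows "lattice_j L \<in> \<real> \<longleftrightarrow> (\<exists>s. s \<noteq> 0 \<and> cnj ` L = (*) s ` L)"
  using lattice_j_eq_iff[OF assms is_lattice_cnj[OF assms]]
  unfolding lattice_j_cnj Reals_cnj_iff by auto

section \<open>Rhombic lattices and j on the line Re \<tau> = 1/2\<close>

abbreviation half_lattice :: "real \<Rightarrow> complex set" where
  "half_lattice t \<equiv> lattice_spanned (Complex (1/2) t) 1"

lemma lattice_half_cnj: "cnj ` half_lattice t = half_lattice t"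
proof -
  have c: "cnj (Complex (1/2) t) = 1 - Complex (1/2) t" by (simp add: complex_eq_iff)
  have "lattice_spanned (1 - \<tau>) 1 = lattice_spanned \<tau> 1" for \<tau> :: complex
  proof -
    have *: "lattice_spanned (1 - \<tau>) 1 \<subseteq> lattice_spanned \<tau> 1" for \<tau> :: complex
    proof
      fix x assume "x \<in> lattice_spanned (1 - \<tau>) 1"
      then obtain m n :: int where "x = of_int m * (1 - \<tau>) + of_int n * 1" unfolding lattice_spanned_def by blast
      then have "x = of_int (- m) * \<tau> + of_int (n + m) * 1" by (simp add: algebra_simps)
      then show "x \<in> lattice_spanned \<tau> 1" unfolding lattice_spanned_def by blast
    qed
    from *[of \<tau>] *[of "1 - \<tau>"] show ?thesis by simp
  qed
  then show ?thesis unfolding cnj_lattice_spanned c by simp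
qed

lemma is_lattice_half: "t > 0 \<Longrightarrow> is_lattice (half_lattice t)"
  by (rule is_lattice_tau) simp

lemma lattice_j_half_real: "lattice_j (half_lattice t) \<in> \<real>"
  unfolding Reals_cnj_iff lattice_j_cnj[symmetric] lattice_half_cnj ..

text \<open>|m \<tau> + n| does not decrease as t grows along the line, so the summands at t = 1/2
  majorize those on the whole half-line and the M-test applies.\<close>

lemma continuous_on_eis_half:
  assumes k: "k \<ge> 3"
  shows "continuous_on {1/2..} (\<lambda>t. eis k (half_lattice t))"
proof -
  define g where "g = (\<lambda>(m::int, n::int) t. of_int m * Complex (1/2) t + of_int n)"
  let ?I = "UNIV - {(0::int, 0::int)}"
  have bij: "bij_betw (\<lambda>p. g p t) ?I (half_lattice t - {0})" if "t > 0" for t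
    using bij_betw_lattice_spanned[of "Complex (1/2) t" 1] that by (simp add: g_def case_prod_beta')
  have nz: "g p t \<noteq> 0" if "p \<in> ?I" "t > 0" for p t
    using bij[OF that(2)] that(1) by (auto simp: bij_betw_def)
  have norm: "norm (g p (1/2)) \<le> norm (g p t)" if "t \<ge> 1/2" for p t
  proof -
    have "(1/2)^2 \<le> t^2" using that by (intro power_mono) auto
    then have "(of_int (fst p))^2 * (1/2)^2 \<le> (of_int (fst p))^2 * t^2" by (intro mult_left_mono) auto
    then have "(of_int (fst p) / 2)^2 \<le> (of_int (fst p))^2 * t^2" by (simp add: power_divide)
    then show ?thesis unfolding g_def norm_complex_def case_prod_beta'
      by (simp add: power_mult_distrib)
  qed
  have "(\<lambda>w. 1 / norm w ^ k) summable_on (half_lattice (1/2) - {0})"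
    by (rule complex_lattice.summable_powers[OF is_lattice_imp_complex_lattice[OF is_lattice_half] k]) simp
  then have M: "(\<lambda>p. 1 / norm (g p (1/2)) ^ k) summable_on ?I"
    using summable_on_reindex_bij_betw[OF bij[of "1/2"], of "\<lambda>w. 1 / norm w ^ k"] by simp
  have "continuous_on {1/2..} (\<lambda>t. \<Sum>\<^sub>\<infinity>p\<in>?I. 1 / g p t ^ k)"
  proof (rule uniform_limit_theorem)
    show "uniform_limit {1/2..} (\<lambda>Y t. \<Sum>p\<in>Y. 1 / g p t ^ k) (\<lambda>t. \<Sum>\<^sub>\<infinity>p\<in>?I. 1 / g p t ^ k) (finite_subsets_at_top ?I)"
    proof (rule Weierstrass_m_test_general[OF _ M])
      fix p t assume p: "p \<in> ?I" and t: "t \<in> {1/2::real..}"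
      have "norm (g p (1/2)) > 0" "norm (g p t) > 0" using nz[OF p] t by auto
      then have "1 / norm (g p t) ^ k \<le> 1 / norm (g p (1/2)) ^ k"
        using norm[of t p] t by (intro divide_left_mono power_mono mult_pos_pos zero_less_power) auto
      then show "norm (1 / g p t ^ k) \<le> 1 / norm (g p (1/2)) ^ k"
        by (simp add: norm_divide norm_power)
    qed
    have "continuous_on {1/2..} (\<lambda>t. \<Sum>p\<in>Y. 1 / g p t ^ k)" if "Y \<subseteq> ?I" for Y
    proof (intro continuous_on_sum)
      fix p assume "p \<in> Y"
      then have p: "p \<in> ?I" using that by blast
      have "continuous_on {1/2..} (g p)"
        unfolding g_def case_prod_beta' Complex_eq by (intro continuous_intros)
      then show "continuous_on {1/2..} (\<lambda>t. 1 / g p t ^ k)"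
        using nz[OF p] by (intro continuous_intros) auto
    qed
    then show "\<forall>\<^sub>F Y in finite_subsets_at_top ?I. continuous_on {1/2..} (\<lambda>t. \<Sum>p\<in>Y. 1 / g p t ^ k)"
      by (intro eventually_finite_subsets_at_top_weakI) blast
  qed simp
  moreover have "(\<Sum>\<^sub>\<infinity>p\<in>?I. 1 / g p t ^ k) = eis k (half_lattice t)" if "t \<in> {1/2..}" for t
    unfolding eis_def using that by (intro infsum_reindex_bij_betw[OF bij, of _ "\<lambda>w. 1 / w ^ k"]) auto
  ultimately show ?thesis using continuous_on_cong[OF refl] by (metis (no_types, lifting))
qed

lemma continuous_on_lattice_j_half:
  "continuous_on {1/2..} (\<lambda>t. lattice_j (half_lattice t))"
proof -
  have "(60 * eis 4 (half_lattice t))^3 - 27 * (140 * eis 6 (half_lattice t))^2 \<noteq> 0"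
    if "t \<in> {1/2..}" for t
    by (rule lattice_disc_nonzero[OF is_lattice_half]) (use that in auto)
  then show ?thesis unfolding lattice_j_def
    by (intro continuous_intros continuous_on_eis_half) auto
qed

text \<open>For \<tau> = 1/2 + t i and an integer matrix with bottom row c, d, the quantity e^2 + 4
  c^2 t^2 is 4 |c \<tau> + d|^2, and \<open>det\<close> is the formula for the imaginary part of the
  image of \<tau>. With t' at least t this quantity is at most 4, and t \<ge> 1/2 then leaves few
  pairs c, e; each of them either gives the value 4, hence t = t', or is contradictory.\<close>

lemma half_line_arith:
  fixes a c d e :: int and t t' :: real
  assumes t: "t \<ge> 1/2" "t' \<ge> t" and e: "e = c + 2 * d"
    and im: "c * t + t' * e = 2 * a * t" and det: "4 * t = t' * (e^2 + 4 * c^2 * t^2)"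
  shows "t = t'"
proof -
  have pos: "t > 0" "t' > 0" using t by auto
  define q where "q = real_of_int (e^2) + 4 * real_of_int (c^2) * t^2"
  have det': "4 * t = t' * q" using det by (simp add: q_def)
  have q4: "q \<le> 4"
  proof (rule ccontr)
    assume "\<not> q \<le> 4"
    then have "t' * 4 < t' * q" using pos by simp
    then show False using det' t by linarith
  qed
  have q_eq: ?thesis if "q = 4" using det' that by simp
  have t4: "4 * t^2 \<ge> 1"
  proof -
    have "(1/2)^2 \<le> t^2" using t by (intro power_mono) auto
    then show ?thesis by (simp add: power2_eq_square)
  qed
  have "real_of_int (c^2) * 1 \<le> real_of_int (c^2) * (4 * t^2)" using t4 by (intro mult_left_mono) auto
  then have ec: "real_of_int (e^2 + c^2) \<le> 4" using q4 by (simp add: q_def)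
  then have ec: "e^2 + c^2 \<le> 4" by linarith
  have "c^2 \<le> 2^2" "e^2 \<le> 2^2" using ec by (simp_all add: order_trans[OF _ ec])
  then have c2: "\<bar>c\<bar> \<le> 2" and e2: "\<bar>e\<bar> \<le> 2" by (auto simp only: power2_le_iff_abs_le[of 2])
  then consider "c = 0" | "\<bar>c\<bar> = 1" | "\<bar>c\<bar> = 2" by linarith
  then show ?thesis
  proof cases
    case 1
    then have "e = 0 \<or> \<bar>e\<bar> = 2" using e e2 by presburger
    then have "e^2 = 0 \<or> e^2 = 4" by (metis power2_abs zero_power2 numeral_Bit0 power2_eq_square mult_2 numeral_One one_add_one mult_2_right)
    then have "(of_int e :: real)^2 = 0 \<or> (of_int e :: real)^2 = 4" by (metis of_int_power of_int_0 of_int_numeral)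
    then have "q = 0 \<or> q = 4" using 1 by (auto simp: q_def)
    then show ?thesis using q_eq det' pos by auto
  next
    case 2
    then have "\<bar>e\<bar> = 1" using e e2 by presburger
    then have sq: "e^2 = 1" "c^2 = 1" using 2 by (metis power2_abs one_power2)+
    then have q: "q = 1 + 4 * t^2" by (simp add: q_def)
    have q2: "q \<ge> 2" using t4 q by simp
    \<comment> \<open>Multiplying \<open>im\<close> by \<open>q\<close> eliminates t' and leads to
      (2 a - c) q = 4 e with |e| = 1. As 2 a - c is odd and q \<ge> 2, it is 1 in absolute value, so
      q = 4.\<close>
    have "c * t * q + t * (4 * e) = 2 * a * t * q"
    proof -
      have "c * t * q + t' * e * q = 2 * a * t * q" using im by (metis distrib_right)
      moreover have "t' * e * q = t * (4 * e)" using det' by (simp add: mult_ac)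
      ultimately show ?thesis by linarith
    qed
    then have "t * (c * q + 4 * e) = t * (2 * a * q)" by (simp add: algebra_simps)
    then have "c * q + 4 * e = 2 * a * q" using pos by simp
    then have "(2 * a - c) * q = 4 * e" by (simp add: algebra_simps)
    then have "\<bar>2 * a - c\<bar> * q = 4 * \<bar>real_of_int e\<bar>" using q2 by (metis abs_mult abs_numeral abs_of_nonneg order_trans zero_le_numeral of_int_abs of_int_mult of_int_numeral of_int_diff)
    then have "real_of_int \<bar>2 * a - c\<bar> * q = 4" using \<open>\<bar>e\<bar> = 1\<close> by (metis of_int_abs of_int_1 mult.right_neutral)
    moreover have "odd \<bar>2 * a - c\<bar>" using 2 by presburger
    moreover define o' where "o' = \<bar>2 * a - c\<bar>"
    ultimately have o': "real_of_int o' * q = 4" "odd o'" "o' \<ge> 0" by auto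
    have "o' \<noteq> 0" using o' by auto
    moreover have "o' < 3"
    proof (rule ccontr)
      assume "\<not> o' < 3"
      then have "3 * 2 \<le> real_of_int o' * q" using q2 by (intro mult_mono) auto
      then show False using o' by simp
    qed
    moreover have "o' \<noteq> 2" using o'(2) by auto
    ultimately have "o' = 1" using o'(3) by linarith
    then show ?thesis using q_eq o' by simp
  next
    case 3
    then have c4: "c^2 = 4" by (metis power2_abs numeral_Bit0 power2_eq_square mult_2 numeral_One one_add_one mult_2_right)
    then have "e^2 \<le> 0" using ec by simp
    then have "q = 16 * t^2" using c4 by (simp add: q_def)
    then have "q = 4" using t4 q4 by simp
    then show ?thesis by (rule q_eq)
  qed
qed

text \<open>From s (c \<tau> + d) = 1 and s (a \<tau> + b) = \<tau>' follows \<tau>' (c \<tau> + d)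
  = a \<tau> + b, and its imaginary part is the second conclusion. Inclusion in both directions
  makes a d - b c equal to 1 or - 1; \<open>e\<close> is twice the real part of c \<tau> +
  d.\<close>

lemma half_lattice_params:
  fixes t t' :: real
  assumes t: "t > 0" "t' > 0" and s: "s \<noteq> 0"
    and eq: "half_lattice t' = (*) s ` half_lattice t"
  obtains a c d e :: int where "e = c + 2 * d"
    "c * t + t' * e = 2 * a * t" "4 * t = t' * (e^2 + 4 * c^2 * t^2)"
proof -
  define \<tau> \<tau>' where "\<tau> = Complex (1/2) t" and "\<tau>' = Complex (1/2) t'"
  have mem: "x \<in> lattice_spanned w 1 \<longleftrightarrow> (\<exists>m n::int. x = of_int m * w + of_int n)" for x w
    by (auto simp: lattice_spanned_def)
  have "\<exists>m n::int. \<tau>' = s * (of_int m * \<tau> + of_int n)"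
  proof -
    have "\<tau>' \<in> lattice_spanned \<tau>' 1" unfolding mem by (intro exI[of _ 1] exI[of _ 0]) simp
    then obtain x where "x \<in> lattice_spanned \<tau> 1" "\<tau>' = s * x"
      using eq unfolding \<tau>_def[symmetric] \<tau>'_def[symmetric] by blast
    then show ?thesis unfolding mem by blast
  qed
  then obtain a b :: int where ab: "\<tau>' = s * (of_int a * \<tau> + of_int b)" by blast
  have "\<exists>m n::int. 1 = s * (of_int m * \<tau> + of_int n)"
  proof -
    have "1 \<in> lattice_spanned \<tau>' 1" unfolding mem by (intro exI[of _ 0] exI[of _ 1]) simp
    then obtain x where "x \<in> lattice_spanned \<tau> 1" "1 = s * x"
      using eq unfolding \<tau>_def[symmetric] \<tau>'_def[symmetric] by blast
    then show ?thesis unfolding mem by blast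
  qed
  then obtain c d :: int where cd: "1 = s * (of_int c * \<tau> + of_int d)" by blast
  have inv_mem: "\<exists>m n::int. s * x = of_int m * \<tau>' + of_int n" if "x \<in> lattice_spanned \<tau> 1" for x
    using that eq unfolding \<tau>_def[symmetric] \<tau>'_def[symmetric] by (metis imageI mem)
  have "\<tau> \<in> lattice_spanned \<tau> 1" unfolding mem by (intro exI[of _ 1] exI[of _ 0]) simp
  from inv_mem[OF this] obtain p q :: int where pq: "s * \<tau> = of_int p * \<tau>' + of_int q" by blast
  have "1 \<in> lattice_spanned \<tau> 1" unfolding mem by (intro exI[of _ 0] exI[of _ 1]) simp
  from inv_mem[OF this] obtain r u :: int where ru: "s = of_int r * \<tau>' + of_int u" by auto
  have lin: "m = 0 \<and> n = 0" if "of_int m * \<tau> + of_int n = 0" for m n :: int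
    using that t by (auto simp: \<tau>_def complex_eq_iff)
  have "s * \<tau> = s * (of_int (p * a + q * c) * \<tau> + of_int (p * b + q * d))"
  proof -
    have "s * \<tau> = of_int p * (s * (of_int a * \<tau> + of_int b)) + of_int q * (s * (of_int c * \<tau> + of_int d))"
      using pq ab cd by (metis mult.right_neutral)
    then show ?thesis by (simp add: algebra_simps)
  qed
  then have "\<tau> = of_int (p * a + q * c) * \<tau> + of_int (p * b + q * d)"
    unfolding mult_left_cancel[OF s] .
  then have "of_int (p * a + q * c - 1) * \<tau> + of_int (p * b + q * d) = 0" by (simp add: algebra_simps)
  from lin[OF this] have 1: "p * a + q * c = 1" "p * b + q * d = 0" by auto
  have "s * 1 = s * (of_int (r * a + u * c) * \<tau> + of_int (r * b + u * d))"
  proof -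
    have "s = of_int r * (s * (of_int a * \<tau> + of_int b)) + of_int u * (s * (of_int c * \<tau> + of_int d))"
      using ru ab cd by (metis mult.right_neutral)
    then show ?thesis by (simp add: algebra_simps)
  qed
  then have "1 = of_int (r * a + u * c) * \<tau> + of_int (r * b + u * d)"
    unfolding mult_left_cancel[OF s] .
  then have "of_int (r * a + u * c) * \<tau> + of_int (r * b + u * d - 1) = 0" by (simp add: algebra_simps)
  from lin[OF this] have 2: "r * a + u * c = 0" "r * b + u * d = 1" by auto
  have "(p * u - q * r) * (a * d - b * c) = (p * a + q * c) * (r * b + u * d) - (p * b + q * d) * (r * a + u * c)"
    by (simp add: algebra_simps)
  also have "\<dots> = 1" using 1 2 by simp
  finally have det: "a * d - b * c = 1 \<or> a * d - b * c = -1" by (simp add: zmult_eq_1_iff mult.commute) blast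
  define e where "e = c + 2 * d"
  have "\<tau>' * (of_int c * \<tau> + of_int d) = of_int a * \<tau> + of_int b"
    using ab cd by (metis mult.assoc mult.commute mult.right_neutral)
  then have "Re (\<tau>' * (of_int c * \<tau> + of_int d)) = Re (of_int a * \<tau> + of_int b)"
    "Im (\<tau>' * (of_int c * \<tau> + of_int d)) = Im (of_int a * \<tau> + of_int b)" by simp_all
  then have re: "e - 4 * c * t * t' = 2 * a + 4 * b" and im: "c * t + t' * e = 2 * a * t"
    by (simp_all add: \<tau>_def \<tau>'_def e_def algebra_simps)
  have i1: "t' * e = 2 * a * t - c * t" using im by simp
  have r1: "- 4 * c * t * t' = 2 * a + 4 * b - e" using re by linarith
  have "4 * (a * d - b * c) * t = t' * (e^2 + 4 * c^2 * t^2)"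
  proof -
    have "t' * (e^2 + 4 * c^2 * t^2) = e * (t' * e) - c * t * (- 4 * c * t * t')"
      by (simp add: power2_eq_square algebra_simps)
    also have "\<dots> = e * (2 * a * t - c * t) - c * t * (2 * a + 4 * b - e)"
      by (simp only: i1 r1)
    also have "\<dots> = 4 * (a * d - b * c) * t" by (simp add: e_def algebra_simps)
    finally show ?thesis by simp
  qed
  \<comment> \<open>Positivity selects the determinant 1: with - 1 this nonnegative quantity would
    equal - 4 t.\<close>
  moreover have "t' * (e^2 + 4 * c^2 * t^2) \<ge> 0" using t by simp
  moreover have "real_of_int (4 * (a * d - b * c)) = 4 \<or> real_of_int (4 * (a * d - b * c)) = - 4"
    using det by (elim disjE) (simp_all only:, simp_all)
  moreover have "\<not> - 4 * t \<ge> 0" using t by simp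
  ultimately have "4 * t = t' * (e^2 + 4 * c^2 * t^2)" by metis
  then show ?thesis using that[of e c d a] e_def im by blast
qed

lemma half_lattice_inj:
  assumes t: "t \<ge> 1/2" "t' \<ge> 1/2" and s: "s \<noteq> 0"
    and eq: "half_lattice t' = (*) s ` half_lattice t"
  shows "t = t'"
proof -
  have tp: "t > 0" "t' > 0" using t by auto
  show ?thesis
  proof (cases "t' \<ge> t")
    case True
    obtain a c d e :: int where "e = c + 2 * d"
      "c * t + t' * e = 2 * a * t" "4 * t = t' * (e^2 + 4 * c^2 * t^2)"
      by (rule half_lattice_params[OF tp s eq]) blast
    then show ?thesis using half_line_arith[OF t(1) True] by blast
  next
    case False
    have s': "inverse s \<noteq> 0" using s by simp
    have eq': "half_lattice t = (*) (inverse s) ` half_lattice t'"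
      unfolding eq image_image using s by (simp flip: mult.assoc)
    obtain a c d e :: int where "e = c + 2 * d"
      "c * t' + t * e = 2 * a * t'" "4 * t' = t * (e^2 + 4 * c^2 * t'^2)"
      by (rule half_lattice_params[OF tp(2,1) s' eq']) blast
    then show ?thesis using half_line_arith[of t' t] t False by force
  qed
qed

definition j_half :: "real \<Rightarrow> real" where
  "j_half t = Re (lattice_j (half_lattice t))"

lemma of_real_j_half: "of_real (j_half t) = lattice_j (half_lattice t)"
  unfolding j_half_def using lattice_j_half_real by (metis of_real_Re)

lemma j_half_inj:
  assumes "t \<ge> 1/2" "t' \<ge> 1/2" "j_half t = j_half t'"
  shows "t = t'"
proof -
  have "lattice_j (half_lattice t) = lattice_j (half_lattice t')"
    unfolding of_real_j_half[symmetric] using assms by simp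
  then show ?thesis
    using lattice_j_eq_iff[OF is_lattice_half is_lattice_half, of t t'] half_lattice_inj assms by auto
qed

lemma lattice_spanned_subsetI:
  assumes "w1 \<in> lattice_spanned v1 v2" "w2 \<in> lattice_spanned v1 v2"
  shows "lattice_spanned w1 w2 \<subseteq> lattice_spanned v1 v2"
proof
  fix x assume "x \<in> lattice_spanned w1 w2"
  then obtain m n :: int where x: "x = of_int m * w1 + of_int n * w2" by (auto simp: lattice_spanned_def)
  obtain p q r u :: int where "w1 = of_int p * v1 + of_int q * v2" "w2 = of_int r * v1 + of_int u * v2"
    using assms by (auto simp: lattice_spanned_def)
  then have "x = of_int (m * p + n * r) * v1 + of_int (m * q + n * u) * v2"
    using x by (simp add: algebra_simps)
  then show "x \<in> lattice_spanned v1 v2" unfolding lattice_spanned_def by blast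
qed

lemma lattice_spanned_memI: "x = of_int m * w1 + of_int n * w2 \<Longrightarrow> x \<in> lattice_spanned w1 w2"
  unfolding lattice_spanned_def by blast

text \<open>The lattice at \<open>(1 + \<i>)/2\<close> has the automorphism \<open>\<i>\<close>, which kills the Eisenstein series of weight 6.\<close>
lemma j_half_half: "j_half (1/2) = 1728"
proof -
  define \<tau> where "\<tau> = Complex (1/2) (1/2)"
  define L where "L = lattice_spanned \<tau> 1"
  have L: "is_lattice L" unfolding L_def \<tau>_def by (rule is_lattice_half) simp
  have "(*) \<i> ` L = L"
  proof -
    have "\<i> * \<tau> = of_int 1 * \<tau> + of_int (-1) * 1" "\<i> * 1 = of_int 2 * \<tau> + of_int (-1) * 1"
      by (simp_all add: \<tau>_def complex_eq_iff)
    then have sub: "(*) \<i> ` L \<subseteq> L" unfolding L_def scale_lattice_spanned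
      by (intro lattice_spanned_subsetI) (rule lattice_spanned_memI, assumption)+
    moreover have "L \<subseteq> (*) \<i> ` L"
    proof
      fix x assume "x \<in> L"
      then have "- (\<i> * x) \<in> L"
        using sub complex_lattice.uminus_mem[OF is_lattice_imp_complex_lattice[OF L]] by blast
      moreover have "x = \<i> * (- (\<i> * x))" by (simp flip: mult.assoc)
      ultimately show "x \<in> (*) \<i> ` L" by blast
    qed
    ultimately show ?thesis by blast
  qed
  then have "eis 6 L = eis 6 L / \<i> ^ 6" using eis_scale[of \<i> 6 L] by simp
  then have "eis 6 L = - eis 6 L" by (simp add: eval_nat_numeral)
  then have "eis 6 L = 0" by simp
  then have "lattice_j L = 1728" using lattice_disc_nonzero[OF L] by (simp add: lattice_j_def)
  then show ?thesis unfolding j_half_def L_def \<tau>_def by simp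
qed

text \<open>The lattice at the primitive sixth root of unity \<open>\<tau>\<close> has the automorphism \<open>\<tau>\<close>, which kills
  the Eisenstein series of weight 4.\<close>
lemma j_half_rho: "j_half (sqrt 3 / 2) = 0"
proof -
  define \<tau> where "\<tau> = Complex (1/2) (sqrt 3 / 2)"
  define L where "L = lattice_spanned \<tau> 1"
  have L: "is_lattice L" unfolding L_def \<tau>_def by (rule is_lattice_half) simp
  have sq: "\<tau> * \<tau> = \<tau> - 1" by (simp add: \<tau>_def complex_eq_iff)
  have "(*) \<tau> ` L = L"
  proof -
    have "\<tau> * \<tau> = of_int 1 * \<tau> + of_int (-1) * 1" "\<tau> * 1 = of_int 1 * \<tau> + of_int 0 * 1"
      using sq by simp_all
    then have sub: "(*) \<tau> ` L \<subseteq> L" unfolding L_def scale_lattice_spanned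
      by (intro lattice_spanned_subsetI) (rule lattice_spanned_memI, assumption)+
    moreover have "L \<subseteq> (*) \<tau> ` L"
    proof
      fix x assume "x \<in> L"
      then have "x - \<tau> * x \<in> L"
        using sub complex_lattice.diff_mem[OF is_lattice_imp_complex_lattice[OF L]] by blast
      moreover have "x = \<tau> * (x - \<tau> * x)"
        using arg_cong[OF sq, of "\<lambda>y. y * x"] by (simp add: algebra_simps)
      ultimately show "x \<in> (*) \<tau> ` L" by blast
    qed
    ultimately show ?thesis by blast
  qed
  moreover have \<tau>: "\<tau> \<noteq> 0" by (simp add: \<tau>_def complex_eq_iff)
  ultimately have "eis 4 L = eis 4 L / \<tau> ^ 4" using eis_scale[of \<tau> 4 L] by simp
  moreover have "\<tau> ^ 4 = - \<tau>"
  proof -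
    have "\<tau> ^ 4 = (\<tau> * \<tau>) * (\<tau> * \<tau>)" by (simp add: power4_eq_xxxx mult_ac)
    also have "\<dots> = - \<tau>" unfolding sq using sq by (simp add: algebra_simps)
    finally show ?thesis .
  qed
  ultimately have "eis 4 L * (1 + \<tau>) = 0" using \<tau> by (simp add: field_simps)
  moreover have "1 + \<tau> \<noteq> 0" by (simp add: \<tau>_def complex_eq_iff)
  ultimately have "eis 4 L = 0" by simp
  then have "lattice_j L = 0" by (simp add: lattice_j_def)
  then show ?thesis unfolding j_half_def L_def \<tau>_def by simp
qed

lemma continuous_on_j_half: "continuous_on {1/2..} j_half"
  unfolding j_half_def[abs_def] by (intro continuous_on_Re continuous_on_lattice_j_half)

text \<open>A continuous injective function on an interval is monotone; the values at \<open>1/2\<close> and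
  \<open>\<surd>3/2\<close> show that it decreases.\<close>
lemma j_half_bounds:
  assumes "1/2 < t" "t \<le> T"
  shows "j_half T \<le> j_half t" "j_half t < 1728"
proof -
  have mono: "(j_half a < j_half x \<and> j_half x < j_half b) \<or> (j_half b < j_half x \<and> j_half x < j_half a)"
    if "1/2 \<le> a" "a < x" "x < b" for a x b
  proof (rule continuous_inj_imp_mono[where f = j_half and a = a and b = b and x = x])
    show "continuous_on {a..b} j_half"
      by (rule continuous_on_subset[OF continuous_on_j_half]) (use that in auto)
    show "inj_on j_half {a..b}"
    proof (rule inj_onI)
      fix u v assume "u \<in> {a..b}" "v \<in> {a..b}" "j_half u = j_half v"
      then show "u = v" using j_half_inj[of u v] that by simp
    qed
  qed (use that in auto)
  have "(1::real) < sqrt 3" by simp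
  then have r: "(1/2::real) < sqrt 3 / 2" by simp
  \<comment> \<open>\<open>B\<close> lies beyond both t and sqrt 3 / 2, so the direction found at
    sqrt 3 / 2 carries over to t by comparing the same end values.\<close>
  define B where "B = max t (sqrt 3 / 2) + 1"
  have B: "t < B" "sqrt 3 / 2 < B" by (auto simp: B_def)
  have "j_half B < j_half (1/2)"
    using mono[OF _ r B(2)] by (auto simp: j_half_half j_half_rho)
  then show lt: "j_half t < 1728"
    using mono[OF _ assms(1) B(1)] by (auto simp: j_half_half)
  show "j_half T \<le> j_half t"
  proof (cases "t = T")
    case False
    then show ?thesis using mono[OF _ assms(1), of T] assms lt by (auto simp: j_half_half)
  qed simp
qed

section \<open>Endomorphisms of a complex torus\<close>

definition multipliers :: "complex set \<Rightarrow> complex set" where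
  "multipliers L = {a. \<forall>w\<in>L. a * w \<in> L}"

lemma multipliers_scale: "c \<noteq> 0 \<Longrightarrow> multipliers ((*) c ` L) = multipliers L"
  by (auto simp: multipliers_def image_iff)

context complex_lattice
begin

abbreviation E :: "complex set monoid" where "E \<equiv> complex_ring A_Mod L"

abbreviation pt :: "complex \<Rightarrow> complex set" where "pt \<equiv> torus_point E"

lemma pt_eq: "pt z = (\<lambda>w. w + z) ` L"
  by (auto simp: torus_point_def one_A_Mod a_r_coset_def' ring_of_type_algebra_def)

lemma carrier_E: "carrier E = range pt"
proof -
  have "carrier E = (\<Union>z\<in>carrier complex_ring. {L +>\<^bsub>complex_ring\<^esub> z})"
    unfolding A_RCOSETS_def'[symmetric] by (simp add: A_FactGroup_def FactGroup_def A_RCOSETS_def)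
  then show ?thesis by (auto simp: torus_point_def one_A_Mod ring_of_type_algebra_def)
qed

lemma one_E: "\<one>\<^bsub>E\<^esub> = pt 0"
  by (simp add: one_A_Mod pt_eq)

lemma pt_eq_iff: "pt z = pt w \<longleftrightarrow> z - w \<in> L"
proof
  assume "pt z = pt w"
  moreover have "z \<in> pt z" unfolding pt_eq by (rule image_eqI[of _ _ 0]) auto
  ultimately have "z \<in> pt w" by simp
  then show "z - w \<in> L" by (auto simp: pt_eq)
next
  have sub: "pt z \<subseteq> pt w" if "z - w \<in> L" for z w
  proof
    fix x assume "x \<in> pt z"
    then obtain l where l: "l \<in> L" "x = l + z" by (auto simp: pt_eq)
    then have "l + (z - w) \<in> L" using add_mem that by blast
    moreover have "x = (l + (z - w)) + w" using l by simp
    ultimately show "x \<in> pt w" unfolding pt_eq by blast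
  qed
  assume "z - w \<in> L"
  then show "pt z = pt w" using sub[of z w] sub[of w z] uminus_mem[of "z - w"] by auto
qed

lemma pt_add: "pt z \<otimes>\<^bsub>E\<^esub> pt w = pt (z + w)"
proof -
  have "pt z \<otimes>\<^bsub>E\<^esub> pt w = (\<Union>a\<in>pt z. \<Union>b\<in>pt w. {a + b})"
    by (simp add: A_FactGroup_def FactGroup_def set_mult_def ring_of_type_algebra_def)
  also have "\<dots> = pt (z + w)"
  proof
    show "(\<Union>a\<in>pt z. \<Union>b\<in>pt w. {a + b}) \<subseteq> pt (z + w)"
    proof clarsimp
      fix a b assume "a \<in> pt z" "b \<in> pt w"
      then obtain k l where "k \<in> L" "l \<in> L" "a = k + z" "b = l + w" by (auto simp: pt_eq)
      then show "a + b \<in> pt (z + w)" unfolding pt_eq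
        by (intro image_eqI[of _ _ "k + l"]) (auto intro: add_mem)
    qed
    show "pt (z + w) \<subseteq> (\<Union>a\<in>pt z. \<Union>b\<in>pt w. {a + b})"
    proof
      fix x assume "x \<in> pt (z + w)"
      then obtain l where l: "l \<in> L" "x = l + (z + w)" by (auto simp: pt_eq)
      have "l + z \<in> pt z" using l(1) by (auto simp: pt_eq)
      moreover have "w \<in> pt w" unfolding pt_eq by (rule image_eqI[of _ _ 0]) auto
      moreover have "x = (l + z) + w" using l(2) by simp
      ultimately show "x \<in> (\<Union>a\<in>pt z. \<Union>b\<in>pt w. {a + b})" by blast
    qed
  qed
  finally show ?thesis .
qed

text \<open>The simplifier unfolds the multiplication of \<open>E\<close> to the sum of cosets.\<close>
lemma pt_set_add [simp]: "pt z <+>\<^bsub>complex_ring\<^esub> pt w = pt (z + w)"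
  using pt_add[of z w] by simp

lemma group_E: "group E"
proof (rule groupI)
  show "\<exists>y\<in>carrier E. y \<otimes>\<^bsub>E\<^esub> x = \<one>\<^bsub>E\<^esub>" if x: "x \<in> carrier E" for x
  proof -
    obtain z where "x = pt z" using x by (auto simp: carrier_E)
    then show ?thesis by (intro bexI[of _ "pt (- z)"]) (simp_all add: carrier_E pt_add one_E)
  qed
qed (auto simp: carrier_E pt_add one_E add.assoc)

lemma pt_int_pow: "pt z [^]\<^bsub>E\<^esub> (n :: int) = pt (of_int n * z)"
proof -
  interpret group E by (rule group_E)
  have nat: "pt z [^]\<^bsub>E\<^esub> (k :: nat) = pt (of_nat k * z)" for k
    by (induction k) (simp_all add: one_E pt_add algebra_simps)
  have inv: "inv\<^bsub>E\<^esub> pt z = pt (- z)" for z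
    by (rule inv_equality) (simp_all add: carrier_E pt_add one_E)
  show ?thesis
    unfolding int_pow_def2 nat inv by auto
qed

lemma small_elements: obtains \<delta> where "\<delta> > 0" "\<And>w. w \<in> L \<Longrightarrow> norm w < \<delta> \<Longrightarrow> w = 0"
proof -
  have "finite (L \<inter> cball 0 1 - {0})" using finite_cball by auto
  from finite_set_avoid[OF this, of 0]
  obtain d where d: "d > 0" "\<forall>x\<in>L \<inter> cball 0 1 - {0}. x \<noteq> 0 \<longrightarrow> d \<le> dist 0 x" by auto
  show ?thesis
  proof (rule that[of "min d 1"])
    fix w assume "w \<in> L" "norm w < min d 1"
    then show "w = 0" using d(2) by fastforce
  qed (use d(1) in simp)
qed

text \<open>The choice of a representative is harmless when \<open>a\<close> maps \<open>L\<close>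
  into itself; restriction to the carrier matches the extensional functions in
  \<open>End\<close>.\<close>

definition mult_map :: "complex \<Rightarrow> complex set \<Rightarrow> complex set" where
  "mult_map a = (\<lambda>P\<in>carrier E. pt (a * (SOME z. pt z = P)))"

lemma mult_map_pt:
  assumes "a \<in> multipliers L"
  shows "mult_map a (pt z) = pt (a * z)"
proof -
  define y where "y = (SOME y. pt y = pt z)"
  have "pt y = pt z" unfolding y_def by (rule someI[of _ z]) simp
  then have "a * (y - z) \<in> L" using assms by (auto simp: multipliers_def pt_eq_iff)
  then have "pt (a * y) = pt (a * z)" by (simp add: pt_eq_iff right_diff_distrib)
  then show ?thesis by (simp add: mult_map_def carrier_E y_def)
qed

lemma carrier_End: "\<phi> \<in> carrier (End E) \<longleftrightarrow>
    \<phi> \<in> hom E E \<and> \<phi> \<in> extensional (carrier E) \<and> holomorphic_torus_map E \<phi>"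
  by (simp add: End_def)

lemma mult_map_in_End:
  assumes a: "a \<in> multipliers L"
  shows "mult_map a \<in> carrier (End E)"
  unfolding carrier_End
proof (intro conjI)
  show "mult_map a \<in> hom E E"
    by (rule homI) (auto simp: carrier_E mult_map_pt[OF a] pt_add distrib_left)
  show "mult_map a \<in> extensional (carrier E)" by (simp add: mult_map_def)
  show "holomorphic_torus_map E (mult_map a)"
    unfolding holomorphic_torus_map_def
    by (intro allI exI[of _ UNIV] exI[of _ "(*) a"]) (auto simp: mult_map_pt[OF a] intro!: holomorphic_intros)
qed

text \<open>Near w = 0 the functions \<open>g (w + z)\<close> and \<open>g w + g z\<close> coincide;
  differentiating at 0 shows that the derivative of \<open>g\<close> at \<open>z\<close> is the one
  at 0.\<close>

lemma additive_germ_linear: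
  assumes r: "r > 0" and g: "g holomorphic_on ball 0 r" and g0: "g 0 = 0"
    and add: "\<And>z w. z \<in> ball 0 r \<Longrightarrow> w \<in> ball 0 r \<Longrightarrow> z + w \<in> ball 0 r \<Longrightarrow> g (z + w) = g z + g w"
    and z: "z \<in> ball 0 r"
  shows "g z = deriv g 0 * z"
proof -
  have gd: "(g has_field_derivative deriv g z) (at z)" if "z \<in> ball 0 r" for z
    using g open_ball that by (rule holomorphic_derivI)
  have const: "deriv g z = deriv g 0" if z: "z \<in> ball 0 r" for z
  proof -
    have "((\<lambda>w. g (w + z)) has_field_derivative deriv g z) (at 0)"
      using gd[OF z] DERIV_shift[of g "deriv g z" 0 z] by simp
    moreover have "((\<lambda>w. g w + g z) has_field_derivative deriv g 0) (at 0)"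
      using gd[of 0] r by (auto intro!: derivative_eq_intros)
    moreover have "\<forall>\<^sub>F w in nhds 0. g (w + z) = g w + g z"
    proof -
      have "open ((\<lambda>w. w + z) -` ball 0 r \<inter> ball 0 r)"
        by (intro open_Int open_vimage open_ball continuous_intros)
      moreover have "0 \<in> (\<lambda>w. w + z) -` ball 0 r \<inter> ball 0 r" using z r by simp
      ultimately have "\<forall>\<^sub>F w in nhds 0. w \<in> (\<lambda>w. w + z) -` ball 0 r \<inter> ball 0 r"
        by (rule eventually_nhds_in_open)
      then show ?thesis by eventually_elim (use add z in auto)
    qed
    ultimately have "((\<lambda>w. g (w + z)) has_field_derivative deriv g 0) (at 0)"
      using DERIV_cong_ev[OF refl, of "\<lambda>w. g (w + z)" "\<lambda>w. g w + g z" 0] by blast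
    then show ?thesis using DERIV_unique \<open>((\<lambda>w. g (w + z)) has_field_derivative deriv g z) (at 0)\<close> by blast
  qed
  have d: "((\<lambda>z. g z - deriv g 0 * z) has_field_derivative 0) (at z)" if z: "z \<in> ball 0 r" for z
    using gd[OF z] const[OF z] by (auto intro!: derivative_eq_intros)
  have "continuous_on (ball 0 r) (\<lambda>z. g z - deriv g 0 * z)"
    by (intro continuous_intros holomorphic_on_imp_continuous_on g)
  then obtain c where "\<And>u. u \<in> ball 0 r \<Longrightarrow> g u - deriv g 0 * u = c"
    using DERIV_zero_connected_constant[OF connected_ball open_ball finite.emptyI] d by blast
  from this[of 0] this[OF z] show ?thesis using g0 r by simp
qed

text \<open>A local lift at 0, shifted by a lattice element to vanish at 0, is additive up to
  elements of \<open>L\<close>. On a small ball this defect is too short to be nonzero, so the lift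
  is linear there, and the homomorphism property extends the formula.\<close>

lemma End_imp_mult_map:
  assumes \<phi>: "\<phi> \<in> carrier (End E)"
  obtains a where "a \<in> multipliers L" "\<phi> = mult_map a"
proof -
  have hom: "\<phi> (pt z \<otimes>\<^bsub>E\<^esub> pt w) = \<phi> (pt z) \<otimes>\<^bsub>E\<^esub> \<phi> (pt w)" for z w
    using \<phi> unfolding carrier_End by (intro hom_mult[of \<phi> E E]) (auto simp: carrier_E)
  obtain U f where U: "open U" "0 \<in> U" "f holomorphic_on U"
    and lift: "\<And>w. w \<in> U \<Longrightarrow> \<phi> (pt w) = pt (f w)"
    using \<phi> unfolding carrier_End holomorphic_torus_map_def by metis
  have f0: "f 0 \<in> L"
    using hom[of 0 0] lift[OF U(2)] pt_eq_iff[of "f 0 + f 0" "f 0"] by (simp add: pt_add)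
  define g where "g = (\<lambda>w. f w - f 0)"
  have lift_g: "\<phi> (pt w) = pt (g w)" if "w \<in> U" for w
    using lift[OF that] pt_eq_iff[of "f w" "g w"] f0 by (simp add: g_def)
  have g: "g holomorphic_on U" unfolding g_def by (intro holomorphic_intros U)
  have g0: "g 0 = 0" by (simp add: g_def)
  obtain \<delta> where \<delta>: "\<delta> > 0" "\<And>w. w \<in> L \<Longrightarrow> norm w < \<delta> \<Longrightarrow> w = 0" using small_elements by blast
  have "isCont g 0" using g U holomorphic_on_imp_continuous_on continuous_on_eq_continuous_at by blast
  \<comment> \<open>A third of \<delta> for each of the three terms in g (z + w) - g z - g w keeps
    this lattice element shorter than any nonzero one.\<close>
  then obtain r1 where r1: "r1 > 0" "\<And>w. dist w 0 < r1 \<Longrightarrow> dist (g w) (g 0) < \<delta> / 3"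
    unfolding continuous_at_eps_delta using \<delta>(1) by (metis divide_pos_pos zero_less_numeral)
  obtain r2 where r2: "r2 > 0" "ball 0 r2 \<subseteq> U" using U(1,2) open_contains_ball by blast
  define r where "r = min r1 r2"
  have r: "r > 0" "ball 0 r \<subseteq> U" using r1 r2 by (auto simp: r_def)
  have small: "norm (g w) < \<delta> / 3" if "w \<in> ball 0 r" for w
    using r1(2)[of w] that g0 by (simp add: r_def)
  have add: "g (z + w) = g z + g w" if "z \<in> ball 0 r" "w \<in> ball 0 r" "z + w \<in> ball 0 r" for z w
  proof -
    have "pt (g (z + w)) = pt (g z + g w)"
      using hom[of z w] lift_g that r(2) by (metis pt_add subsetD)
    then have "g (z + w) - (g z + g w) \<in> L" by (simp add: pt_eq_iff)
    moreover have "norm (g (z + w) - (g z + g w)) \<le> norm (g (z + w)) + (norm (g z) + norm (g w))"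
      using norm_triangle_ineq4[of "g (z + w)" "g z + g w"] norm_triangle_ineq[of "g z" "g w"] by linarith
    ultimately have "g (z + w) - (g z + g w) = 0" using small that by (intro \<delta>(2)) (auto intro: order_le_less_trans, smt (verit))
    then show ?thesis by simp
  qed
  define a where "a = deriv g 0"
  have lin: "g z = a * z" if "z \<in> ball 0 r" for z
    unfolding a_def using additive_germ_linear[OF r(1) holomorphic_on_subset[OF g r(2)] g0 add that] .
  have mult: "\<phi> (pt (of_nat k * u)) = pt (a * (of_nat k * u))" if u: "u \<in> ball 0 r" for k u
  proof (induction k)
    case 0
    show ?case using lift_g[OF U(2)] g0 by simp
  next
    case (Suc k)
    have "\<phi> (pt (of_nat (Suc k) * u)) = \<phi> (pt u \<otimes>\<^bsub>E\<^esub> pt (of_nat k * u))"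
      by (simp add: pt_add algebra_simps)
    also have "\<dots> = pt (a * u) \<otimes>\<^bsub>E\<^esub> pt (a * (of_nat k * u))"
      unfolding hom Suc using lift_g[of u] lin[OF u] u r(2) by auto
    finally show ?case by (simp add: pt_add algebra_simps)
  qed
  \<comment> \<open>Every z is k u with u in the small ball, which carries the formula from the germ
    to the whole torus.\<close>
  have all: "\<phi> (pt z) = pt (a * z)" for z
  proof -
    obtain k :: nat where k: "norm z / r < real k" using reals_Archimedean2 by blast
    then have "real k > 0" using r(1) by (smt (verit) divide_nonneg_pos norm_ge_zero)
    define u where "u = z / of_nat k"
    have "norm u < r" using k r(1) \<open>real k > 0\<close> by (simp add: u_def norm_divide field_simps)
    moreover have "z = of_nat k * u" using \<open>real k > 0\<close> by (simp add: u_def)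
    ultimately show ?thesis using mult[of u k] by simp
  qed
  have "a \<in> multipliers L"
    unfolding multipliers_def
  proof clarify
    fix w assume "w \<in> L"
    then have "pt w = pt 0" by (simp add: pt_eq_iff)
    then show "a * w \<in> L" using all[of w] all[of 0] pt_eq_iff[of "a * w" 0] by simp
  qed
  moreover have "\<phi> = mult_map a"
  proof
    fix P
    show "\<phi> P = mult_map a P"
    proof (cases "P \<in> carrier E")
      case True
      then show ?thesis using all mult_map_pt[OF \<open>a \<in> multipliers L\<close>] by (auto simp: carrier_E)
    next
      case False
      then show ?thesis using \<phi> unfolding carrier_End by (simp add: mult_map_def extensional_def)
    qed
  qed
  ultimately show ?thesis by (rule that)
qed

lemma mult_map_inj:
  assumes "a \<in> multipliers L" "b \<in> multipliers L" "mult_map a = mult_map b"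
  shows "a = b"
proof (rule ccontr)
  assume ne: "a \<noteq> b"
  obtain \<delta> where \<delta>: "\<delta> > 0" "\<And>w. w \<in> L \<Longrightarrow> norm w < \<delta> \<Longrightarrow> w = 0" using small_elements by blast
  \<comment> \<open>Chosen so that (a - b) z = \<delta> / 2, which is nonzero yet too short for a
    nonzero lattice element.\<close>
  define z where "z = of_real (\<delta> / 2) / (a - b)"
  have "pt (a * z) = pt (b * z)"
    using assms mult_map_pt by metis
  then have "(a - b) * z \<in> L" by (simp add: pt_eq_iff left_diff_distrib)
  moreover have "(a - b) * z = complex_of_real (\<delta> / 2)" unfolding z_def using ne
    by (metis eq_iff_diff_eq_0 nonzero_mult_div_cancel_left times_divide_eq_right)
  ultimately have "complex_of_real (\<delta> / 2) \<in> L" by (simp only:)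
  then have "complex_of_real (\<delta> / 2) = 0" using \<delta> by (intro \<delta>(2)) (auto simp: norm_divide)
  then show False using \<delta>(1) by simp
qed

lemma subring_multipliers:
  shows "1 \<in> multipliers L" "a \<in> multipliers L \<Longrightarrow> b \<in> multipliers L \<Longrightarrow> a * b \<in> multipliers L"
    "a \<in> multipliers L \<Longrightarrow> b \<in> multipliers L \<Longrightarrow> a + b \<in> multipliers L"
    "a \<in> multipliers L \<Longrightarrow> - a \<in> multipliers L"
    "of_int n \<in> multipliers L"
proof -
  show "1 \<in> multipliers L" by (simp add: multipliers_def)
  show neg: "a \<in> multipliers L \<Longrightarrow> - a \<in> multipliers L" for a by (auto simp: multipliers_def uminus_mem)
  show "a \<in> multipliers L \<Longrightarrow> b \<in> multipliers L \<Longrightarrow> a * b \<in> multipliers L"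
    by (auto simp: multipliers_def mult.assoc)
  show add: "a \<in> multipliers L \<Longrightarrow> b \<in> multipliers L \<Longrightarrow> a + b \<in> multipliers L" for a b
    by (auto simp: multipliers_def distrib_right add_mem)
  have nat: "of_nat k \<in> multipliers L" for k
    by (induction k) (auto intro: add simp: multipliers_def distrib_right add_mem)
  show "of_int n \<in> multipliers L"
    by (cases n rule: int_cases2) (auto simp: nat intro: neg)
qed

lemma mult_map_ring_iso: "mult_map \<in> ring_iso (complex_ring\<lparr>carrier := multipliers L\<rparr>) (End E)"
proof (rule ring_iso_memI)
  let ?R = "complex_ring\<lparr>carrier := multipliers L\<rparr>"
  show "mult_map a \<in> carrier (End E)" if "a \<in> carrier ?R" for a
    using mult_map_in_End that by simp
  show "mult_map (a \<otimes>\<^bsub>?R\<^esub> b) = mult_map a \<otimes>\<^bsub>End E\<^esub> mult_map b" if "a \<in> carrier ?R" "b \<in> carrier ?R" for a b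
  proof -
    have ab: "a \<in> multipliers L" "b \<in> multipliers L" using that by auto
    have "mult_map (a * b) P = compose (carrier E) (mult_map a) (mult_map b) P" for P
    proof (cases "P \<in> carrier E")
      case True
      then show ?thesis using ab subring_multipliers(2)[OF ab]
        by (auto simp: compose_def carrier_E mult_map_pt mult.assoc)
    qed (simp add: mult_map_def compose_def)
    then show ?thesis by (auto simp: End_def ring_of_type_algebra_def)
  qed
  show "mult_map (a \<oplus>\<^bsub>?R\<^esub> b) = mult_map a \<oplus>\<^bsub>End E\<^esub> mult_map b" if "a \<in> carrier ?R" "b \<in> carrier ?R" for a b
  proof -
    have ab: "a \<in> multipliers L" "b \<in> multipliers L" using that by auto
    have "mult_map (a + b) P = (\<lambda>P\<in>carrier E. mult_map a P \<otimes>\<^bsub>E\<^esub> mult_map b P) P" for P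
    proof (cases "P \<in> carrier E")
      case True
      then show ?thesis using ab subring_multipliers(3)[OF ab]
        by (auto simp: carrier_E mult_map_pt pt_add distrib_right)
    qed (simp add: mult_map_def)
    then show ?thesis by (auto simp: End_def ring_of_type_algebra_def)
  qed
  have "mult_map 1 P = (\<lambda>P\<in>carrier E. P) P" for P
  proof (cases "P \<in> carrier E")
    case True
    then show ?thesis using subring_multipliers(1) by (auto simp: carrier_E mult_map_pt)
  qed (simp add: mult_map_def)
  then show "mult_map \<one>\<^bsub>?R\<^esub> = \<one>\<^bsub>End E\<^esub>" by (auto simp: End_def ring_of_type_algebra_def)
  show "bij_betw mult_map (carrier ?R) (carrier (End E))"
    unfolding bij_betw_def
  proof
    show "inj_on mult_map (carrier ?R)" using mult_map_inj by (auto intro: inj_onI)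
    show "mult_map ` carrier ?R = carrier (End E)"
      using mult_map_in_End End_imp_mult_map by (auto simp: image_iff) metis
  qed
qed

lemma has_CM_iff: "has_CM E \<longleftrightarrow> (\<exists>a\<in>multipliers L. a \<notin> \<int>)"
proof -
  have pow: "(\<lambda>P\<in>carrier E. P [^]\<^bsub>E\<^esub> n) = mult_map (of_int n)" for n :: int
  proof
    fix P
    show "(\<lambda>P\<in>carrier E. P [^]\<^bsub>E\<^esub> n) P = mult_map (of_int n) P"
    proof (cases "P \<in> carrier E")
      case True
      then show ?thesis using subring_multipliers(5)[of n] by (auto simp: carrier_E mult_map_pt pt_int_pow)
    qed (simp add: mult_map_def)
  qed
  show ?thesis
  proof
    assume "has_CM E"
    then obtain \<phi> where \<phi>: "\<phi> \<in> carrier (End E)" "\<And>n. \<phi> \<noteq> mult_map (of_int n)"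
      unfolding has_CM_def pow by blast
    obtain a where a: "a \<in> multipliers L" "\<phi> = mult_map a" using End_imp_mult_map[OF \<phi>(1)] by blast
    then have "a \<notin> \<int>" using \<phi>(2) by (auto elim: Ints_cases)
    then show "\<exists>a\<in>multipliers L. a \<notin> \<int>" using a by blast
  next
    assume "\<exists>a\<in>multipliers L. a \<notin> \<int>"
    then obtain a where a: "a \<in> multipliers L" "a \<notin> \<int>" by blast
    then have "mult_map a \<noteq> mult_map (of_int n)" for n
      using mult_map_inj[OF a(1) subring_multipliers(5)] by auto
    then show "has_CM E" unfolding has_CM_def pow using mult_map_in_End[OF a(1)] by blast
  qed
qed

end

section \<open>Orders and their discriminants\<close>

text \<open>An arbitrary additive \<open>h\<close> covers the embeddings of the rationals and of the
  integers at once; additivity reduces injectivity to a trivial kernel.\<close>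

lemma bij_betw_linear_vec2:
  fixes h :: "'a::comm_ring_1 \<Rightarrow> complex" and e :: "complex ^ 2"
  assumes h: "\<And>x y. h (x - y) = h x - h y" "h 0 = 0"
  shows "bij_betw (\<lambda>c :: 'a ^ 2. \<Sum>i\<in>UNIV. h (c $ i) * e $ i) UNIV K \<longleftrightarrow>
    K = {h x * e $ 1 + h y * e $ 2 | x y. True} \<and>
    (\<forall>x y. h x * e $ 1 + h y * e $ 2 = 0 \<longrightarrow> x = 0 \<and> y = 0)"
proof -
  let ?f = "\<lambda>c :: 'a ^ 2. h (c $ 1) * e $ 1 + h (c $ 2) * e $ 2"
  have f: "(\<lambda>c :: 'a ^ 2. \<Sum>i\<in>UNIV. h (c $ i) * e $ i) = ?f" by (simp add: sum_2)
  have range: "range ?f = {h x * e $ 1 + h y * e $ 2 | x y. True}"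
  proof -
    have "h x * e $ 1 + h y * e $ 2 \<in> range ?f" for x y
      by (rule image_eqI[of _ _ "vector [x, y]"]) (simp_all add: vector_2)
    then show ?thesis by auto
  qed
  have diff: "?f c - ?f d = ?f (c - d)" for c d by (simp add: h algebra_simps)
  have "inj ?f \<longleftrightarrow> (\<forall>x y. h x * e $ 1 + h y * e $ 2 = 0 \<longrightarrow> x = 0 \<and> y = 0)"
  proof
    assume inj: "inj ?f"
    show "\<forall>x y. h x * e $ 1 + h y * e $ 2 = 0 \<longrightarrow> x = 0 \<and> y = 0"
    proof (intro allI impI)
      fix x y assume "h x * e $ 1 + h y * e $ 2 = 0"
      then have "?f (vector [x, y]) = ?f 0" by (simp add: vector_2 h)
      then have "(vector [x, y] :: 'a ^ 2) = 0" by (rule injD[OF inj])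
      then show "x = 0 \<and> y = 0" by (metis vector_2 zero_index)
    qed
  next
    assume 0: "\<forall>x y. h x * e $ 1 + h y * e $ 2 = 0 \<longrightarrow> x = 0 \<and> y = 0"
    show "inj ?f"
    proof (rule injI)
      fix c d assume "?f c = ?f d"
      then have "?f (c - d) = 0" using diff[of c d] by simp
      then have "(c - d) $ 1 = 0 \<and> (c - d) $ 2 = 0" using 0 by blast
      then show "c = d" by (simp add: vec_eq_iff forall_2)
    qed
  qed
  then show ?thesis unfolding f bij_betw_def range by auto
qed

lemma rat_basis_iff: "rat_basis K e \<longleftrightarrow>
    K = {of_rat x * e $ 1 + of_rat y * e $ 2 | x y. True} \<and>
    (\<forall>x y :: rat. of_rat x * e $ 1 + of_rat y * e $ 2 = 0 \<longrightarrow> x = 0 \<and> y = 0)"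
  unfolding rat_basis_def by (rule bij_betw_linear_vec2) (simp_all add: of_rat_diff)

lemma int_basis_iff: "int_basis K e \<longleftrightarrow>
    K = {of_int x * e $ 1 + of_int y * e $ 2 | x y. True} \<and>
    (\<forall>x y :: int. of_int x * e $ 1 + of_int y * e $ 2 = 0 \<longrightarrow> x = 0 \<and> y = 0)"
  unfolding int_basis_def by (rule bij_betw_linear_vec2) simp_all

text \<open>The vector \<open>e\<close> is an eigenvector of the transpose of \<open>M\<close> for
  \<open>x\<close>, and it is nonzero, so \<open>x\<close> is a root of the characteristic
  polynomial.\<close>

lemma rep_matrix_char_poly:
  fixes M :: "rat ^ 2 ^ 2"
  assumes e: "rat_basis K e" and M: "\<And>j. x * e $ j = (\<Sum>i\<in>UNIV. of_rat (M $ i $ j) * e $ i)"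
  shows "x * x - of_rat (trace M) * x + of_rat (det M) = 0"
proof -
  define a b c d where "a = complex_of_rat (M $ 1 $ 1)" and "b = complex_of_rat (M $ 1 $ 2)"
    and "c = complex_of_rat (M $ 2 $ 1)" and "d = complex_of_rat (M $ 2 $ 2)"
  have 1: "(x - a) * e $ 1 = c * e $ 2" and 2: "(x - d) * e $ 2 = b * e $ 1"
    using M[of 1] M[of 2] by (simp_all add: sum_2 a_def b_def c_def d_def algebra_simps)
  have "((x - a) * (x - d) - b * c) * e $ 1 = (x - d) * ((x - a) * e $ 1) - c * (b * e $ 1)"
    by (simp add: algebra_simps)
  also have "\<dots> = 0" unfolding 1 2[symmetric] by (simp add: algebra_simps)
  finally have "((x - a) * (x - d) - b * c) * e $ 1 = 0" .
  moreover have "e $ 1 \<noteq> 0"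
  proof
    assume "e $ 1 = 0"
    then have "of_rat 1 * e $ 1 + of_rat 0 * e $ 2 = 0" by simp
    then show False using e unfolding rat_basis_iff by (metis zero_neq_one)
  qed
  ultimately have "(x - a) * (x - d) - b * c = 0" by simp
  then show ?thesis
    by (simp add: trace_def det_2 sum_2 of_rat_add of_rat_diff of_rat_mult a_def b_def c_def d_def algebra_simps)
qed

text \<open>The trace of a representation matrix is the trace of the characteristic polynomial, which is
  determined by \<open>x\<close> when \<open>x\<close> is irrational; a rational \<open>x\<close> is represented by a scalar matrix.\<close>
lemma trace_rep_matrix_unique:
  fixes M M' :: "rat ^ 2 ^ 2"
  assumes e: "rat_basis K e" and M: "\<And>j. x * e $ j = (\<Sum>i\<in>UNIV. of_rat (M $ i $ j) * e $ i)"
    and e': "rat_basis K' e'" and M': "\<And>j. x * e' $ j = (\<Sum>i\<in>UNIV. of_rat (M' $ i $ j) * e' $ i)"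
  shows "trace M = trace M'"
proof (cases "x \<in> \<rat>")
  case True
  have scalar: "trace M = 2 * q" if x: "x = of_rat q" and e: "rat_basis K e"
    and M: "\<And>j. x * e $ j = (\<Sum>i\<in>UNIV. of_rat (M $ i $ j) * e $ i)" for q K e and M :: "rat ^ 2 ^ 2"
  proof -
    have "of_rat (M $ 1 $ 1 - q) * e $ 1 + of_rat (M $ 2 $ 1) * e $ 2 = 0"
      using M[of 1] by (simp add: x sum_2 of_rat_diff algebra_simps)
    then have "M $ 1 $ 1 = q" using e unfolding rat_basis_iff by (metis eq_iff_diff_eq_0)
    moreover have "of_rat (M $ 1 $ 2) * e $ 1 + of_rat (M $ 2 $ 2 - q) * e $ 2 = 0"
      using M[of 2] by (simp add: x sum_2 of_rat_diff algebra_simps)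
    then have "M $ 2 $ 2 = q" using e unfolding rat_basis_iff by (metis eq_iff_diff_eq_0)
    ultimately show ?thesis by (simp add: trace_def sum_2)
  qed
  obtain q where q: "x = of_rat q" using True by (auto elim: Rats_cases)
  show ?thesis using scalar[OF q e M] scalar[OF q e' M'] by simp
next
  case False
  have "x * x - of_rat (trace M) * x + of_rat (det M) = 0" "x * x - of_rat (trace M') * x + of_rat (det M') = 0"
    using rep_matrix_char_poly[OF e M] rep_matrix_char_poly[OF e' M'] by auto
  then have "of_rat (trace M) * x = x * x + of_rat (det M)" "of_rat (trace M') * x = x * x + of_rat (det M')"
    by (simp_all add: algebra_simps)
  then have *: "of_rat (trace M - trace M') * x = of_rat (det M - det M')"
    by (simp add: of_rat_diff left_diff_distrib)
  show ?thesis
  proof (rule ccontr)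
    assume "trace M \<noteq> trace M'"
    then have "x = of_rat ((det M - det M') / (trace M - trace M'))"
      using * by (simp add: of_rat_divide field_simps)
    then show False using False by (metis Rats_of_rat)
  qed
qed

lemma field_trace_eqI:
  fixes M :: "rat ^ 2 ^ 2"
  assumes e: "rat_basis K e" and M: "\<And>j. x * e $ j = (\<Sum>i\<in>UNIV. of_rat (M $ i $ j) * e $ i)"
  shows "field_trace K x = trace M"
  unfolding field_trace_def
proof (rule the_equality)
  show "\<exists>e (M' :: rat ^ 2 ^ 2). rat_basis K e \<and>
        (\<forall>j. x * e $ j = (\<Sum>i\<in>UNIV. of_rat (M' $ i $ j) * e $ i)) \<and> trace M = trace M'"
    using assms by blast
  fix t assume "\<exists>e (M' :: rat ^ 2 ^ 2). rat_basis K e \<and>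
        (\<forall>j. x * e $ j = (\<Sum>i\<in>UNIV. of_rat (M' $ i $ j) * e $ i)) \<and> t = trace M'"
  then obtain e' and M' :: "rat ^ 2 ^ 2" where e': "rat_basis K e'"
    and M': "\<And>j. x * e' $ j = (\<Sum>i\<in>UNIV. of_rat (M' $ i $ j) * e' $ i)" and t: "t = trace M'" by blast
  show "t = trace M" unfolding t by (rule trace_rep_matrix_unique[OF e' M' e M])
qed

lemma field_trace_quadratic:
  assumes basis: "rat_basis K (vector [1, \<theta>])" and \<theta>: "\<theta> * \<theta> = of_rat s * \<theta> - of_rat p"
  shows "field_trace K (of_rat a + of_rat b * \<theta>) = 2 * a + b * s"
proof -
  define M :: "rat ^ 2 ^ 2" where "M = vector [vector [a, - b * p], vector [b, a + b * s]]"
  have "(of_rat a + of_rat b * \<theta>) * (vector [1, \<theta>] :: complex ^ 2) $ j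
      = (\<Sum>i\<in>UNIV. of_rat (M $ i $ j) * (vector [1, \<theta>] :: complex ^ 2) $ i)" for j
  proof -
    have "j = 1 \<or> j = 2" using exhaust_2 by blast
    moreover have "(of_rat a + of_rat b * \<theta>) * \<theta> = of_rat (- b * p) + of_rat (a + b * s) * \<theta>"
      using \<theta> by (simp add: distrib_right mult.assoc of_rat_add of_rat_mult of_rat_minus) (simp add: algebra_simps)
    ultimately show ?thesis by (auto simp: sum_2 M_def vector_2)
  qed
  from field_trace_eqI[OF basis this] show ?thesis by (simp add: trace_def sum_2 M_def vector_2)
qed

text \<open>For the basis 1, \<theta> the traces 2, s and s^2 - 2 p give the Gram determinant 2 (s^2
  - 2 p) - s^2. Another basis multiplies it by the square of a unimodular determinant, so the
  definite description has a unique value.\<close>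

lemma order_discriminant_eq:
  fixes s p :: int
  assumes rb: "rat_basis K (vector [1, \<theta>])" and ib: "int_basis A (vector [1, \<theta>])"
    and \<theta>: "\<theta> * \<theta> = of_int s * \<theta> - of_int p"
  shows "order_discriminant K A = of_int (s^2 - 4 * p)"
proof -
  have tr: "field_trace K (of_int a + of_int b * \<theta>) = of_int (2 * a + b * s)" for a b
    using field_trace_quadratic[OF rb, of "of_int s" "of_int p" "of_int a" "of_int b"] \<theta> by simp
  have prod: "(of_int a + of_int b * \<theta>) * (of_int c + of_int d * \<theta>) =
      of_int (a * c - b * d * p) + of_int (a * d + b * c + b * d * s) * \<theta>" for a b c d :: int
  proof -
    have "(of_int a + of_int b * \<theta>) * (of_int c + of_int d * \<theta>) =
      of_int (a * c) + of_int (a * d + b * c) * \<theta> + of_int (b * d) * (\<theta> * \<theta>)" by (simp add: algebra_simps)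
    also have "\<dots> = of_int (a * c - b * d * p) + of_int (a * d + b * c + b * d * s) * \<theta>"
      unfolding \<theta> by (simp add: algebra_simps)
    finally show ?thesis .
  qed
  have A: "A = {of_int x + of_int y * \<theta> | x y. True}"
    and ind: "\<And>x y :: int. of_int x + of_int y * \<theta> = 0 \<Longrightarrow> x = 0 \<and> y = 0"
    using ib unfolding int_basis_iff by (auto simp: vector_2)
  have det_eq: "det ((\<chi> i j. field_trace K (e $ i * e $ j)) :: rat ^ 2 ^ 2) = of_int (s^2 - 4 * p)"
    if e: "int_basis A e" for e
  proof -
    have mem: "\<exists>x y. e $ i = of_int x + of_int y * \<theta>" for i
    proof -
      have "e $ 1 = of_int 1 * e $ 1 + of_int 0 * e $ 2" "e $ 2 = of_int 0 * e $ 1 + of_int 1 * e $ 2" by simp_all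
      moreover have "i = 1 \<or> i = 2" using exhaust_2 by blast
      ultimately have "e $ i \<in> A" using e unfolding int_basis_iff by blast
      then show ?thesis unfolding A by blast
    qed
    obtain a b where e1: "e $ 1 = of_int a + of_int b * \<theta>" using mem by blast
    obtain c d where e2: "e $ 2 = of_int c + of_int d * \<theta>" using mem by blast
    have "of_int 1 + of_int 0 * \<theta> \<in> A" "of_int 0 + of_int 1 * \<theta> \<in> A" unfolding A by blast+
    then obtain x y z w :: int where x: "1 = of_int x * e $ 1 + of_int y * e $ 2"
      and z: "\<theta> = of_int z * e $ 1 + of_int w * e $ 2"
      using e unfolding int_basis_iff by auto
    have "of_int (x * a + y * c - 1) + of_int (x * b + y * d) * \<theta> = 0"
      using x unfolding e1 e2 by (simp add: algebra_simps)
    from ind[OF this] have 1: "x * a + y * c = 1" "x * b + y * d = 0" by auto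
    have "of_int (z * a + w * c) + of_int (z * b + w * d - 1) * \<theta> = 0"
      using z unfolding e1 e2 by (simp add: algebra_simps)
    from ind[OF this] have 2: "z * a + w * c = 0" "z * b + w * d = 1" by auto
    have "(x * w - y * z) * (a * d - b * c) = (x * a + y * c) * (z * b + w * d) - (x * b + y * d) * (z * a + w * c)"
      by (simp add: algebra_simps)
    also have "\<dots> = 1" using 1 2 by simp
    finally have "a * d - b * c = 1 \<or> a * d - b * c = - 1" by (auto simp: zmult_eq_1_iff)
    then have sq: "(a * d - b * c)^2 = 1" by auto
    have "det ((\<chi> i j. field_trace K (e $ i * e $ j)) :: rat ^ 2 ^ 2) = of_int ((a * d - b * c)^2 * (s^2 - 4 * p))"
      by (simp add: det_2 e1 e2 prod tr del: of_int_add of_int_mult of_int_diff)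
         (simp add: power2_eq_square algebra_simps)
    then show ?thesis unfolding sq by simp
  qed
  show ?thesis unfolding order_discriminant_def
    by (rule the_equality) (use ib det_eq in \<open>auto intro!: exI[of _ "vector [1, \<theta>]"]\<close>)
qed

lemma subring_complexD:
  assumes "subring A complex_ring"
  shows "1 \<in> A" "x \<in> A \<Longrightarrow> y \<in> A \<Longrightarrow> x * y \<in> A" "x \<in> A \<Longrightarrow> y \<in> A \<Longrightarrow> x + y \<in> A"
  using subringE(3,6,7)[OF assms] by (auto simp: ring_of_type_algebra_def)

text \<open>The element 1 can be completed to an integral basis because it is primitive in
  \<open>A\<close>; the completion comes from a Bezout relation between its coordinates.\<close>

lemma order_generator:
  assumes A: "order_in K A"
  obtains \<theta> and s p :: int where "rat_basis K (vector [1, \<theta>])" "int_basis A (vector [1, \<theta>])"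
    "\<theta> * \<theta> = of_int s * \<theta> - of_int p"
proof -
  obtain e where sub: "subring A complex_ring" and ib: "int_basis A e" and rb: "rat_basis K e"
    using A unfolding order_in_def by blast
  have A_eq: "A = {of_int x * e $ 1 + of_int y * e $ 2 | x y. True}"
    and ind: "\<And>x y :: int. of_int x * e $ 1 + of_int y * e $ 2 = 0 \<Longrightarrow> x = 0 \<and> y = 0"
    using ib unfolding int_basis_iff by auto
  have A_mem: "x \<in> A" if "x = of_int m * e $ 1 + of_int n * e $ 2" for x and m n :: int
    using that unfolding A_eq by blast
  obtain a b :: int where ab: "1 = of_int a * e $ 1 + of_int b * e $ 2"
    using subring_complexD(1)[OF sub] unfolding A_eq by blast
  \<comment> \<open>The element \<open>u = 1 / g\<close> of \<open>A\<close> has its square in \<open>A\<close>, which forces \<open>g = 1\<close>.\<close>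
  define g where "g = gcd a b"
  obtain a' b' where a': "a = g * a'" "b = g * b'" by (metis g_def gcd_dvd1 gcd_dvd2 dvdE)
  define u where "u = of_int a' * e $ 1 + of_int b' * e $ 2"
  have gu: "of_int g * u = 1" using ab by (simp add: u_def a' algebra_simps)
  have "u \<in> A" by (rule A_mem[OF u_def])
  then have "u * u \<in> A" using subring_complexD(2)[OF sub] by blast
  then obtain c d :: int where cd: "u * u = of_int c * e $ 1 + of_int d * e $ 2" unfolding A_eq by blast
  have "of_int g * (u * u) = u" using gu by (simp flip: mult.assoc)
  then have "of_int (g * c - a') * e $ 1 + of_int (g * d - b') * e $ 2 = 0"
    unfolding cd by (simp add: u_def algebra_simps)
  from ind[OF this] have "a' = g * c" "b' = g * d" by auto
  then have gg: "g * g dvd a" "g * g dvd b" using a' by auto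
  have "g \<noteq> 0" using gu by auto
  moreover have "g * g dvd g" using gg unfolding g_def by (rule gcd_greatest)
  ultimately have "g dvd 1" using dvd_times_left_cancel_iff[of g g 1] by simp
  moreover have "g \<ge> 0" by (simp add: g_def)
  ultimately have "g = 1" by simp
  then have "coprime a b" by (simp add: g_def coprime_iff_gcd_eq_1)
  then obtain x y where "a * x + b * y = 1" using bezout_int[of a b] by (auto simp: mult.commute)
  \<comment> \<open>The coordinate rows (a, b) of 1 and (- y, x) of \<theta> have determinant a x +
    b y = 1.\<close>
  define \<theta> where "\<theta> = of_int (- y) * e $ 1 + of_int x * e $ 2"
  have bez: "a * x + b * y = 1" by fact
  have bez': "complex_of_int a * of_int x + of_int b * of_int y = 1" using bez by (metis of_int_1 of_int_add of_int_mult)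
  have e1: "e $ 1 = of_int x * 1 - of_int b * \<theta>"
  proof -
    have "of_int x * 1 - of_int b * \<theta> = (complex_of_int a * of_int x + of_int b * of_int y) * e $ 1"
      unfolding ab \<theta>_def by (simp add: algebra_simps)
    then show ?thesis unfolding bez' by simp
  qed
  have e2: "e $ 2 = of_int y * 1 + of_int a * \<theta>"
  proof -
    have "of_int y * 1 + of_int a * \<theta> = (complex_of_int a * of_int x + of_int b * of_int y) * e $ 2"
      unfolding ab \<theta>_def by (simp add: algebra_simps)
    then show ?thesis unfolding bez' by simp
  qed
  have trans1: "of_int m * e $ 1 + of_int n * e $ 2 = of_int (m * x + n * y) * 1 + of_int (n * a - m * b) * \<theta>" for m n
    unfolding e1 e2 by (simp add: algebra_simps)
  have trans2: "of_int m * 1 + of_int n * \<theta> = of_int (m * a - n * y) * e $ 1 + of_int (m * b + n * x) * e $ 2" for m n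
    unfolding ab \<theta>_def by (simp add: algebra_simps)
  have ib': "int_basis A (vector [1, \<theta>])"
    unfolding int_basis_iff vector_2
  proof (intro conjI allI impI)
    show "A = {of_int x * 1 + of_int y * \<theta> | x y. True}"
      unfolding A_eq using trans1 trans2 by blast
    fix m n :: int assume "of_int m * 1 + of_int n * \<theta> = 0"
    then have *: "m * a - n * y = 0 \<and> m * b + n * x = 0" using ind trans2 by metis
    have "m = (m * a - n * y) * x + (m * b + n * x) * y"
      using arg_cong[OF bez, of "\<lambda>t. m * t"] by (simp add: algebra_simps)
    then show "m = 0" using * by simp
    have "n = (m * b + n * x) * a - (m * a - n * y) * b"
      using arg_cong[OF bez, of "\<lambda>t. n * t"] by (simp add: algebra_simps)
    then show "n = 0" using * by simp
  qed
  have transq1: "of_rat m * e $ 1 + of_rat n * e $ 2 =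
      of_rat (m * of_int x + n * of_int y) * 1 + of_rat (n * of_int a - m * of_int b) * \<theta>" for m n
    unfolding e1 e2 by (simp add: of_rat_add of_rat_diff of_rat_mult algebra_simps)
  have transq2: "of_rat m * 1 + of_rat n * \<theta> =
      of_rat (m * of_int a - n * of_int y) * e $ 1 + of_rat (m * of_int b + n * of_int x) * e $ 2" for m n
    unfolding ab \<theta>_def by (simp add: of_rat_add of_rat_diff of_rat_mult algebra_simps)
  have rb': "rat_basis K (vector [1, \<theta>])"
    unfolding rat_basis_iff vector_2
  proof (intro conjI allI impI)
    have "K = {of_rat x * e $ 1 + of_rat y * e $ 2 | x y. True}" using rb unfolding rat_basis_iff by blast
    then show "K = {of_rat x * 1 + of_rat y * \<theta> | x y. True}"
      using transq1 transq2 by blast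
    fix m n :: rat assume "of_rat m * 1 + of_rat n * \<theta> = 0"
    then have *: "m * of_int a - n * of_int y = 0 \<and> m * of_int b + n * of_int x = 0"
      using rb transq2 unfolding rat_basis_iff by metis
    have bez'': "rat_of_int a * of_int x + of_int b * of_int y = 1" using bez by (metis of_int_1 of_int_add of_int_mult)
    have "m = (m * of_int a - n * of_int y) * of_int x + (m * of_int b + n * of_int x) * of_int y"
      using arg_cong[OF bez'', of "\<lambda>t. m * t"] by (simp add: algebra_simps)
    then show "m = 0" using * by simp
    have "n = (m * of_int b + n * of_int x) * of_int a - (m * of_int a - n * of_int y) * of_int b"
      using arg_cong[OF bez'', of "\<lambda>t. n * t"] by (simp add: algebra_simps)
    then show "n = 0" using * by simp
  qed
  have "\<theta> \<in> A" by (rule A_mem[OF \<theta>_def])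
  then have "\<theta> * \<theta> \<in> A" using subring_complexD(2)[OF sub] by blast
  then obtain p' s :: int where "\<theta> * \<theta> = of_int p' * 1 + of_int s * \<theta>"
    using ib' unfolding int_basis_iff vector_2 by blast
  then have "\<theta> * \<theta> = of_int s * \<theta> - of_int (- p')" by simp
  then show ?thesis using that rb' ib' by blast
qed

section \<open>The order of discriminant D inside the complex numbers\<close>

definition quad_gen :: "int \<Rightarrow> complex" where
  "quad_gen D = Complex (1/2) (sqrt \<bar>real_of_int D\<bar> / 2)"

definition quad_order :: "int \<Rightarrow> complex set" where
  "quad_order D = {of_int m + of_int n * quad_gen D | m n. True}"

lemma quad_gen_square:
  assumes "D < 0" "[D = 1] (mod 4)"
  shows "quad_gen D * quad_gen D = of_int 1 * quad_gen D - of_int ((1 - D) div 4)"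
proof -
  have "4 dvd 1 - D" using assms(2) by (metis cong_iff_dvd_diff cong_sym)
  then have "4 * ((1 - D) div 4) = 1 - D" by (rule dvd_mult_div_cancel)
  then have "4 * real_of_int ((1 - D) div 4) = 1 - D" by (metis of_int_mult of_int_numeral)
  moreover have "sqrt \<bar>real_of_int D\<bar> * sqrt \<bar>real_of_int D\<bar> = - D" using assms(1) by simp
  ultimately show ?thesis by (simp add: quad_gen_def complex_eq_iff field_simps)
qed

lemma Im_quad_gen: "D < 0 \<Longrightarrow> Im (quad_gen D) > 0"
  by (simp add: quad_gen_def)

lemma quad_order_memI: "x = of_int m + of_int n * quad_gen D \<Longrightarrow> x \<in> quad_order D"
  unfolding quad_order_def by blast

lemma a_inv_complex: "\<ominus>\<^bsub>complex_ring\<^esub> x = - x"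
proof -
  interpret ring "complex_ring" by (rule ring_from_type_algebra)
  show ?thesis by (rule minus_equality) (simp_all add: ring_of_type_algebra_def)
qed

lemma subring_quad_order:
  assumes D: "D < 0" "[D = 1] (mod 4)"
  shows "subring (quad_order D) complex_ring"
proof -
  interpret ring "complex_ring" by (rule ring_from_type_algebra)
  show ?thesis
  proof (rule subringI)
    show "\<one>\<^bsub>complex_ring\<^esub> \<in> quad_order D"
      by (rule quad_order_memI[of _ 1 0]) (simp add: ring_of_type_algebra_def)
    fix x assume "x \<in> quad_order D"
    then obtain m n :: int where x: "x = of_int m + of_int n * quad_gen D" unfolding quad_order_def by blast
    show "\<ominus>\<^bsub>complex_ring\<^esub> x \<in> quad_order D"
      unfolding a_inv_complex by (rule quad_order_memI[of _ "- m" "- n"]) (simp add: x)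
    fix y assume "y \<in> quad_order D"
    then obtain k l :: int where y: "y = of_int k + of_int l * quad_gen D" unfolding quad_order_def by blast
    show "x \<oplus>\<^bsub>complex_ring\<^esub> y \<in> quad_order D"
      by (rule quad_order_memI[of _ "m + k" "n + l"]) (simp add: x y ring_of_type_algebra_def algebra_simps)
    define p where "p = (1 - D) div 4"
    have "x * y = of_int (m * k) + of_int (m * l + n * k) * quad_gen D + of_int (n * l) * (quad_gen D * quad_gen D)"
      by (simp add: x y algebra_simps)
    also have "\<dots> = of_int (m * k - n * l * p) + of_int (m * l + n * k + n * l) * quad_gen D"
      unfolding quad_gen_square[OF D] p_def[symmetric] by (simp add: algebra_simps)
    finally have "x * y \<in> quad_order D" by (rule quad_order_memI)
    then show "x \<otimes>\<^bsub>complex_ring\<^esub> y \<in> quad_order D" by (simp add: ring_of_type_algebra_def)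
  qed (simp add: ring_of_type_algebra_def)
qed

lemma real_mult_gen_zero:
  assumes "D < 0" "of_real x + of_real y * quad_gen D = 0"
  shows "x = 0 \<and> y = 0"
  using assms Im_quad_gen[of D] by (auto simp: complex_eq_iff)

lemma complex_of_rat_eq: "(of_rat q :: complex) = of_real (of_rat q)"
proof (cases q)
  case (Fract a b)
  then show ?thesis by (simp add: of_rat_rat)
qed

definition quad_field :: "int \<Rightarrow> complex set" where
  "quad_field D = {of_rat x + of_rat y * quad_gen D | x y. True}"

lemma rat_basis_quad_field:
  assumes D: "D < 0"
  shows "rat_basis (quad_field D) (vector [1, quad_gen D])"
  unfolding rat_basis_iff vector_2 quad_field_def
proof (intro conjI allI impI)
  fix x y :: rat assume *: "of_rat x * 1 + of_rat y * quad_gen D = 0"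
  have "of_real (of_rat x) + of_real (of_rat y) * quad_gen D = 0" using * unfolding complex_of_rat_eq by simp
  from real_mult_gen_zero[OF D this] show "x = 0" "y = 0" by auto
qed simp

lemma int_basis_quad_order:
  assumes D: "D < 0"
  shows "int_basis (quad_order D) (vector [1, quad_gen D])"
  unfolding int_basis_iff vector_2 quad_order_def
proof (intro conjI allI impI)
  fix x y :: int assume *: "of_int x * 1 + of_int y * quad_gen D = 0"
  have "of_real (of_int x) + of_real (of_int y) * quad_gen D = 0" using * by simp
  from real_mult_gen_zero[OF D this] show "x = 0" "y = 0" by auto
qed simp

lemma quadratic_field_quad_field:
  assumes D: "D < 0" "[D = 1] (mod 4)"
  shows "quadratic_field (quad_field D)"
proof -
  interpret field "complex_ring" by (rule field_from_type_algebra)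
  have memI: "z \<in> quad_field D" if "z = of_rat x + of_rat y * quad_gen D" for z x y
    using that unfolding quad_field_def by blast
  define p where "p = (1 - D) div 4"
  have mult: "(of_rat m + of_rat n * quad_gen D) * (of_rat k + of_rat l * quad_gen D) =
      of_rat (m * k - n * l * of_int p) + of_rat (m * l + n * k + n * l) * quad_gen D" for m n k l
  proof -
    have "(of_rat m + of_rat n * quad_gen D) * (of_rat k + of_rat l * quad_gen D) =
      of_rat (m * k) + of_rat (m * l + n * k) * quad_gen D + of_rat (n * l) * (quad_gen D * quad_gen D)"
      by (simp add: of_rat_mult of_rat_add algebra_simps)
    also have "\<dots> = of_rat (m * k - n * l * of_int p) + of_rat (m * l + n * k + n * l) * quad_gen D"
      unfolding quad_gen_square[OF D] p_def[symmetric]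
      by (simp add: of_rat_mult of_rat_add of_rat_diff algebra_simps)
    finally show ?thesis .
  qed
  have sub: "subring (quad_field D) complex_ring"
  proof (rule subringI)
    show "\<one>\<^bsub>complex_ring\<^esub> \<in> quad_field D"
      by (rule memI[of _ 1 0]) (simp add: ring_of_type_algebra_def)
    fix x assume "x \<in> quad_field D"
    then obtain m n where x: "x = of_rat m + of_rat n * quad_gen D" unfolding quad_field_def by blast
    show "\<ominus>\<^bsub>complex_ring\<^esub> x \<in> quad_field D"
      unfolding a_inv_complex by (rule memI[of _ "- m" "- n"]) (simp add: x of_rat_minus)
    fix y assume "y \<in> quad_field D"
    then obtain k l where y: "y = of_rat k + of_rat l * quad_gen D" unfolding quad_field_def by blast
    show "x \<oplus>\<^bsub>complex_ring\<^esub> y \<in> quad_field D"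
      by (rule memI[of _ "m + k" "n + l"]) (simp add: x y ring_of_type_algebra_def of_rat_add algebra_simps)
    show "x \<otimes>\<^bsub>complex_ring\<^esub> y \<in> quad_field D"
      by (rule memI[OF trans[OF _ mult[of m n k l]]]) (simp add: x y ring_of_type_algebra_def)
  qed (simp add: ring_of_type_algebra_def)
  have "subfield (quad_field D) complex_ring"
  proof (rule subfieldI'[OF sub])
    fix z assume "z \<in> quad_field D - {\<zero>\<^bsub>complex_ring\<^esub>}"
    then obtain x y where z: "z = of_rat x + of_rat y * quad_gen D" and z0: "z \<noteq> 0"
      unfolding quad_field_def by (auto simp: ring_of_type_algebra_def)
    \<comment> \<open>\<open>N\<close> is the norm of \<open>z\<close>: conjugation sends
      \<open>quad_gen D\<close> to 1 - \<open>quad_gen D\<close>, so the conjugate of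
      \<open>z\<close> has coordinates x + y and - y.\<close>
    define N where "N = x * (x + y) + y * y * of_int p"
    have prod: "z * (of_rat (x + y) + of_rat (- y) * quad_gen D) = of_rat N"
      unfolding z mult by (simp add: N_def algebra_simps)
    have cnj: "cnj (quad_gen D) = 1 - quad_gen D" by (simp add: quad_gen_def complex_eq_iff)
    have r: "cnj (of_rat q) = of_rat q" for q unfolding complex_of_rat_eq by simp
    have "cnj z = of_rat (x + y) + of_rat (- y) * quad_gen D"
      unfolding z by (simp add: cnj r of_rat_add of_rat_minus algebra_simps)
    then have "of_rat N = z * cnj z" using prod by simp
    then have N0: "N \<noteq> 0" using z0 by auto
    have "z * (of_rat ((x + y) / N) + of_rat (- y / N) * quad_gen D) = 
        z * (of_rat (x + y) + of_rat (- y) * quad_gen D) / of_rat N"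
      unfolding of_rat_divide by (simp only: add_divide_distrib distrib_left times_divide_eq_right times_divide_eq_left)
    also have "\<dots> = 1" unfolding prod using N0 by simp
    finally have one: "z * (of_rat ((x + y) / N) + of_rat (- y / N) * quad_gen D) = 1" .
    have "inv\<^bsub>complex_ring\<^esub> z = of_rat ((x + y) / N) + of_rat (- y / N) * quad_gen D"
      using one by (intro comm_inv_char) (auto simp: ring_of_type_algebra_def)
    then show "inv\<^bsub>complex_ring\<^esub> z \<in> quad_field D" by (rule memI)
  qed
  then show ?thesis unfolding quadratic_field_def using rat_basis_quad_field[OF D(1)] by blast
qed

lemma order_in_quad_order:
  assumes D: "D < 0" "[D = 1] (mod 4)"
  shows "order_in (quad_field D) (quad_order D)" "order_discriminant (quad_field D) (quad_order D) = of_int D"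
proof -
  show "order_in (quad_field D) (quad_order D)"
    unfolding order_in_def using subring_quad_order[OF D] int_basis_quad_order[OF D(1)] rat_basis_quad_field[OF D(1)] by blast
  have "4 dvd 1 - D" using D(2) by (metis cong_iff_dvd_diff cong_sym)
  then have "1^2 - 4 * ((1 - D) div 4) = D" by simp
  then show "order_discriminant (quad_field D) (quad_order D) = of_int D"
    using order_discriminant_eq[OF rat_basis_quad_field[OF D(1)] int_basis_quad_order[OF D(1)] quad_gen_square[OF D]] by metis
qed

text \<open>The isomorphism type already fixes the subset of the complex numbers: the preimage t of
  a generator \<theta> satisfies (2 t - s)^2 = D, so 2 t - s agrees up to sign with 2
  \<open>quad_gen D\<close> - 1, and both square roots of D lead to the same ring.\<close>

lemma iso_order_imp_quad_order:
  assumes D: "D < 0" "[D = 1] (mod 4)"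
    and ord: "order_in K A" "order_discriminant K A = of_int D"
    and g: "g \<in> ring_iso (complex_ring\<lparr>carrier := B\<rparr>) (complex_ring\<lparr>carrier := A\<rparr>)"
    and B: "\<And>n :: int. of_int n \<in> B" "\<And>x y. x \<in> B \<Longrightarrow> y \<in> B \<Longrightarrow> x + y \<in> B"
      "\<And>x y. x \<in> B \<Longrightarrow> y \<in> B \<Longrightarrow> x * y \<in> B"
  shows "B = quad_order D"
proof -
  obtain \<theta> and s p :: int where rb: "rat_basis K (vector [1, \<theta>])" and ib: "int_basis A (vector [1, \<theta>])"
    and \<theta>: "\<theta> * \<theta> = of_int s * \<theta> - of_int p" using order_generator[OF ord(1)] by blast
  have "of_int (s^2 - 4 * p) = (of_int D :: rat)"
    using order_discriminant_eq[OF rb ib \<theta>] ord(2) by metis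
  then have disc: "s^2 - 4 * p = D" by (simp only: of_int_eq_iff)
  have A: "A = {of_int x + of_int y * \<theta> | x y. True}" using ib unfolding int_basis_iff by (auto simp: vector_2)
  have gm: "g (x * y) = g x * g y" and ga: "g (x + y) = g x + g y" if "x \<in> B" "y \<in> B" for x y
    using ring_iso_memE(2,3)[OF g, of x y] that by (simp_all add: ring_of_type_algebra_def)
  have g1: "g 1 = 1" using ring_iso_memE(4)[OF g] by (simp add: ring_of_type_algebra_def)
  have bij: "bij_betw g B A" using ring_iso_memE(5)[OF g] by simp
  have g0: "g 0 = 0" using ga[of 0 0] B(1)[of 0] by simp
  have gn: "g (of_nat n) = of_nat n" for n
  proof (induction n)
    case (Suc n)
    have "of_nat n \<in> B" "1 \<in> B" using B(1)[of "int n"] B(1)[of 1] by simp_all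
    then show ?case using ga[of 1 "of_nat n"] Suc g1 by simp
  qed (simp add: g0)
  have gi: "g (of_int n) = of_int n" for n
  proof (cases n rule: int_cases2)
    case (nonneg k)
    then show ?thesis using gn by simp
  next
    case (nonpos k)
    have "g (of_int (int k) + of_int (- int k)) = g (of_int (int k)) + g (of_int (- int k))"
      by (rule ga) (rule B(1))+
    then have "of_nat k + g (of_int (- int k)) = 0" using g0 gn[of k] by simp
    moreover have "n = - int k" using nonpos by simp
    ultimately show ?thesis by (simp add: add_eq_0_iff)
  qed
  have "of_int 0 + of_int 1 * \<theta> \<in> A" unfolding A by blast
  then obtain t where t: "t \<in> B" "g t = \<theta>" using bij unfolding bij_betw_def by auto
  have memB: "of_int m + of_int n * t \<in> B" for m n using B t by blast
  have gt: "g (of_int m + of_int n * t) = of_int m + of_int n * \<theta>" for m n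
    using ga[OF B(1)[of m] B(3)[OF B(1)[of n] t(1)]] gm[OF B(1)[of n] t(1)] gi t(2) by simp
  have inj: "x = y" if "x \<in> B" "y \<in> B" "g x = g y" for x y
    using bij that unfolding bij_betw_def by (meson inj_onD)
  have Bt: "B = {of_int m + of_int n * t | m n. True}"
  proof
    show "B \<subseteq> {of_int m + of_int n * t | m n. True}"
    proof
      fix x assume x: "x \<in> B"
      then have "g x \<in> A" using bij unfolding bij_betw_def by blast
      then obtain m n where "g x = of_int m + of_int n * \<theta>" unfolding A by blast
      then have "x = of_int m + of_int n * t" using inj[OF x memB] gt by simp
      then show "x \<in> {of_int m + of_int n * t | m n. True}" by blast
    qed
  qed (use memB in blast)
  have "g (t * t) = g (of_int (- p) + of_int s * t)"
    unfolding gm[OF t(1) t(1)] gt t(2) \<theta> by simp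
  then have tt: "t * t = of_int (- p) + of_int s * t" using inj[OF B(3)[OF t(1) t(1)] memB] by blast
  have "(2 * t - of_int s)^2 = 4 * (t * t) - 4 * (of_int s * t) + of_int s * of_int s"
    by (simp add: power2_eq_square algebra_simps)
  also have "\<dots> = of_int (s^2 - 4 * p)" unfolding tt by (simp add: power2_eq_square algebra_simps)
  also have "\<dots> = of_int D" unfolding disc ..
  also have "of_int D = (2 * quad_gen D - 1)^2"
    using quad_gen_square[OF D] D(1) by (simp add: quad_gen_def complex_eq_iff power2_eq_square)
  finally have "2 * t - of_int s = 2 * quad_gen D - 1 \<or> 2 * t - of_int s = - (2 * quad_gen D - 1)"
    by (simp only: power2_eq_iff)
  \<comment> \<open>The parity of \<open>s\<close>, forced by s^2 - 4 p = D, makes t differ from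
    \<open>quad_gen D\<close> or its negative by an integer.\<close>
  moreover have "odd s"
  proof
    assume "even s"
    then have "even D" using disc by (auto simp flip: disc)
    then show False using D(2) by (auto simp: cong_def) presburger
  qed
  then obtain k where k: "s = 2 * k + 1" by (auto elim: oddE)
  ultimately have "2 * t = 2 * (of_int k + quad_gen D) \<or> 2 * t = 2 * (of_int (k + 1) - quad_gen D)"
    by (auto simp: algebra_simps)
  then have "t = of_int k + quad_gen D \<or> t = of_int (k + 1) - quad_gen D"
    by (metis mult_left_cancel zero_neq_numeral)
  then show ?thesis
  proof
    assume t: "t = of_int k + quad_gen D"
    have "of_int m + of_int n * t = of_int (m + n * k) + of_int n * quad_gen D" 
      "of_int m + of_int n * quad_gen D = of_int (m - n * k) + of_int n * t" for m n
      by (simp_all add: t algebra_simps)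
    then show ?thesis unfolding Bt quad_order_def by blast
  next
    assume t: "t = of_int (k + 1) - quad_gen D"
    have "of_int m + of_int n * t = of_int (m + n * (k + 1)) + of_int (- n) * quad_gen D"
      "of_int m + of_int n * quad_gen D = of_int (m + n * (k + 1)) + of_int (- n) * t" for m n
      by (simp_all add: t algebra_simps)
    then show ?thesis unfolding Bt quad_order_def by blast
  qed
qed

lemma is_order_of_discriminant_End_iff:
  assumes L: "complex_lattice L" and D: "D < 0" "[D = 1] (mod 4)"
  shows "is_order_of_discriminant (End (complex_ring A_Mod L)) D \<longleftrightarrow> multipliers L = quad_order D"
proof -
  interpret complex_lattice L by fact
  interpret C: ring "complex_ring" by (rule ring_from_type_algebra)
  show ?thesis
  proof
    assume "is_order_of_discriminant (End E) D"
    then obtain K A h where ord: "order_in K A" "order_discriminant K A = of_int D"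
      and h: "h \<in> ring_iso (End E) (complex_ring\<lparr>carrier := A\<rparr>)"
      unfolding is_order_of_discriminant_def is_ring_iso_def by blast
    have "h \<circ> mult_map \<in> ring_iso (complex_ring\<lparr>carrier := multipliers L\<rparr>) (complex_ring\<lparr>carrier := A\<rparr>)"
      by (rule ring_iso_set_trans[OF mult_map_ring_iso h])
    then show "multipliers L = quad_order D"
      by (rule iso_order_imp_quad_order[OF D ord]) (use subring_multipliers in blast)+
  next
    assume eq: "multipliers L = quad_order D"
    have "ring (complex_ring\<lparr>carrier := quad_order D\<rparr>)"
      by (rule C.subring_is_ring[OF subring_quad_order[OF D]])
    then have "inv_into (quad_order D) mult_map \<in> ring_iso (End E) (complex_ring\<lparr>carrier := quad_order D\<rparr>)"
      using ring_iso_set_sym[OF _ mult_map_ring_iso] eq by simp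
    then show "is_order_of_discriminant (End E) D"
      unfolding is_order_of_discriminant_def is_ring_iso_def
      using quadratic_field_quad_field[OF D] order_in_quad_order[OF D] by blast
  qed
qed

text \<open>The order contains the nonreal number \<open>quad_gen D\<close>, so complex
  multiplication comes with it.\<close>

lemma has_CM_order_iff:
  assumes L: "complex_lattice L" and D: "D < 0" "[D = 1] (mod 4)"
  shows "has_CM (complex_ring A_Mod L) \<and> is_order_of_discriminant (End (complex_ring A_Mod L)) D
    \<longleftrightarrow> multipliers L = quad_order D"
proof -
  have "quad_gen D \<in> quad_order D" by (rule quad_order_memI[of _ 0 1]) simp
  moreover have "quad_gen D \<notin> \<int>"
    using Im_quad_gen[OF D(1)] by (auto elim!: Ints_cases)
  ultimately show ?thesis
    using is_order_of_discriminant_End_iff[OF assms] complex_lattice.has_CM_iff[OF L] by blast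
qed

section \<open>Saturated divisors\<close>

abbreviation (input) is_prime :: "nat \<Rightarrow> bool" where
  "is_prime \<equiv> normalization_semidom_class.prime"

text \<open>Recovering the set of primes from the product is what makes the parametrization of
  unitary divisors injective.\<close>

lemma prime_power_part:
  fixes n :: nat
  assumes "finite A" "A \<subseteq> prime_factors n"
  shows "prime_factors (\<Prod>p\<in>A. p ^ multiplicity p n) = A"
proof -
  have A: "is_prime p" "multiplicity p n > 0" if "p \<in> A" for p
    using that assms(2) by (auto simp: prime_factors_multiplicity)
  have nz: "(\<Prod>p\<in>A. p ^ multiplicity p n) \<noteq> 0"
    using assms(1) A(1) by (auto simp: prod_zero_iff)
  have "q dvd (\<Prod>p\<in>A. p ^ multiplicity p n) \<longleftrightarrow> q \<in> A" if q: "is_prime q" for q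
  proof
    assume "q dvd (\<Prod>p\<in>A. p ^ multiplicity p n)"
    then have "\<exists>p\<in>A. q dvd p ^ multiplicity p n"
      using prime_dvd_prod_iff[OF assms(1) q, of "\<lambda>p. p ^ multiplicity p n"] by simp
    then obtain p where p: "p \<in> A" "q dvd p ^ multiplicity p n" by blast
    have "q dvd p" using prime_dvd_power[OF q p(2)] .
    then show "q \<in> A" using p(1) primes_dvd_imp_eq[OF q A(1)[OF p(1)]] by simp
  next
    assume "q \<in> A"
    then have "q dvd q ^ multiplicity q n" using A(2) by (simp add: dvd_power)
    then show "q dvd (\<Prod>p\<in>A. p ^ multiplicity p n)"
      using dvd_prodI[OF assms(1) \<open>q \<in> A\<close>, of "\<lambda>p. p ^ multiplicity p n"] by (rule dvd_trans)
  qed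
  then show ?thesis using nz A(1) by (auto simp: prime_factors_dvd)
qed

text \<open>A divisor coprime to its cofactor takes each prime power of \<open>n\<close> whole or
  not at all, so it amounts to a set of primes.\<close>

lemma card_unitary_divisors:
  fixes n :: nat
  assumes n: "n > 0"
  shows "card {d. d dvd n \<and> coprime d (n div d)} = 2 ^ card (prime_factors n)"
proof -
  define F where "F = (\<lambda>A. \<Prod>p\<in>A. p ^ multiplicity p n)"
  let ?P = "prime_factors n"
  have fin: "finite A" if "A \<subseteq> ?P" for A using that finite_subset by blast
  have whole: "F ?P = n" unfolding F_def using n by (intro prime_factorization_nat[symmetric])
  have pos: "F A > 0" if "A \<subseteq> ?P" for A
    unfolding F_def using that by (intro prod_pos) (auto simp: prime_factors_multiplicity prime_gt_0_nat)
  have split: "F A * F (?P - A) = n" if "A \<subseteq> ?P" for A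
    using prod.subset_diff[OF that, of "\<lambda>p. p ^ multiplicity p n"] whole by (simp add: F_def mult.commute)
  have "bij_betw F (Pow ?P) {d. d dvd n \<and> coprime d (n div d)}"
    unfolding bij_betw_def
  proof
    show "inj_on F (Pow ?P)"
    proof (rule inj_onI)
      fix A B assume AB: "A \<in> Pow ?P" "B \<in> Pow ?P" "F A = F B"
      have "prime_factors (F A) = A" if "A \<in> Pow ?P" for A
        unfolding F_def using that by (intro prime_power_part fin) auto
      from this[OF AB(1)] this[OF AB(2)] show "A = B" unfolding AB(3) by (rule trans[OF sym])
    qed
    show "F ` Pow ?P = {d. d dvd n \<and> coprime d (n div d)}"
    proof
      show "F ` Pow ?P \<subseteq> {d. d dvd n \<and> coprime d (n div d)}"
      proof clarify
        fix A assume A: "A \<subseteq> ?P"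
        have "F A * F (?P - A) div F A = F (?P - A)"
          by (rule nonzero_mult_div_cancel_left) (use pos[OF A] in auto)
        then have "n div F A = F (?P - A)" unfolding split[OF A] .
        moreover have "coprime (F A) (F (?P - A))"
          unfolding F_def
        proof (intro prod_coprime_left prod_coprime_right)
          fix p q assume "p \<in> A" "q \<in> ?P - A"
          then have "is_prime p" "is_prime q" "p \<noteq> q" using A by (auto simp: prime_factors_multiplicity)
          then show "coprime (p ^ multiplicity p n) (q ^ multiplicity q n)"
            using primes_coprime by (intro coprime_power_left_iff[THEN iffD2] disjI1 coprime_power_right_iff[THEN iffD2]) blast
        qed
        moreover have "F A dvd n" using split[OF A] by (metis dvd_triv_left)
        ultimately show "F A dvd n \<and> coprime (F A) (n div F A)" by simp
      qed
      show "{d. d dvd n \<and> coprime d (n div d)} \<subseteq> F ` Pow ?P"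
      proof clarify
        fix d assume d: "d dvd n" "coprime d (n div d)"
        have dn: "n = d * (n div d)" using d(1) by simp
        have d0: "d > 0" "n div d > 0" using n dn by (auto intro: Nat.gr0I) 
        have mult: "multiplicity p d = multiplicity p n" if p: "p \<in> prime_factors d" for p
        proof -
          have pp: "is_prime p" "p dvd d" using p by auto
          then have "\<not> p dvd n div d" using coprime_common_divisor_nat[OF d(2) pp(2)] pp(1) by (auto dest: prime_gt_1_nat)
          then have "multiplicity p (n div d) = 0" by (rule not_dvd_imp_multiplicity_0)
          moreover have "multiplicity p n = multiplicity p d + multiplicity p (n div d)"
            using prime_elem_multiplicity_mult_distrib[of p d "n div d"] pp(1) d0 dn by simp
          ultimately show ?thesis by simp
        qed
        have "d = (\<Prod>p\<in>prime_factors d. p ^ multiplicity p d)" using d0 by (intro prime_factorization_nat)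
        also have "\<dots> = F (prime_factors d)" unfolding F_def by (intro prod.cong refl) (simp add: mult)
        finally have "d = F (prime_factors d)" .
        moreover have "prime_factors d \<subseteq> ?P" using d(1) n by (intro dvd_prime_factors) auto
        ultimately show "d \<in> F ` Pow ?P" by blast
      qed
    qed
  qed
  then have "card {d. d dvd n \<and> coprime d (n div d)} = card (Pow ?P)"
    by (rule bij_betw_same_card[symmetric])
  then show ?thesis by (simp add: card_Pow)
qed

lemma saturated_divisor_iff_nat:
  assumes "D < 0"
  shows "0 < \<beta> \<and> saturated_divisor \<beta> D \<longleftrightarrow>
    (\<exists>d. \<beta> = int d \<and> d dvd nat (- D) \<and> coprime d (nat (- D) div d))"
proof -
  define n where "n = nat (- D)"
  have D: "D = - int n" using assms by (simp add: n_def)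
  have "saturated_divisor (int d) D \<longleftrightarrow> d dvd n \<and> coprime d (n div d)" for d
  proof (cases "d dvd n")
    case True
    then obtain k where k: "n = d * k" by blast
    show ?thesis
    proof (cases "d = 0")
      case False
      moreover have "D = int d * (- int k)" by (simp add: D k)
      ultimately have "D div int d = - int k" "n div d = k"
        using nonzero_mult_div_cancel_left[of "int d" "- int k"] by (simp_all add: k)
      then show ?thesis using True by (simp add: saturated_divisor_def D)
    qed (use True assms D in auto)
  next
    case False
    then show ?thesis by (simp add: saturated_divisor_def D)
  qed
  note * = this
  show ?thesis
  proof
    assume "0 < \<beta> \<and> saturated_divisor \<beta> D"
    then show "\<exists>d. \<beta> = int d \<and> d dvd nat (- D) \<and> coprime d (nat (- D) div d)"
      using *[of "nat \<beta>"] by (intro exI[of _ "nat \<beta>"]) (auto simp: n_def)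
  next
    assume "\<exists>d. \<beta> = int d \<and> d dvd nat (- D) \<and> coprime d (nat (- D) div d)"
    then obtain d where "\<beta> = int d" "d dvd n" "coprime d (n div d)" unfolding n_def by blast
    moreover have "n > 0" using assms by (simp add: n_def)
    then have "d \<noteq> 0" using dvd_pos_nat[OF _ \<open>d dvd n\<close>] by simp
    ultimately show "0 < \<beta> \<and> saturated_divisor \<beta> D" using *[of d] by simp
  qed
qed

lemma saturated_divisor_cofactor:
  assumes D: "D < 0" and b: "0 < \<beta>" "saturated_divisor \<beta> D"
  shows "0 < - D div \<beta>" "saturated_divisor (- D div \<beta>) D" "\<beta> * (- D div \<beta>) = - D"
proof -
  obtain k where k: "D = \<beta> * k" using b(2) by (auto simp: saturated_divisor_def)
  have e: "- D div \<beta> = - k" using b(1) unfolding k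
    by (metis mult_minus_right nonzero_mult_div_cancel_left less_irrefl)
  have kneg: "k < 0" using D b(1) unfolding k by (simp add: mult_less_0_iff)
  show "0 < - D div \<beta>" "\<beta> * (- D div \<beta>) = - D" unfolding e using kneg by (auto simp: k)
  have "D = (- k) * (- \<beta>)" by (simp add: k mult.commute)
  then have "D div - k = - \<beta>" using kneg by (metis neg_equal_0_iff_equal less_irrefl nonzero_mult_div_cancel_left)
  moreover have "D div \<beta> = k" using b(1) by (simp add: k)
  ultimately have "D div \<beta> = k" "D div - k = - \<beta>" by auto
  then show "saturated_divisor (- D div \<beta>) D"
    using b(2) unfolding e saturated_divisor_def by (auto simp: k coprime_commute)
qed

text \<open>Squares are 0 or 1 modulo 4, whereas - D is 3.\<close>

lemma square_neq_minus:
  fixes \<beta> D :: int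
  assumes "[D = 1] (mod 4)"
  shows "\<beta> * \<beta> \<noteq> - D"
proof
  assume *: "\<beta> * \<beta> = - D"
  have "\<beta> mod 4 \<in> {0,1,2,3}" by auto
  then have "(\<beta> * \<beta>) mod 4 \<in> {0, 1}" using mod_mult_eq[of \<beta> 4 \<beta>, symmetric] by auto
  moreover have "(- D) mod 4 = 3" using assms unfolding cong_def by presburger
  ultimately show False using * by simp
qed

text \<open>The involution \<open>\<beta> \<mapsto> |D| / \<beta>\<close> on the saturated divisors has no fixed points, since
  \<open>|D|\<close> is not a square.\<close>
lemma card_small_saturated_divisors:
  assumes D: "D < 0" "[D = 1] (mod 4)"
  shows "card {\<beta>::int. \<beta> > 0 \<and> saturated_divisor \<beta> D \<and> real_of_int \<beta> < sqrt \<bar>real_of_int D\<bar>}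
    = 2 ^ (card {p::nat. is_prime p \<and> int p dvd D} - 1)"
proof -
  define n where "n = nat (- D)"
  have n: "n > 0" "D = - int n" using D by (simp_all add: n_def)
  define U where "U = {\<beta>. 0 < \<beta> \<and> saturated_divisor \<beta> D}"
  define S where "S = {\<beta>\<in>U. \<beta> * \<beta> < - D}"
  define T where "T = {\<beta>\<in>U. - D < \<beta> * \<beta>}"
  have U_img: "U = int ` {d. d dvd n \<and> coprime d (n div d)}"
    unfolding U_def n_def using saturated_divisor_iff_nat[OF D(1)] by auto
  have fin_n: "finite {d. d dvd n \<and> coprime d (n div d)}"
    by (rule finite_subset[OF _ finite_divisors_nat[OF n(1)]]) auto
  have finU: "finite U" unfolding U_img using fin_n by simp
  have cardU: "card U = 2 ^ card (prime_factors n)"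
    unfolding U_img using card_unitary_divisors[OF n(1)] by (simp add: card_image)
  have pf: "prime_factors n = {p::nat. is_prime p \<and> int p dvd D}"
    using n by (auto simp: prime_factors_dvd)
  define \<iota> where "\<iota> = (\<lambda>\<beta>. - D div \<beta>)"
  have inv: "\<iota> \<beta> \<in> U" "\<beta> * \<iota> \<beta> = - D" if "\<beta> \<in> U" for \<beta>
    using saturated_divisor_cofactor[OF D(1)] that by (auto simp: U_def \<iota>_def)
  have inv2: "\<iota> (\<iota> \<beta>) = \<beta>" if "\<beta> \<in> U" for \<beta>
  proof -
    have "\<iota> \<beta> * \<iota> (\<iota> \<beta>) = \<iota> \<beta> * \<beta>" using inv(2)[OF that] inv(2)[OF inv(1)[OF that]] by (simp add: mult.commute)
    moreover have "\<iota> \<beta> \<noteq> 0" using inv(1)[OF that] by (auto simp: U_def)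
    ultimately show ?thesis by simp
  qed
  have posU: "\<beta> * \<beta> > 0" if "\<beta> \<in> U" for \<beta> using that by (simp add: U_def)
  have sq: "(\<beta> * \<beta>) * (\<iota> \<beta> * \<iota> \<beta>) = (- D) * (- D)" if "\<beta> \<in> U" for \<beta>
    using inv(2)[OF that] by (metis mult.assoc mult.left_commute)
  have ST: "\<iota> \<beta> \<in> T" if "\<beta> \<in> S" for \<beta>
  proof -
    have b: "\<beta> \<in> U" "\<beta> * \<beta> < - D" using that by (auto simp: S_def)
    have "\<not> \<iota> \<beta> * \<iota> \<beta> \<le> - D"
    proof
      assume "\<iota> \<beta> * \<iota> \<beta> \<le> - D"
      then have "(\<beta> * \<beta>) * (\<iota> \<beta> * \<iota> \<beta>) < (- D) * (- D)"
        using b D(1) posU[OF b(1)] posU[OF inv(1)[OF b(1)]] by (intro mult_less_le_imp_less) auto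
      then show False using sq[OF b(1)] by simp
    qed
    then show ?thesis using inv(1)[OF b(1)] by (simp add: T_def)
  qed
  have TS: "\<iota> \<beta> \<in> S" if "\<beta> \<in> T" for \<beta>
  proof -
    have b: "\<beta> \<in> U" "- D < \<beta> * \<beta>" using that by (auto simp: T_def)
    have "\<not> - D \<le> \<iota> \<beta> * \<iota> \<beta>"
    proof
      assume "- D \<le> \<iota> \<beta> * \<iota> \<beta>"
      then have "(- D) * (- D) < (\<beta> * \<beta>) * (\<iota> \<beta> * \<iota> \<beta>)"
        using b D(1) posU[OF b(1)] posU[OF inv(1)[OF b(1)]] by (intro mult_less_le_imp_less) auto
      then show False using sq[OF b(1)] by simp
    qed
    then show ?thesis using inv(1)[OF b(1)] by (simp add: S_def)
  qed
  have "bij_betw \<iota> S T"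
  proof (rule bij_betwI[where g = \<iota>])
    show "\<iota> \<in> S \<rightarrow> T" "\<iota> \<in> T \<rightarrow> S" using ST TS by auto
  qed (use inv2 in \<open>auto simp: S_def T_def\<close>)
  then have "card S = card T" by (rule bij_betw_same_card)
  moreover have "U = S \<union> T" unfolding S_def T_def using square_neq_minus[OF D(2)] by (auto simp: neq_iff)
  moreover have "S \<inter> T = {}" unfolding S_def T_def by auto
  moreover have "finite S" "finite T" using finU unfolding S_def T_def by auto
  ultimately have "card U = 2 * card S" by (simp add: card_Un_disjoint)
  then have two: "2 * card S = 2 ^ card (prime_factors n)" using cardU by simp
  \<comment> \<open>The left side of \<open>two\<close> is even, which rules out the exponent 0; the
    truncated subtraction in the exponent is thus a true one.\<close>
  have "card (prime_factors n) \<noteq> 0"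
  proof
    assume "card (prime_factors n) = 0"
    then show False using two by simp
  qed
  then obtain k where k: "card (prime_factors n) = Suc k" by (cases "card (prime_factors n)") auto
  have "card S = 2 ^ k" using two unfolding k by simp
  moreover have "{\<beta>::int. \<beta> > 0 \<and> saturated_divisor \<beta> D \<and> real_of_int \<beta> < sqrt \<bar>real_of_int D\<bar>} = S"
  proof -
    have "real_of_int \<beta> < sqrt \<bar>real_of_int D\<bar> \<longleftrightarrow> \<beta> * \<beta> < - D" if "\<beta> > 0" for \<beta>
    proof -
      have "real_of_int \<beta> < sqrt \<bar>real_of_int D\<bar> \<longleftrightarrow> sqrt (real_of_int (\<beta> * \<beta>)) < sqrt (real_of_int (- D))"
        using that D(1) by (simp add: real_sqrt_mult)
      also have "\<dots> \<longleftrightarrow> \<beta> * \<beta> < - D" unfolding real_sqrt_less_iff of_int_less_iff ..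
      finally show ?thesis .
    qed
    then show ?thesis by (auto simp: S_def U_def)
  qed
  ultimately show ?thesis unfolding pf[symmetric] k by simp
qed

section \<open>Lattices with real \<open>j\<close>-invariant\<close>

lemma is_lattice_off_axes:
  assumes "is_lattice L"
  obtains u v where "u \<in> L" "Im u > 0" "v \<in> L" "Re v > 0"
proof -
  obtain w1 w2 where w: "Im (w1 * cnj w2) \<noteq> 0" "L = lattice_spanned w1 w2"
    using assms is_lattice_iff by blast
  interpret complex_lattice L by (rule is_lattice_imp_complex_lattice[OF assms])
  have mem: "w1 \<in> L" "w2 \<in> L" unfolding w(2)
    by (rule lattice_spanned_memI[of _ 1 _ 0], simp, rule lattice_spanned_memI[of _ 0 _ 1], simp)
  have "Im w1 \<noteq> 0 \<or> Im w2 \<noteq> 0" using w(1) by auto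
  then obtain u0 where u0: "u0 \<in> L" "Im u0 \<noteq> 0" using mem by blast
  obtain u where u: "u \<in> L" "Im u > 0"
  proof (cases "Im u0 > 0")
    case False
    then have "Im (- u0) > 0" using u0 by simp
    then show ?thesis using that[of "- u0"] uminus_mem u0 by blast
  qed (use that u0 in blast)
  have "Re w1 \<noteq> 0 \<or> Re w2 \<noteq> 0" using w(1) by auto
  then obtain v0 where v0: "v0 \<in> L" "Re v0 \<noteq> 0" using mem by blast
  obtain v where v: "v \<in> L" "Re v > 0"
  proof (cases "Re v0 > 0")
    case False
    then have "Re (- v0) > 0" using v0 by simp
    then show ?thesis using that[of "- v0"] uminus_mem v0 by blast
  qed (use that v0 in blast)
  show ?thesis using that u v by blast
qed

lemma (in complex_lattice) of_int_mult_mem: "w \<in> L \<Longrightarrow> of_int n * w \<in> L"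
  using subring_multipliers(5)[of n] by (simp add: multipliers_def)

text \<open>\<open>v + cnj v\<close> is a positive real element, so by discreteness there is a least
  one, and division with remainder shows that it generates all real elements.\<close>

lemma (in complex_lattice) real_points:
  assumes stable: "cnj ` L = L" and v: "v \<in> L" "Re v > 0"
  obtains a where "a > 0" "of_real a \<in> L" "\<And>y. of_real y \<in> L \<Longrightarrow> \<exists>n::int. y = of_int n * a"
proof -
  define r where "r = 2 * Re v"
  have "v + cnj v \<in> L" using v(1) stable add_mem by blast
  then have r: "of_real r \<in> L" "r > 0" using v(2) by (simp_all add: complex_add_cnj r_def)
  define S where "S = {x. 0 < x \<and> x \<le> r \<and> of_real x \<in> L}"
  have "of_real ` S \<subseteq> L \<inter> cball 0 r" by (auto simp: S_def)
  then have "finite (complex_of_real ` S)" using finite_cball finite_subset by blast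
  then have "finite S" by (rule finite_imageD) (simp add: inj_on_def)
  moreover have "r \<in> S" using r by (simp add: S_def)
  then have "S \<noteq> {}" by blast
  ultimately have a: "Min S \<in> S" "\<And>x. x \<in> S \<Longrightarrow> Min S \<le> x" using Min_in[of S] Min_le[of S] by blast+
  define a where "a = Min S"
  have apos: "a > 0" "of_real a \<in> L" "a \<le> r" using a(1) by (auto simp: S_def a_def)
  have "\<exists>n::int. y = of_int n * a" if y: "of_real y \<in> L" for y
  proof -
    define n where "n = \<lfloor>y / a\<rfloor>"
    define z where "z = y - of_int n * a"
    have "of_int n \<le> y / a" "y / a < of_int n + 1" unfolding n_def by linarith+
    then have z: "0 \<le> z" "z < a" using apos(1) by (simp_all add: z_def field_simps)
    have "of_real z \<in> L" using diff_mem[OF y of_int_mult_mem[OF apos(2), of n]] by (simp add: z_def)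
    then have "z = 0" using z a(2)[of z] apos by (force simp: S_def a_def)
    then show ?thesis by (auto simp: z_def)
  qed
  then show ?thesis using that apos by blast
qed

text \<open>A basis consists of the least positive real element \<open>a\<close> and an element
  \<open>w\<close> of least positive imaginary part. As \<open>w + cnj w\<close> is real, it is an
  integer multiple of \<open>a\<close>, so shifting \<open>w\<close> by multiples of
  \<open>a\<close> brings its real part to 0 or a / 2.\<close>

lemma cnj_stable_normal_form:
  assumes L: "is_lattice L" and stable: "cnj ` L = L"
  obtains c \<tau> where "c \<noteq> 0" "Im \<tau> > 0" "Re \<tau> = 0 \<or> Re \<tau> = 1/2" "L = (*) c ` lattice_spanned \<tau> 1"
proof -
  interpret complex_lattice L by (rule is_lattice_imp_complex_lattice[OF L])
  obtain u v where uv: "u \<in> L" "Im u > 0" "v \<in> L" "Re v > 0" using is_lattice_off_axes[OF L] by blast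
  obtain a where a: "a > 0" "of_real a \<in> L" "\<And>y. of_real y \<in> L \<Longrightarrow> \<exists>n::int. y = of_int n * a"
    using real_points[OF stable uv(3,4)] by blast
  \<comment> \<open>Real parts are reduced to be at least 0 and below \<open>a\<close>, so that the
    candidates for \<open>w\<close> lie in a bounded set and a minimum exists.\<close>
  have shift: "\<exists>n::int. x - of_int n * of_real a \<in> L \<and> 0 \<le> Re (x - of_int n * of_real a) \<and> Re (x - of_int n * of_real a) < a"
    if "x \<in> L" for x
  proof (intro exI[of _ "\<lfloor>Re x / a\<rfloor>"] conjI)
    show "0 \<le> Re (x - of_int \<lfloor>Re x / a\<rfloor> * of_real a)" "Re (x - of_int \<lfloor>Re x / a\<rfloor> * of_real a) < a"
      using floor_divide_lower[OF a(1), of "Re x"] floor_divide_upper[OF a(1), of "Re x"]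
      by (simp_all add: distrib_right)
    show "x - of_int \<lfloor>Re x / a\<rfloor> * of_real a \<in> L" using that a(2) diff_mem of_int_mult_mem by blast
  qed
  define T where "T = {w\<in>L. 0 < Im w \<and> Im w \<le> Im u \<and> 0 \<le> Re w \<and> Re w < a}"
  have "T \<subseteq> L \<inter> cball 0 (a + Im u)"
  proof
    fix w assume w: "w \<in> T"
    then have "norm w \<le> a + Im u" using cmod_le[of w] by (auto simp: T_def)
    then show "w \<in> L \<inter> cball 0 (a + Im u)" using w by (auto simp: T_def)
  qed
  then have "finite T" using finite_cball finite_subset by blast
  then have finI: "finite (Im ` T)" by simp
  have "T \<noteq> {}"
  proof -
    obtain n where "u - of_int n * of_real a \<in> L \<and> 0 \<le> Re (u - of_int n * of_real a) \<and> Re (u - of_int n * of_real a) < a"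
      using shift[OF uv(1)] by blast
    then have "u - of_int n * of_real a \<in> T" using uv(2) by (simp add: T_def)
    then show ?thesis by blast
  qed
  then have "Min (Im ` T) \<in> Im ` T" using finI by (intro Min_in) auto
  then obtain w where w: "w \<in> T" "\<And>x. x \<in> T \<Longrightarrow> Im w \<le> Im x"
    using finI by (metis (no_types, lifting) Min_le image_eqI image_iff)
  have wL: "w \<in> L" "Im w > 0" "Im w \<le> Im u" using w(1) by (auto simp: T_def)
  have minimal: "Im w \<le> Im x" if x: "x \<in> L" "Im x > 0" for x
  proof (rule ccontr)
    assume "\<not> Im w \<le> Im x"
    obtain n where n: "x - of_int n * of_real a \<in> L \<and> 0 \<le> Re (x - of_int n * of_real a) \<and> Re (x - of_int n * of_real a) < a"
      using shift[OF x(1)] by blast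
    then have "x - of_int n * of_real a \<in> T" using x \<open>\<not> Im w \<le> Im x\<close> wL by (simp add: T_def)
    from w(2)[OF this] show False using \<open>\<not> Im w \<le> Im x\<close> by simp
  qed
  have gen: "\<exists>m n::int. x = of_int m * w + of_int n * of_real a" if x: "x \<in> L" for x
  proof -
    define m where "m = \<lfloor>Im x / Im w\<rfloor>"
    define y where "y = x - of_int m * w"
    have yL: "y \<in> L" using x wL diff_mem of_int_mult_mem by (simp add: y_def)
    have "of_int m \<le> Im x / Im w" "Im x / Im w < of_int m + 1" unfolding m_def by linarith+
    then have "0 \<le> Im y" "Im y < Im w" using wL(2) by (simp_all add: y_def field_simps)
    then have "Im y = 0" using minimal[OF yL] by force
    then have y: "y = of_real (Re y)" by (simp add: complex_eq_iff)
    obtain n :: int where "Re y = of_int n * a" using a(3)[of "Re y"] yL y by auto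
    then have "y = of_int n * of_real a" using y by (metis of_real_mult of_real_of_int_eq)
    then show ?thesis by (intro exI[of _ m] exI[of _ n]) (simp add: y_def algebra_simps)
  qed
  have "w + cnj w \<in> L" using wL(1) stable add_mem by blast
  then have "of_real (2 * Re w) \<in> L" by (simp add: complex_add_cnj)
  then obtain k :: int where k: "2 * Re w = of_int k * a" using a(3) by blast
  define w' where "w' = w - of_int (k div 2) * of_real a"
  have w'L: "w' \<in> L" using wL(1) a(2) diff_mem of_int_mult_mem by (simp add: w'_def)
  define \<tau> where "\<tau> = w' / of_real a"
  have "Re \<tau> = of_int k / 2 - of_int (k div 2)"
    using k a(1) by (simp add: \<tau>_def w'_def field_simps)
  moreover have "k = 2 * (k div 2) \<or> k = 2 * (k div 2) + 1" by presburger
  then have "real_of_int k = 2 * real_of_int (k div 2) \<or> real_of_int k = 2 * real_of_int (k div 2) + 1"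
    by (metis of_int_1 of_int_add of_int_mult of_int_numeral)
  ultimately have re: "Re \<tau> = 0 \<or> Re \<tau> = 1/2" by auto
  have im: "Im \<tau> > 0" using wL(2) a(1) by (simp add: \<tau>_def w'_def)
  have scale: "(*) (of_real a) ` lattice_spanned \<tau> 1 = lattice_spanned w' (of_real a)"
    unfolding scale_lattice_spanned using a(1) by (simp add: \<tau>_def)
  have "L = lattice_spanned w' (of_real a)"
  proof
    show "L \<subseteq> lattice_spanned w' (of_real a)"
    proof
      fix x assume "x \<in> L"
      then obtain m n :: int where "x = of_int m * w + of_int n * of_real a" using gen by blast
      then have "x = of_int m * w' + of_int (n + m * (k div 2)) * of_real a"
        by (simp add: w'_def algebra_simps)
      then show "x \<in> lattice_spanned w' (of_real a)" by (rule lattice_spanned_memI)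
    qed
    show "lattice_spanned w' (of_real a) \<subseteq> L"
      unfolding lattice_spanned_def using w'L a(2) add_mem of_int_mult_mem by blast
  qed
  then have "L = (*) (of_real a) ` lattice_spanned \<tau> 1" unfolding scale .
  then show ?thesis using that[of "of_real a" \<tau>] re im a(1) by simp
qed

lemma quad_order_real: "D < 0 \<Longrightarrow> of_real x \<in> quad_order D \<Longrightarrow> x \<in> \<int>"
proof -
  assume D: "D < 0" and "of_real x \<in> quad_order D"
  then obtain m n :: int where mn: "of_real x = of_int m + of_int n * quad_gen D" unfolding quad_order_def by blast
  then have "of_real (x - m) + of_real (- of_int n) * quad_gen D = 0" by simp
  from real_mult_gen_zero[OF D this] have "x = of_int m" by simp
  then show "x \<in> \<int>" by simp
qed

text \<open>If \<open>cnj L = s L\<close>, rotating \<open>L\<close> by a square root of \<open>s\<close> makes \<open>s\<close> positive real; then \<open>s\<^sup>2\<close> is a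
  unit among the real multipliers, which are integers, so \<open>s = 1\<close>.\<close>
lemma make_cnj_stable:
  assumes L: "is_lattice L" and s: "s \<noteq> 0" "cnj ` L = (*) s ` L"
    and D: "D < 0" and mult: "multipliers L = quad_order D"
  obtains c where "c \<noteq> 0" "cnj ` ((*) c ` L) = (*) c ` L"
proof -
  define c where "c = csqrt s"
  have c: "c \<noteq> 0" "c * c = s" using s(1) by (simp_all add: c_def flip: power2_eq_square)
  define \<rho> where "\<rho> = (norm c)^2"
  have \<rho>: "\<rho> > 0" "cnj c * c = of_real \<rho>"
    using c(1) complex_norm_square[of c] by (simp_all add: \<rho>_def mult.commute)
  define L' where "L' = (*) c ` L"
  have stable: "cnj ` L' = (*) (of_real \<rho>) ` L'"
  proof -
    have "cnj ` L' = (*) (cnj c) ` (cnj ` L)" unfolding L'_def by (simp add: image_image)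
    also have "\<dots> = (*) (of_real \<rho>) ` L'"
      unfolding s(2) L'_def image_image \<rho>(2)[symmetric] using c(2) by (auto simp: mult_ac)
    finally show ?thesis .
  qed
  have sq: "(*) (of_real (\<rho>^2)) ` L' = L'"
  proof -
    have "L' = cnj ` ((*) (of_real \<rho>) ` L')"
      by (simp only: stable[symmetric] image_image complex_cnj_cnj image_ident)
    also have "\<dots> = (*) (of_real \<rho>) ` (cnj ` L')" by (simp add: image_image)
    also have "\<dots> = (*) (of_real \<rho>) ` ((*) (of_real \<rho>) ` L')" unfolding stable ..
    also have "\<dots> = (*) (of_real (\<rho>^2)) ` L'" by (simp add: image_image power2_eq_square mult.assoc)
    finally show ?thesis ..
  qed
  have mL': "multipliers L' = quad_order D" unfolding L'_def using multipliers_scale[OF c(1)] mult by simp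
  have "of_real (\<rho>^2) \<in> multipliers L'" unfolding multipliers_def using sq by blast
  then have "\<rho>^2 \<in> \<int>" using quad_order_real[OF D] mL' by blast
  moreover have "of_real (1 / \<rho>^2) \<in> multipliers L'"
    unfolding multipliers_def
  proof clarify
    fix w assume "w \<in> L'"
    then obtain v where "v \<in> L'" "w = of_real (\<rho>^2) * v" using sq by blast
    then show "of_real (1 / \<rho>^2) * w \<in> L'" using \<rho>(1) by simp
  qed
  then have "1 / \<rho>^2 \<in> \<int>" using quad_order_real[OF D] mL' by blast
  ultimately obtain p q :: int where pq: "\<rho>^2 = of_int p" "1 / \<rho>^2 = of_int q" by (auto elim!: Ints_cases)
  have "real_of_int (p * q) = 1" using pq \<rho>(1) by (metis of_int_mult nonzero_mult_div_cancel_left times_divide_eq_right mult.right_neutral power_not_zero less_irrefl)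
  then have "p * q = 1" by linarith
  moreover have "p > 0" using pq(1) \<rho>(1) by (metis of_int_0_less_iff zero_less_power)
  ultimately have "p = 1" using zmult_eq_1_iff by auto
  then have "\<rho> = 1" using pq(1) \<rho>(1) by (simp add: power2_eq_1_iff)
  then have "cnj ` L' = L'" using stable by simp
  then show ?thesis using that[of c] c(1) by (simp add: L'_def)
qed

section \<open>Multipliers of rhombic lattices\<close>

lemma multipliers_tau_iff: "a \<in> multipliers (lattice_spanned \<tau> 1) \<longleftrightarrow>
    a \<in> lattice_spanned \<tau> 1 \<and> a * \<tau> \<in> lattice_spanned \<tau> 1"
proof
  assume *: "a \<in> multipliers (lattice_spanned \<tau> 1)"
  have "1 \<in> lattice_spanned \<tau> 1" "\<tau> \<in> lattice_spanned \<tau> 1"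
    by (rule lattice_spanned_memI[of _ 0 _ 1], simp, rule lattice_spanned_memI[of _ 1 _ 0], simp)
  then show "a \<in> lattice_spanned \<tau> 1 \<and> a * \<tau> \<in> lattice_spanned \<tau> 1"
    using * unfolding multipliers_def by force
next
  assume *: "a \<in> lattice_spanned \<tau> 1 \<and> a * \<tau> \<in> lattice_spanned \<tau> 1"
  have "(*) a ` lattice_spanned \<tau> 1 \<subseteq> lattice_spanned \<tau> 1"
    unfolding scale_lattice_spanned using * by (intro lattice_spanned_subsetI) auto
  then show "a \<in> multipliers (lattice_spanned \<tau> 1)" unfolding multipliers_def by blast
qed

lemma half_mem_iff:
  "Complex x y \<in> half_lattice t \<longleftrightarrow>
    (\<exists>m::int. \<exists>n::int. x = m / 2 + n \<and> y = m * t)"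
  by (simp add: lattice_spanned_def complex_eq_iff)

text \<open>Writing \<open>quad_gen D\<close> as x \<tau> + y with \<tau> = 1/2 + t i produces
  \<beta> as the coefficient x. The product with \<tau> lies in the lattice as well, which makes x
  |\<tau>|^2 an integer w; as \<tau> has trace 1, this is x \<tau>^2 - x \<tau> + w = 0.\<close>

lemma half_multipliers_saturated:
  assumes t: "t > 0" and D: "D < 0" "[D = 1] (mod 4)"
    and mult: "multipliers (half_lattice t) = quad_order D"
  obtains \<beta> :: int where "\<beta> > 0" "saturated_divisor \<beta> D" "t = sqrt \<bar>real_of_int D\<bar> / (2 * real_of_int \<beta>)"
proof -
  define r where "r = sqrt \<bar>real_of_int D\<bar>"
  have r: "r > 0" "r * r = - real_of_int D" using D(1) by (simp_all add: r_def)
  have "quad_gen D \<in> quad_order D" by (rule quad_order_memI[of _ 0 1]) simp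
  then have gen: "quad_gen D \<in> half_lattice t"
    "quad_gen D * Complex (1/2) t \<in> half_lattice t"
    unfolding mult[symmetric] multipliers_tau_iff by auto
  have g: "quad_gen D = Complex (1/2) (r/2)" by (simp add: quad_gen_def r_def)
  have g2: "quad_gen D * Complex (1/2) t = Complex (1/4 - r * t / 2) (t / 2 + r / 4)"
    unfolding g by (simp add: complex_eq_iff)
  obtain x y :: int where x: "1/2 = x / 2 + y" "r / 2 = x * t"
    using gen(1) unfolding g half_mem_iff by blast
  obtain u v :: int where u: "1/4 - r * t / 2 = u / 2 + v" "t / 2 + r / 4 = u * t"
    using gen(2) unfolding g2 half_mem_iff by blast
  have rx: "r = 2 * x * t" using x(2) by simp
  have xpos: "x > 0"
  proof -
    have "real_of_int x * t > 0" using x(2) r(1) by linarith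
    then show ?thesis using t by (simp add: zero_less_mult_iff)
  qed
  have "t * (1 + x) = t * (2 * u)" using u(2) unfolding rx by (simp add: algebra_simps)
  then have ux: "1 + real_of_int x = 2 * u" using t by simp
  define w where "w = - v"
  have w: "x * (1/4 + t * t) = w"
    using u(1) ux unfolding rx w_def by (simp add: algebra_simps)
  have "real_of_int D = - (4 * (x * (x * (t * t))))" using r(2) unfolding rx by (simp add: algebra_simps)
  also have "\<dots> = x * x - 4 * x * (x * (1/4 + t * t))" by (simp add: algebra_simps)
  also have "\<dots> = real_of_int (x * (x - 4 * w))" unfolding w by (simp add: algebra_simps)
  finally have Dx: "D = x * (x - 4 * w)" by (simp only: of_int_eq_iff)
  have "1 = x + 2 * y" using x(1) by linarith
  then have "odd x" by presburger
  \<comment> \<open>With h the gcd of x and w, (x / h) \<tau> is still a multiplier. Its imaginary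
    part must be an integer multiple of that of \<open>quad_gen D\<close>, which is x t, and this
    forces h = 1.\<close>
  have "coprime x w"
  proof -
    define h where "h = gcd x w"
    obtain x' w' where x': "x = h * x'" "w = h * w'" by (metis h_def gcd_dvd1 gcd_dvd2 dvdE)
    have hpos: "h > 0" using xpos by (simp add: h_def)
    have w'e: "x' * (1/4 + t * t) = w'"
    proof -
      have "h * (x' * (1/4 + t * t)) = h * real_of_int w'" using w unfolding x' by (simp add: mult.assoc)
      then show ?thesis using hpos by simp
    qed
    have "Complex (x' / 2) (x' * t) \<in> multipliers (half_lattice t)"
      unfolding multipliers_tau_iff
    proof
      show "Complex (x' / 2) (x' * t) \<in> half_lattice t"
        unfolding half_mem_iff by (intro exI[of _ x'] exI[of _ 0]) simp
      have "Complex (x' / 2) (x' * t) * Complex (1/2) t = Complex (x' / 2 + (- w')) (x' * t)"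
        using w'e by (simp add: complex_eq_iff algebra_simps)
      then show "Complex (x' / 2) (x' * t) * Complex (1/2) t \<in> half_lattice t"
        unfolding half_mem_iff by (simp only: half_mem_iff) (intro exI[of _ x'] exI[of _ "- w'"], simp)
    qed
    then obtain m n :: int where "Complex (x' / 2) (x' * t) = of_int m + of_int n * quad_gen D"
      unfolding mult quad_order_def by blast
    from arg_cong[OF this, of Im] have "x' * t = n * (r / 2)" unfolding g by simp
    then have "t * x' = t * (n * x)" unfolding rx by (simp add: algebra_simps)
    then have "x' = n * x" using t by (simp flip: of_int_mult)
    then have "x' * (n * h) = x' * 1" using x'(1) by (simp add: mult.commute mult.left_commute)
    moreover have "x' \<noteq> 0" using xpos x'(1) by auto
    ultimately have "n * h = 1" by (simp only: mult_cancel_left simp_thms)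
    then have "h = 1" using hpos by (simp add: pos_zmult_eq_1_iff_lemma zmult_eq_1_iff)
    then show ?thesis by (simp add: h_def coprime_iff_gcd_eq_1)
  qed
  then have "coprime x (4 * w)"
    using \<open>odd x\<close> by (simp add: coprime_mult_right_iff) (metis coprime_power_right_iff coprime_right_2_iff_odd mult_2 numeral_Bit0 power2_eq_square)
  have "coprime x (x - 4 * w)"
  proof (rule coprimeI)
    fix c assume c: "c dvd x" "c dvd x - 4 * w"
    then have "c dvd x - (x - 4 * w)" by (rule dvd_diff)
    then have "c dvd 4 * w" by simp
    with \<open>coprime x (4 * w)\<close> c(1) show "is_unit c" by (rule coprime_common_divisor)
  qed
  moreover have "D div x = x - 4 * w" unfolding Dx using xpos by simp
  ultimately have "saturated_divisor x D" unfolding saturated_divisor_def using Dx by simp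
  moreover have "t = sqrt \<bar>real_of_int D\<bar> / (2 * real_of_int x)" using rx xpos unfolding r_def by (simp add: field_simps)
  ultimately show ?thesis using that xpos by blast
qed

text \<open>With \<tau> = 1/2 + t i, the number \<beta> \<tau> is \<open>quad_gen D\<close> plus an
  integer, and |\<tau>|^2 = w / \<beta> in lowest terms. For m \<tau> + n to be a multiplier, m
  |\<tau>|^2 has to be an integer, so \<beta> divides m.\<close>

lemma half_multipliers_eq:
  assumes D: "D < 0" "[D = 1] (mod 4)" and b: "\<beta> > 0" "saturated_divisor \<beta> D"
  shows "multipliers (half_lattice (sqrt \<bar>real_of_int D\<bar> / (2 * real_of_int \<beta>))) = quad_order D"
proof -
  define r where "r = sqrt \<bar>real_of_int D\<bar>"
  have r: "r > 0" "r * r = - real_of_int D" using D(1) by (simp_all add: r_def)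
  define t where "t = r / (2 * real_of_int \<beta>)"
  have t: "t > 0" "r = 2 * \<beta> * t" using r(1) b(1) by (simp_all add: t_def)
  have g: "quad_gen D = Complex (1/2) (r/2)" by (simp add: quad_gen_def r_def)
  define \<gamma> where "\<gamma> = - (D div \<beta>)"
  have bg: "D = - (\<beta> * \<gamma>)" "coprime \<beta> \<gamma>"
    using b by (auto simp: saturated_divisor_def \<gamma>_def)
  \<comment> \<open>Modulo 4 the product \<beta> \<gamma> = - D is 3, so the two factors are 1 and 3
    in some order.\<close>
  have "4 dvd \<beta> + \<gamma>"
  proof -
    have "(\<beta> * \<gamma>) mod 4 = 3" using D(2) unfolding bg(1) cong_def by presburger
    then have "((\<beta> mod 4) * (\<gamma> mod 4)) mod 4 = 3" by (simp add: mod_mult_eq)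
    moreover have "\<beta> mod 4 \<in> {0,1,2,3}" "\<gamma> mod 4 \<in> {0,1,2,3}" by auto
    ultimately have "(\<beta> mod 4 + \<gamma> mod 4) mod 4 = 0" by auto
    then show ?thesis by (simp add: mod_add_eq mod_0_imp_dvd)
  qed
  then obtain w where w: "\<beta> + \<gamma> = 4 * w" by blast
  have "odd \<beta>"
  proof
    assume "even \<beta>"
    then have "even D" using bg(1) by simp
    then show False using D(2) unfolding cong_def by presburger
  qed
  then obtain k where k: "\<beta> = 2 * k + 1" by (auto elim: oddE)
  have bw: "coprime \<beta> w"
  proof (rule coprimeI)
    fix c assume c: "c dvd \<beta>" "c dvd w"
    then have "c dvd \<gamma>" using w by (metis dvd_add_right_iff dvd_mult)
    then show "is_unit c" using c bg(2) coprime_common_divisor by blast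
  qed
  have wt: "\<beta> * (1/4 + t * t) = w"
  proof -
    have "4 * (\<beta> * \<beta>) * (t * t) = real_of_int (\<beta> * \<gamma>)" using r(2) unfolding t(2) bg(1) by (simp add: algebra_simps)
    then have "\<beta> * (4 * \<beta> * (t * t)) = \<beta> * real_of_int \<gamma>" by (simp add: algebra_simps)
    then have "4 * \<beta> * (t * t) = \<gamma>" using b(1) by simp
    moreover have "real_of_int \<beta> + \<gamma> = 4 * w" using w by (metis of_int_add of_int_mult of_int_numeral)
    ultimately show ?thesis by (simp add: algebra_simps)
  qed
  let ?L = "half_lattice t"
  interpret complex_lattice ?L by (rule is_lattice_imp_complex_lattice[OF is_lattice_half[OF t(1)]])
  have "multipliers ?L = quad_order D"
  proof
    show "multipliers ?L \<subseteq> quad_order D"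
    proof
      fix a assume a: "a \<in> multipliers ?L"
      then have "a \<in> ?L" unfolding multipliers_tau_iff by simp
      then obtain m n :: int where a_eq: "a = of_int m * Complex (1/2) t + of_int n * 1"
        unfolding lattice_spanned_def by blast
      have "a * Complex (1/2) t = Complex (m * (1/4 - t * t) + n / 2) (m * t + n * t)"
        unfolding a_eq by (simp add: complex_eq_iff algebra_simps)
      moreover have "a * Complex (1/2) t \<in> ?L" using a unfolding multipliers_tau_iff by simp
      ultimately have "Complex (m * (1/4 - t * t) + n / 2) (m * t + n * t) \<in> ?L" by (simp only:)
      then obtain p q :: int where pq: "m * (1/4 - t * t) + n / 2 = p / 2 + q" "m * t + n * t = p * t"
        unfolding half_mem_iff by blast
      have "t * (m + n) = t * p" using pq(2) by (simp add: algebra_simps)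
      then have "real_of_int m + n = p" using t(1) by simp
      then have mq: "m * (1/4 + t * t) = - q" using pq(1) by (simp add: algebra_simps)
      have "m * (\<beta> * (1/4 + t * t)) = \<beta> * (m * (1/4 + t * t))" by (rule mult.left_commute)
      also have "\<dots> = - (q * \<beta>)" unfolding mq by simp
      finally have "m * (\<beta> * (1/4 + t * t)) = - (q * \<beta>)" .
      then have "real_of_int (m * w) = real_of_int (- (q * \<beta>))" unfolding wt by simp
      then have "m * w = - (q * \<beta>)" by (simp only: of_int_eq_iff)
      then have "\<beta> dvd m * w" by simp
      then have "\<beta> dvd m" using bw by (simp add: coprime_dvd_mult_left_iff)
      then obtain l where l: "m = \<beta> * l" by blast
      have "a = of_int (n + k * l) + of_int l * quad_gen D"
        unfolding a_eq l g t(2) by (simp add: complex_eq_iff k algebra_simps)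
      then show "a \<in> quad_order D" by (rule quad_order_memI)
    qed
    have gen: "quad_gen D \<in> multipliers ?L"
      unfolding multipliers_tau_iff
    proof
      show "quad_gen D \<in> ?L" unfolding g half_mem_iff
        by (intro exI[of _ \<beta>] exI[of _ "- k"]) (simp add: t(2), simp add: k)
      have "quad_gen D * Complex (1/2) t = Complex (1/4 - \<beta> * (t * t)) ((k + 1) * t)"
        unfolding g t(2) by (simp add: complex_eq_iff k algebra_simps)
      moreover have "1/4 - \<beta> * (t * t) = real_of_int (k + 1) / 2 + real_of_int (- w)"
        using wt by (simp add: k algebra_simps)
      ultimately show "quad_gen D * Complex (1/2) t \<in> ?L"
        by (simp only: half_mem_iff) (intro exI[of _ "k + 1"] exI[of _ "- w"], simp)
    qed
    show "quad_order D \<subseteq> multipliers ?L"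
      unfolding quad_order_def using gen subring_multipliers(2,3,5) by blast
  qed
  then show ?thesis by (simp add: t_def r_def)
qed

text \<open>The rhombic lattice is also the centred rectangular lattice with sides 1 and 2 t. A
  quarter turn combined with scaling by 1 / (2 t) interchanges the directions of the sides and gives
  the sides 1 and 1 / (2 t).\<close>

lemma half_lattice_swap:
  assumes t: "t > 0"
  shows "\<exists>c. c \<noteq> 0 \<and> half_lattice (1 / (4 * t)) = (*) c ` half_lattice t"
proof (intro exI conjI)
  let ?c = "Complex 0 (1 / (2 * t))" and ?\<tau> = "Complex (1/2) (1 / (4 * t))"
  show "?c \<noteq> 0" using t by (simp add: complex_eq_iff)
  have e: "?c * Complex (1/2) t = ?\<tau> - 1" "?c * 1 = 2 * ?\<tau> - 1"
    using t by (simp_all add: complex_eq_iff field_simps)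
  show "lattice_spanned ?\<tau> 1 = (*) ?c ` half_lattice t"
    unfolding scale_lattice_spanned e
  proof (intro subset_antisym lattice_spanned_subsetI)
    show "?\<tau> \<in> lattice_spanned (?\<tau> - 1) (2 * ?\<tau> - 1)" by (rule lattice_spanned_memI[of _ "-1" _ 1]) simp
    show "1 \<in> lattice_spanned (?\<tau> - 1) (2 * ?\<tau> - 1)" by (rule lattice_spanned_memI[of _ "-2" _ 1]) (simp add: algebra_simps)
    show "?\<tau> - 1 \<in> lattice_spanned ?\<tau> 1" by (rule lattice_spanned_memI[of _ 1 _ "-1"]) simp
    show "2 * ?\<tau> - 1 \<in> lattice_spanned ?\<tau> 1" by (rule lattice_spanned_memI[of _ 2 _ "-1"]) simp
  qed
qed

lemma real_quad_order_iff:
  assumes L: "is_lattice L" and D: "D < 0" "[D = 1] (mod 4)"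
  shows "lattice_j L \<in> \<real> \<and> multipliers L = quad_order D \<longleftrightarrow>
    (\<exists>\<beta>::int. \<beta> > 0 \<and> saturated_divisor \<beta> D \<and> real_of_int \<beta> < sqrt \<bar>real_of_int D\<bar> \<and>
      lattice_j L = lattice_j (half_lattice (sqrt \<bar>real_of_int D\<bar> / (2 * real_of_int \<beta>))))"
    (is "?l \<longleftrightarrow> ?r")
proof
  define r where "r = sqrt \<bar>real_of_int D\<bar>"
  have r: "r > 0" "r * r = - real_of_int D" using D(1) by (simp_all add: r_def)
  let ?half = "\<lambda>t. half_lattice t"
  assume l: ?l
  then obtain s where s: "s \<noteq> 0" "cnj ` L = (*) s ` L" using lattice_j_real_iff[OF L] by blast
  obtain c where c: "c \<noteq> 0" "cnj ` ((*) c ` L) = (*) c ` L"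
    using make_cnj_stable[OF L s D(1)] l by blast
  obtain c' \<tau> where \<tau>: "c' \<noteq> 0" "Im \<tau> > 0" "Re \<tau> = 0 \<or> Re \<tau> = 1/2" "(*) c ` L = (*) c' ` lattice_spanned \<tau> 1"
    using cnj_stable_normal_form[OF is_lattice_scale[OF L c(1)] c(2)] by blast
  have mult: "multipliers (lattice_spanned \<tau> 1) = quad_order D"
    using l multipliers_scale[OF c(1), of L] multipliers_scale[OF \<tau>(1), of "lattice_spanned \<tau> 1"] \<tau>(4) by simp
  have j: "lattice_j L = lattice_j (lattice_spanned \<tau> 1)"
    using lattice_j_scale[OF c(1), of L] lattice_j_scale[OF \<tau>(1), of "lattice_spanned \<tau> 1"] \<tau>(4) by simp
  \<comment> \<open>If Re \<tau> = 0, all elements of the lattice have integral real part, whereas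
    \<open>quad_gen D\<close> has real part 1/2.\<close>
  have "Re \<tau> \<noteq> 0"
  proof
    assume re: "Re \<tau> = 0"
    have "quad_gen D \<in> quad_order D" by (rule quad_order_memI[of _ 0 1]) simp
    then have "quad_gen D \<in> lattice_spanned \<tau> 1" unfolding mult[symmetric] multipliers_tau_iff by simp
    then obtain m n :: int where "quad_gen D = of_int m * \<tau> + of_int n * 1" unfolding lattice_spanned_def by blast
    from arg_cong[OF this, of Re] have "1/2 = real_of_int n" using re by (simp add: quad_gen_def)
    then have "1 = real_of_int (2 * n)" by simp
    then have "1 = 2 * n" by linarith
    then show False by presburger
  qed
  then have "\<tau> = Complex (1/2) (Im \<tau>)" using \<tau>(3) by (simp add: complex_eq_iff)
  then obtain t where t: "t > 0" "\<tau> = Complex (1/2) t" using \<tau>(2) by blast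
  obtain \<beta> :: int where \<beta>: "\<beta> > 0" "saturated_divisor \<beta> D" "t = r / (2 * real_of_int \<beta>)"
    using half_multipliers_saturated[OF t(1) D] mult unfolding t(2) r_def by blast
  show ?r
  proof (cases "real_of_int \<beta> < r")
    case True
    have "lattice_j L = lattice_j (?half (r / (2 * real_of_int \<beta>)))" using j unfolding t(2) \<beta>(3) .
    with \<beta>(1,2) True show ?thesis unfolding r_def by (intro exI[of _ \<beta>] conjI)
  next
    case False
    \<comment> \<open>When \<beta> is too large, the complementary divisor serves: the homothety
      taking t to 1 / (4 t) replaces \<beta> by \<gamma>, and \<gamma> < r because \<beta> \<gamma>
      = r^2 with unequal factors.\<close>
    define \<gamma> where "\<gamma> = - D div \<beta>"
    have \<gamma>: "\<gamma> > 0" "saturated_divisor \<gamma> D" "\<beta> * \<gamma> = - D"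
      unfolding \<gamma>_def by (rule saturated_divisor_cofactor[OF D(1) \<beta>(1,2)])+
    have bg: "real_of_int \<beta> * \<gamma> = r * r" using \<gamma>(3) r(2) by (metis of_int_minus of_int_mult)
    have "\<gamma> \<noteq> \<beta>" using \<gamma>(3) square_neq_minus[OF D(2), of \<beta>] by metis
    have "real_of_int \<gamma> < r"
    proof (rule ccontr)
      assume "\<not> real_of_int \<gamma> < r"
      then have "r \<le> \<gamma>" "r \<le> \<beta>" using False by auto
      then have "r * r \<le> r * \<gamma>" "r * \<gamma> \<le> \<beta> * \<gamma>" using r(1) \<gamma>(1) by (auto intro: mult_left_mono mult_right_mono)
      then have "r * \<gamma> = r * r" "r * \<gamma> = \<beta> * \<gamma>" using bg by auto
      then have "real_of_int \<gamma> = r" "r = \<beta>" using r(1) \<gamma>(1) by auto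
      then have "\<gamma> = \<beta>" by (metis of_int_eq_iff)
      with \<open>\<gamma> \<noteq> \<beta>\<close> show False ..
    qed
    moreover have "lattice_j L = lattice_j (?half (r / (2 * real_of_int \<gamma>)))"
    proof -
      have "1 / (4 * t) = r / (2 * real_of_int \<gamma>)"
      proof -
        have "1 / (4 * t) = real_of_int \<beta> / (2 * r)" unfolding \<beta>(3) by simp
        also have "\<dots> = r / (2 * real_of_int \<gamma>)"
          by (rule frac_eq_eq[THEN iffD2]) (use r(1) \<gamma>(1) bg in auto)
        finally show ?thesis .
      qed
      moreover obtain s where s: "s \<noteq> 0" "?half (1 / (4 * t)) = (*) s ` ?half t"
        using half_lattice_swap[OF t(1)] by (elim exE conjE) (rule that)
      have "lattice_j (?half (1 / (4 * t))) = lattice_j (?half t)"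
        unfolding s(2) by (rule lattice_j_scale[OF s(1)])
      ultimately show ?thesis using j unfolding t(2) by (simp only:)
    qed
    ultimately show ?thesis using \<gamma>(1,2) unfolding r_def by (intro exI[of _ \<gamma>] conjI)
  qed
next
  assume ?r
  then obtain \<beta> :: int where \<beta>: "\<beta> > 0" "saturated_divisor \<beta> D"
    and j: "lattice_j L = lattice_j (half_lattice (sqrt \<bar>real_of_int D\<bar> / (2 * real_of_int \<beta>)))"
    by (elim exE conjE) (rule that)
  have t: "sqrt \<bar>real_of_int D\<bar> / (2 * real_of_int \<beta>) > 0" using D(1) \<beta>(1) by simp
  obtain s where s: "s \<noteq> 0"
    "half_lattice (sqrt \<bar>real_of_int D\<bar> / (2 * real_of_int \<beta>)) = (*) s ` L"
    using j lattice_j_eq_iff[OF L is_lattice_half[OF t]] by blast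
  have "lattice_j L \<in> \<real>" unfolding j by (rule lattice_j_half_real)
  moreover have "multipliers L = quad_order D"
    using half_multipliers_eq[OF D \<beta>] multipliers_scale[OF s(1), of L] s(2) by simp
  ultimately show ?l ..
qed

lemma elliptic_curve_cases:
  assumes "elliptic_curve E"
  obtains L where "is_lattice L" "E = complex_ring A_Mod L" "j_invariant E = lattice_j L"
  using assms j_invariant_A_Mod unfolding elliptic_curve_def by blast

lemma CM_real_j_iff:
  assumes E: "elliptic_curve E" "j_invariant E \<in> \<real>" and D: "D < 0" "[D = 1] (mod 4)"
  shows "has_CM E \<and> is_order_of_discriminant (End E) D \<longleftrightarrow>
    (\<exists>\<beta>::int. \<beta> > 0 \<and> saturated_divisor \<beta> D \<and> real_of_int \<beta> < sqrt \<bar>real_of_int D\<bar> \<and>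
      j_invariant E = modular_j (Complex (1/2) (sqrt \<bar>real_of_int D\<bar> / (2 * real_of_int \<beta>))))"
proof -
  obtain L where L: "is_lattice L" "E = complex_ring A_Mod L" "j_invariant E = lattice_j L"
    using E(1) by (rule elliptic_curve_cases)
  have "has_CM E \<and> is_order_of_discriminant (End E) D \<longleftrightarrow> lattice_j L \<in> \<real> \<and> multipliers L = quad_order D"
    unfolding L(2) has_CM_order_iff[OF is_lattice_imp_complex_lattice[OF L(1)] D] using E(2) L(3) by simp
  then show ?thesis unfolding L(3) modular_j_eq real_quad_order_iff[OF L(1) D] .
qed

lemma real_CM_j_invariants_eq:
  assumes D: "D < 0" "[D = 1] (mod 4)"
  shows "real_CM_j_invariants D = (\<lambda>\<beta>. j_half (sqrt \<bar>real_of_int D\<bar> / (2 * real_of_int \<beta>))) `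
    {\<beta>::int. \<beta> > 0 \<and> saturated_divisor \<beta> D \<and> real_of_int \<beta> < sqrt \<bar>real_of_int D\<bar>}"
    (is "_ = ?f ` ?S")
proof
  show "real_CM_j_invariants D \<subseteq> ?f ` ?S"
  proof
    fix x assume "x \<in> real_CM_j_invariants D"
    then obtain E where E: "elliptic_curve E" "j_invariant E = of_real x" "has_CM E \<and> is_order_of_discriminant (End E) D"
      unfolding real_CM_j_invariants_def by blast
    then have "j_invariant E \<in> \<real>" by simp
    then obtain \<beta> :: int where \<beta>: "\<beta> \<in> ?S" "j_invariant E = modular_j (Complex (1/2) (sqrt \<bar>real_of_int D\<bar> / (2 * real_of_int \<beta>)))"
      using CM_real_j_iff[OF E(1) _ D] E(3) by blast
    then have "complex_of_real x = of_real (?f \<beta>)"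
      using E(2) unfolding modular_j_eq of_real_j_half by simp
    then have "x = ?f \<beta>" by (simp only: of_real_eq_iff)
    then show "x \<in> ?f ` ?S" using \<beta>(1) by (rule image_eqI)
  qed
  show "?f ` ?S \<subseteq> real_CM_j_invariants D"
  proof
    fix x assume "x \<in> ?f ` ?S"
    then obtain \<beta> where \<beta>: "x = ?f \<beta>" "\<beta> \<in> ?S" by (rule imageE)
    define t where "t = sqrt \<bar>real_of_int D\<bar> / (2 * real_of_int \<beta>)"
    define E where "E = complex_ring A_Mod half_lattice t"
    have "t > 0" using \<beta>(2) D(1) by (simp add: t_def)
    then have E: "elliptic_curve E" unfolding E_def elliptic_curve_def using is_lattice_half by blast
    have jE: "j_invariant E = modular_j (Complex (1/2) t)" by (simp add: E_def modular_j_def)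
    then have "j_invariant E = of_real x"
      unfolding modular_j_eq \<beta>(1) of_real_j_half t_def by simp
    moreover from this have "j_invariant E \<in> \<real>" by simp
    then have "has_CM E \<and> is_order_of_discriminant (End E) D"
      using CM_real_j_iff[OF E _ D] \<beta>(2) jE unfolding t_def by blast
    ultimately show "x \<in> real_CM_j_invariants D" unfolding real_CM_j_invariants_def using E by blast
  qed
qed

theorem theorem7p3:
  fixes D :: int
  assumes "D < 0" and "[D = 1] (mod 4)"
  shows
    "(\<forall>E. elliptic_curve E \<and> j_invariant E \<in> \<real> \<longrightarrow>
        (has_CM E \<and> is_order_of_discriminant (End E) D \<longleftrightarrow>
         (\<exists>\<beta>::int. \<beta> > 0 \<and> saturated_divisor \<beta> D \<and>
            real_of_int \<beta> < sqrt \<bar>real_of_int D\<bar> \<and>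
            j_invariant E =
              modular_j (Complex (1/2) (sqrt \<bar>real_of_int D\<bar> / (2 * real_of_int \<beta>)))))) \<and>
     card (real_CM_j_invariants D) = 2 ^ (card {p::nat. normalization_semidom_class.prime p \<and> int p dvd D} - 1) \<and>
     modular_j (Complex (1/2) (sqrt \<bar>real_of_int D\<bar> / 2)) \<in> \<real> \<and>
     real_CM_j_invariants D \<subseteq>
       {Re (modular_j (Complex (1/2) (sqrt \<bar>real_of_int D\<bar> / 2))) ..< 1728}"
proof (intro conjI)
  let ?S = "{\<beta>::int. \<beta> > 0 \<and> saturated_divisor \<beta> D \<and> real_of_int \<beta> < sqrt \<bar>real_of_int D\<bar>}"
  let ?t = "\<lambda>\<beta>. sqrt \<bar>real_of_int D\<bar> / (2 * real_of_int \<beta>)"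
  \<comment> \<open>\<beta> < sqrt |D| says t > 1/2, where \<open>j_half\<close> is injective and
    below 1728; \<beta> \<ge> 1 bounds t by its value at \<beta> = 1, where the decreasing
    \<open>j_half\<close> takes the lower end of the interval.\<close>
  have t: "1/2 < ?t \<beta>" "?t \<beta> \<le> sqrt \<bar>real_of_int D\<bar> / 2" if "\<beta> \<in> ?S" for \<beta>
  proof -
    have b: "1 \<le> real_of_int \<beta>" "real_of_int \<beta> < sqrt \<bar>real_of_int D\<bar>" using that by auto
    show "1/2 < ?t \<beta>" using b by (simp add: field_simps)
    show "?t \<beta> \<le> sqrt \<bar>real_of_int D\<bar> / 2" using b by (intro divide_left_mono) auto
  qed
  show "\<forall>E. elliptic_curve E \<and> j_invariant E \<in> \<real> \<longrightarrow>
        (has_CM E \<and> is_order_of_discriminant (End E) D \<longleftrightarrow>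
         (\<exists>\<beta>::int. \<beta> > 0 \<and> saturated_divisor \<beta> D \<and>
            real_of_int \<beta> < sqrt \<bar>real_of_int D\<bar> \<and>
            j_invariant E =
              modular_j (Complex (1/2) (sqrt \<bar>real_of_int D\<bar> / (2 * real_of_int \<beta>)))))"
    by (intro allI impI, elim conjE) (rule CM_real_j_iff[OF _ _ assms])
  have inj: "inj_on (\<lambda>\<beta>. j_half (?t \<beta>)) ?S"
  proof (rule inj_onI)
    fix \<beta> \<gamma> assume b: "\<beta> \<in> ?S" "\<gamma> \<in> ?S" "j_half (?t \<beta>) = j_half (?t \<gamma>)"
    have "?t \<beta> = ?t \<gamma>"
      by (rule j_half_inj[OF less_imp_le[OF t(1)[OF b(1)]] less_imp_le[OF t(1)[OF b(2)]] b(3)])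
    moreover have "sqrt \<bar>real_of_int D\<bar> \<noteq> 0" using assms(1) by simp
    ultimately show "\<beta> = \<gamma>" by (simp add: divide_cancel_left)
  qed
  show "card (real_CM_j_invariants D) = 2 ^ (card {p::nat. normalization_semidom_class.prime p \<and> int p dvd D} - 1)"
    unfolding real_CM_j_invariants_eq[OF assms] card_image[OF inj]
    by (rule card_small_saturated_divisors[OF assms])
  show "modular_j (Complex (1/2) (sqrt \<bar>real_of_int D\<bar> / 2)) \<in> \<real>"
    unfolding modular_j_eq by (rule lattice_j_half_real)
  have "Re (modular_j (Complex (1/2) (sqrt \<bar>real_of_int D\<bar> / 2))) = j_half (sqrt \<bar>real_of_int D\<bar> / 2)"
    unfolding modular_j_eq j_half_def ..
  then show "real_CM_j_invariants D \<subseteq>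
       {Re (modular_j (Complex (1/2) (sqrt \<bar>real_of_int D\<bar> / 2))) ..< 1728}"
    unfolding real_CM_j_invariants_eq[OF assms] using j_half_bounds[OF t] by auto
qed

end
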